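(* Let $2\le n\le \omega$. The set $\mathcal H(I^n)$ of all homogeneous continua in $I^n$ is a $\Sigma^1_1$-subset (i.e. an analytic subset) of the hyperspace $C(I^n)$, and the space $\mathcal H(I^n)$ contains a closed subset (closed relative to $\mathcal H(I^n)$) homeomorphic to $c_0=\{(x_k)\in\mathbb R^\omega:\lim x_k=0\}$. Consequently, $\mathcal H(I^n)$ is not a $G_{\delta\sigma}$-subset of $C(I^n)$.
   Context: $I=[0,1]$; $I^n$ for finite $n$ is the $n$-dimensional cube and $I^\omega$ is the Hilbert cube (countable product with the product topology). A continuum is a nonempty compact connected metrizable space (a single point is allowed). For a Polish space $(X,d)$, $2^X$ is the hyperspace of all nonempty compact subsets of $X$ with the Hausdorff metric $H_d$, and $C(X)\subset 2^X$ is the subspace of all subcontinua of $X$. A continuum $X$ is homogeneous if for every two points $x,y\in X$ there is a homeomorphism $h:X\to X$ (onto $X$) with $h(x)=y$. $\mathcal H(I^n)$ is the subspace of $C(I^n)$ consisting of all homogeneous continua contained in $I^n$. The space $c_0$ carries the topology inherited from the product topology on $\mathbb R^\omega$ (not the norm topology). A $G_{\delta\sigma}$-set is a countable union of $G_\delta$-sets. *)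

theory Defs
  imports "HOL-Analysis.Analysis"
begin

text \<open>
  The type \<^typ>\<open>nat \<Rightarrow> real\<close> carries the product topology, and its \<^const>\<open>dist\<close> induces that
  topology. The \<open>n\<close>-dimensional cube, \<open>n \<le> \<omega>\<close> (written \<^term>\<open>\<infinity>::enat\<close>), is realised
  in it by setting all coordinates from \<open>n\<close> on to zero.
\<close>

definition cube :: "enat \<Rightarrow> (nat \<Rightarrow> real) set" where
  "cube n = {x. (\<forall>i. 0 \<le> x i \<and> x i \<le> 1) \<and> (\<forall>i. n \<le> enat i \<longrightarrow> x i = 0)}"

lemma cube_homeomorphic_product:
  "top_of_set (cube n) homeomorphic_space
     product_topology (\<lambda>_. top_of_set {0..1::real}) {i. enat i < n}"
proof -
  let ?I = "{i. enat i < n}"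
  let ?P = "product_topology (\<lambda>_. top_of_set {0..1::real}) ?I"
  let ?f = "\<lambda>x::nat \<Rightarrow> real. restrict x ?I"
  let ?g = "\<lambda>(x::nat \<Rightarrow> real) i. if enat i < n then x i else 0"
  have f: "continuous_map (top_of_set (cube n)) ?P ?f"
    by (auto simp: continuous_map_componentwise continuous_map_in_subtopology cube_def
        intro: continuous_on_subset[OF continuous_on_product_coordinates])
  have g1: "continuous_map ?P euclideanreal (\<lambda>x. if enat i < n then x i else 0)" for i
  proof (cases "enat i < n")
    case True
    then show ?thesis
      using continuous_map_product_projection[of i ?I "\<lambda>_. top_of_set {0..1::real}"]
      by (simp add: continuous_map_in_subtopology)
  qed simp
  have "continuous_map ?P (product_topology (\<lambda>_. euclideanreal) UNIV) ?g"
    unfolding continuous_map_componentwise_UNIV using g1 by blast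
  then have g: "continuous_map ?P (top_of_set (cube n)) ?g"
    by (auto simp: continuous_map_in_subtopology euclidean_product_topology cube_def PiE_iff)
  have "homeomorphic_maps (top_of_set (cube n)) ?P ?f ?g"
    unfolding homeomorphic_maps_def using f g
    by (force simp: cube_def PiE_iff extensional_def not_less fun_eq_iff)
  then show ?thesis
    by (auto simp: homeomorphic_space_def)
qed

text \<open>
  The value on empty or unbounded sets is irrelevant for hyperspaces of compacta; it is set to zero
  because the locale \<^locale>\<open>Metric_space\<close> asks for a nonnegative symmetric function on the
  whole type.
\<close>

definition hausdorff_dist :: "'a::metric_space set \<Rightarrow> 'a set \<Rightarrow> real" where
  "hausdorff_dist A B =
     (if A \<noteq> {} \<and> B \<noteq> {} \<and> bounded A \<and> bounded B
      then max (SUP a\<in>A. infdist a B) (SUP b\<in>B. infdist b A) else 0)"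

definition nonempty_compacts :: "'a::topological_space set \<Rightarrow> 'a set set" where
  "nonempty_compacts X = {K. K \<subseteq> X \<and> K \<noteq> {} \<and> compact K}"

definition hyperspace :: "'a::metric_space set \<Rightarrow> 'a set topology" where
  "hyperspace X = Metric_space.mtopology (nonempty_compacts X) hausdorff_dist"

definition subcontinua :: "'a::topological_space set \<Rightarrow> 'a set set" where
  "subcontinua X = {K \<in> nonempty_compacts X. connected K}"

definition continuum_hyperspace :: "'a::metric_space set \<Rightarrow> 'a set topology" where
  "continuum_hyperspace X = subtopology (hyperspace X) (subcontinua X)"

lemma bdd_above_infdist:
  assumes "bounded A" "B \<noteq> {}" shows "bdd_above ((\<lambda>a. infdist a B) ` A)"
proof -
  obtain b where b: "b \<in> B" using assms by blast
  obtain e where e: "\<forall>a\<in>A. dist b a \<le> e" using assms by (meson bounded_any_center)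
  show ?thesis
    by (rule bdd_aboveI2[where M = e]) (metis b e infdist_le2 dist_commute)
qed

lemma infdist_le_hausdorff_dist:
  assumes "a \<in> A" "B \<noteq> {}" "bounded A" "bounded B"
  shows "infdist a B \<le> hausdorff_dist A B"
proof -
  have "infdist a B \<le> (SUP a\<in>A. infdist a B)"
    using assms by (intro cSUP_upper bdd_above_infdist)
  then show ?thesis using assms by (auto simp: hausdorff_dist_def)
qed

lemma hausdorff_dist_commute: "hausdorff_dist A B = hausdorff_dist B A"
  by (auto simp: hausdorff_dist_def max.commute)

lemma hausdorff_dist_nonneg: "0 \<le> hausdorff_dist A B"
proof (cases "A \<noteq> {} \<and> B \<noteq> {} \<and> bounded A \<and> bounded B")
  case True
  then obtain a where "a \<in> A" by blast
  then show ?thesis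
    using infdist_le_hausdorff_dist[of a A B] infdist_nonneg[of a B] True by linarith
next
  case False
  then show ?thesis by (simp only: hausdorff_dist_def if_False)
qed

lemma hausdorff_dist_leI:
  assumes "A \<noteq> {}" "B \<noteq> {}" "bounded A" "bounded B"
    and "\<And>a. a \<in> A \<Longrightarrow> infdist a B \<le> r" "\<And>b. b \<in> B \<Longrightarrow> infdist b A \<le> r"
  shows "hausdorff_dist A B \<le> r"
  using assms by (auto simp: hausdorff_dist_def intro!: cSUP_least)

lemma infdist_triangle_hausdorff:
  assumes "a \<in> A" "B \<noteq> {}" "C \<noteq> {}" "bounded A" "bounded B" "bounded C"
  shows "infdist a C \<le> hausdorff_dist A B + hausdorff_dist B C"
proof -
  have "infdist a C - hausdorff_dist B C \<le> dist a b" if "b \<in> B" for b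
    using infdist_triangle[of a C b] infdist_le_hausdorff_dist[of b B C] assms that by linarith
  then have "infdist a C - hausdorff_dist B C \<le> infdist a B"
    using assms by (auto simp: infdist_notempty intro: cINF_greatest)
  then show ?thesis
    using infdist_le_hausdorff_dist[of a A B] assms by linarith
qed

lemma Metric_space_hausdorff_dist:
  "Metric_space (nonempty_compacts X) (hausdorff_dist :: 'a::metric_space set \<Rightarrow> _)"
proof
  fix A B :: "'a set"
  show "0 \<le> hausdorff_dist A B" by (rule hausdorff_dist_nonneg)
  show "hausdorff_dist A B = hausdorff_dist B A" by (rule hausdorff_dist_commute)
next
  fix A B :: "'a set"
  assume AB: "A \<in> nonempty_compacts X" "B \<in> nonempty_compacts X"
  then have *: "A \<noteq> {}" "B \<noteq> {}" "bounded A" "bounded B" "closed A" "closed B"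
    by (auto simp: nonempty_compacts_def compact_imp_bounded compact_imp_closed)
  show "hausdorff_dist A B = 0 \<longleftrightarrow> A = B"
  proof
    assume 0: "hausdorff_dist A B = 0"
    have "a \<in> B" if "a \<in> A" for a
      using infdist_le_hausdorff_dist[of a A B] infdist_nonneg[of a B] 0 * that
      by (simp add: in_closed_iff_infdist_zero)
    moreover have "b \<in> A" if "b \<in> B" for b
      using infdist_le_hausdorff_dist[of b B A] infdist_nonneg[of b A] 0 * that
      by (simp add: in_closed_iff_infdist_zero hausdorff_dist_commute[of B A])
    ultimately show "A = B" by blast
  next
    assume "A = B"
    then have "hausdorff_dist A B \<le> 0" using * by (intro hausdorff_dist_leI) auto
    then show "hausdorff_dist A B = 0" using hausdorff_dist_nonneg[of A B] by linarith
  qed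
next
  fix A B C :: "'a set"
  assume "A \<in> nonempty_compacts X" "B \<in> nonempty_compacts X" "C \<in> nonempty_compacts X"
  then have *: "A \<noteq> {}" "B \<noteq> {}" "C \<noteq> {}" "bounded A" "bounded B" "bounded C"
    by (auto simp: nonempty_compacts_def compact_imp_bounded)
  show "hausdorff_dist A C \<le> hausdorff_dist A B + hausdorff_dist B C"
  proof (rule hausdorff_dist_leI)
    show "infdist a C \<le> hausdorff_dist A B + hausdorff_dist B C" if "a \<in> A" for a
      using that * by (intro infdist_triangle_hausdorff)
    show "infdist c A \<le> hausdorff_dist A B + hausdorff_dist B C" if "c \<in> C" for c
      using infdist_triangle_hausdorff[of c C B A] that *
      by (simp add: hausdorff_dist_commute[of C B] hausdorff_dist_commute[of B A])
  qed (use * in auto)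
qed

lemma topspace_hyperspace [simp]: "topspace (hyperspace X) = nonempty_compacts X"
  by (simp add: hyperspace_def Metric_space.topspace_mtopology[OF Metric_space_hausdorff_dist])

lemma topspace_continuum_hyperspace [simp]: "topspace (continuum_hyperspace X) = subcontinua X"
  by (auto simp: continuum_hyperspace_def subcontinua_def)

definition homogeneous :: "'a::topological_space set \<Rightarrow> bool" where
  "homogeneous K \<longleftrightarrow> (\<forall>x\<in>K. \<forall>y\<in>K. \<exists>h g. homeomorphism K K h g \<and> h x = y)"

definition homogeneous_continua :: "'a::topological_space set \<Rightarrow> 'a set set" where
  "homogeneous_continua X = {K \<in> subcontinua X. homogeneous K}"

definition Polish_space :: "'a topology \<Rightarrow> bool" where
  "Polish_space Y \<longleftrightarrow> completely_metrizable_space Y \<and> second_countable Y"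

text \<open>
  A set is analytic if it is a continuous image of a Polish space. Taking the Polish space to have
  its points in \<^typ>\<open>nat \<Rightarrow> real\<close> is no restriction, since every Polish space is homeomorphic
  to a subspace of the countable product of lines.
\<close>

definition analytic_in :: "'a topology \<Rightarrow> 'a set \<Rightarrow> bool" where
  "analytic_in X A \<longleftrightarrow>
     (\<exists>(Y :: (nat \<Rightarrow> real) topology) f.
        Polish_space Y \<and> continuous_map Y X f \<and> f ` topspace Y = A)"

definition gdelta_sigma_in :: "'a topology \<Rightarrow> 'a set \<Rightarrow> bool" where
  "gdelta_sigma_in X = countable union_of gdelta_in X"

definition c0 :: "(nat \<Rightarrow> real) set" where
  "c0 = {x. x \<longlonglongrightarrow> 0}"

end

theory Submission
  imports Defs
begin

text \<open>
  Analyticity. If \<open>K\<close> is a homogeneous continuum, the Baire category theorem shows that nearby points of \<open>K\<close>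
  can be moved arbitrarily close to each other by homeomorphisms of \<open>K\<close> close to the identity. Conversely, Ancel's
  back-and-forth argument turns such approximate moves into exact ones, so orbits are open and, \<open>K\<close> being
  connected, \<open>K\<close> is homogeneous. Unlike homogeneity itself, the approximate condition has countable witnesses:
  homeomorphisms and moduli of continuity, recorded on a dense sequence of \<open>K\<close>. The codes of this kind form a
  \<open>G\<^sub>\<delta>\<close> set, and \<open>K\<close> depends continuously on its code.

  The copy of \<open>c\<^sub>0\<close>. A triangle whose base carries a sequence of peaks converging to a vertex is a simple closed
  curve iff the heights of the peaks tend to zero and no peak touches the hypotenuse. Otherwise some point has no
  neighbourhood homeomorphic to an open set of reals, whereas interior points of the hypotenuse always have one, so
  the curve is not homogeneous. Since the curve contains the edge along which the peaks accumulate, it depends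
  continuously on the heights in the product topology. As the heights range over a compact cube, the homogeneous
  members of the family form a closed subset of the space of homogeneous continua.

  That \<open>c\<^sub>0\<close> is not \<open>G\<^sub>\<delta>\<^sub>\<sigma>\<close> is a diagonal argument: in a box that prescribes finitely many
  coordinates and bounds the others by \<open>c > 0\<close>, no \<open>G\<^sub>\<delta>\<close> subset of \<open>c\<^sub>0\<close> is dense, since the
  points with infinitely many coordinates above \<open>c/2\<close> are comeager.
\<close>

section \<open>Orbits under homeomorphisms close to the identity\<close>

text \<open>Taken literally, homogeneity puts an existential quantifier over functions behind a
  universal one over uncountably many pairs of points, and a formula of this shape does not by
  itself exhibit an analytic set. Compactness removes the obstacle: for a prescribed accuracy,
  finitely many homeomorphisms bring all points near \<open>y\<close> close to \<open>y\<close>. So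
  countably many witnesses suffice, and the recorded bound on their number lets a condition on a
  dense sequence carry over to the whole continuum.

  In the second half, closedness of the copy of \<open>c0\<close> comes from a compact parameter
  space, so the heights must range over closed intervals, whereas no homeomorphism carries a closed
  interval onto the line. Letting a peak of full height touch the hypotenuse, which destroys
  homogeneity, discards the end values; what remains is \<open>unit_c0\<close>, which a map acting
  on each coordinate identifies with \<open>c0\<close>.\<close>

lemma uniform_limit_geometric:
  fixes u :: "nat \<Rightarrow> 'a \<Rightarrow> 'b::complete_space"
  assumes "\<And>k x. x \<in> K \<Longrightarrow> dist (u (Suc k) x) (u k x) \<le> (1/2)^k"
  obtains f where "uniform_limit K u f sequentially"
proof -
  have *: "dist (u (n + i) x) (u n x) \<le> 2 * ((1/2)^n - (1/2)^(n+i))" if "x \<in> K" for n i x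
  proof (induction i)
    case (Suc i)
    have "dist (u (n + Suc i) x) (u n x) \<le> dist (u (Suc (n+i)) x) (u (n+i) x) + dist (u (n+i) x) (u n x)"
      by (simp add: dist_triangle)
    also have "\<dots> \<le> (1/2)^(n+i) + 2 * ((1/2)^n - (1/2)^(n+i))"
      by (intro add_mono assms that Suc)
    also have "\<dots> = 2 * ((1/2)^n - (1/2)^(n+Suc i))" by simp
    finally show ?case .
  qed simp
  have "\<exists>N. \<forall>x\<in>K. \<forall>m\<ge>N. \<forall>n\<ge>N. dist (u m x) (u n x) < e" if "e > 0" for e :: real
  proof -
    have "e/4 > 0" "(1/2::real) < 1" using that by auto
    then obtain N where N: "(1/2::real)^N < e/4"
      using real_arch_pow_inv by blast
    have **: "dist (u m x) (u N x) < e/2" if "x \<in> K" "m \<ge> N" for x m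
    proof -
      have "dist (u (N + (m-N)) x) (u N x) \<le> 2 * ((1/2)^N - (1/2)^(N+(m-N)))"
        by (rule *[OF that(1)])
      also have "\<dots> \<le> 2 * (1/2)^N" by simp
      also have "\<dots> < e/2" using N by simp
      finally show ?thesis using that by simp
    qed
    show ?thesis
      by (intro exI[of _ N] ballI allI impI) (meson ** dist_triangle_half_l)
  qed
  then have "uniformly_Cauchy_on K u" by (auto simp: uniformly_Cauchy_on_def)
  then show ?thesis
    using that by (metis Cauchy_uniformly_convergent uniformly_convergent_on_def)
qed

text \<open>A uniform limit of homeomorphisms may fail to be injective; here the inverses are
  controlled as well, so that both sequences converge uniformly and their limits undo each
  other.\<close>

lemma homeomorphism_limit:
  fixes K :: "'a::complete_space set"
  assumes "compact K" and uv: "\<And>k. homeomorphism K K (u k) (v k)"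
    and u: "\<And>k x. x \<in> K \<Longrightarrow> dist (u (Suc k) x) (u k x) \<le> (1/2)^k"
    and v: "\<And>k x. x \<in> K \<Longrightarrow> dist (v (Suc k) x) (v k x) \<le> (1/2)^k"
  obtains f g where "homeomorphism K K f g" "\<And>x. x \<in> K \<Longrightarrow> (\<lambda>k. u k x) \<longlonglongrightarrow> f x"
proof -
  have cl: "closed K" using assms(1) compact_imp_closed by blast
  obtain f where f: "uniform_limit K u f sequentially" using uniform_limit_geometric[of K u] u by blast
  obtain g where g: "uniform_limit K v g sequentially" using uniform_limit_geometric[of K v] v by blast
  have cf: "continuous_on K f"
    by (rule uniform_limit_theorem[OF _ f]) (use uv in \<open>auto simp: homeomorphism_def\<close>)
  have cg: "continuous_on K g"
    by (rule uniform_limit_theorem[OF _ g]) (use uv in \<open>auto simp: homeomorphism_def\<close>)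
  have pf: "(\<lambda>k. u k x) \<longlonglongrightarrow> f x" if "x \<in> K" for x using f that tendsto_uniform_limitI by metis
  have pg: "(\<lambda>k. v k x) \<longlonglongrightarrow> g x" if "x \<in> K" for x using g that tendsto_uniform_limitI by metis
  have uK: "u k x \<in> K" "v k x \<in> K" if "x \<in> K" for k x
    using uv[of k] that by (auto simp: homeomorphism_def)
  have fK: "f x \<in> K" if "x \<in> K" for x
    by (rule closed_sequentially[OF cl _ pf[OF that]]) (use uK that in auto)
  have gK: "g x \<in> K" if "x \<in> K" for x
    by (rule closed_sequentially[OF cl _ pg[OF that]]) (use uK that in auto)
  have comp: "G (F x) = x"
    if x: "x \<in> K" and G: "uniform_limit K b G sequentially" "continuous_on K G"
      and F: "(\<lambda>k. a k x) \<longlonglongrightarrow> F x" "F x \<in> K" and ab: "\<And>k. a k x \<in> K" "\<And>k. b k (a k x) = x"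
    for a b :: "nat \<Rightarrow> 'a \<Rightarrow> 'a" and F G x
  proof -
    have 1: "(\<lambda>k. G (a k x)) \<longlonglongrightarrow> G (F x)"
      using continuous_on_tendsto_compose[OF G(2) F(1) F(2)] ab by auto
    have "(\<lambda>k. dist (b k (a k x)) (G (a k x))) \<longlonglongrightarrow> 0"
    proof (rule tendstoI)
      fix e :: real assume "e > 0"
      then have "\<forall>\<^sub>F k in sequentially. \<forall>x\<in>K. dist (b k x) (G x) < e"
        using G(1) by (auto simp: uniform_limit_iff)
      then show "\<forall>\<^sub>F k in sequentially. dist (dist (b k (a k x)) (G (a k x))) 0 < e"
        by eventually_elim (use ab(1) in auto)
    qed
    then have "(\<lambda>k. dist x (G (a k x))) \<longlonglongrightarrow> 0" using ab by simp
    moreover have "(\<lambda>k. dist x (G (a k x))) \<longlonglongrightarrow> dist x (G (F x))"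
      by (intro tendsto_intros 1)
    ultimately show ?thesis using LIMSEQ_unique by fastforce
  qed
  have "homeomorphism K K f g"
  proof (rule homeomorphismI)
    show "g (f x) = x" if "x \<in> K" for x
      by (rule comp[where a=u and b=v]) (use that g cg pf fK uK uv in \<open>auto simp: homeomorphism_def\<close>)
    show "f (g x) = x" if "x \<in> K" for x
      by (rule comp[where a=v and b=u]) (use that f cf pg gK uK uv in \<open>auto simp: homeomorphism_def\<close>)
  qed (use cf cg fK gK in auto)
  then show ?thesis using that pf by blast
qed

text \<open>Writing \<open>G\<^sub>e\<close> for the set of self-homeomorphisms of \<open>K\<close> that move every point by at most \<open>e\<close>,
  this says that \<open>b\<close> lies in the closure of the partial orbit \<open>G\<^sub>e a\<close>.\<close>

definition near_orbit :: "'a::metric_space set \<Rightarrow> real \<Rightarrow> 'a \<Rightarrow> 'a \<Rightarrow> bool" where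
  "near_orbit K e a b \<longleftrightarrow>
     (\<forall>r>0. \<exists>h g. homeomorphism K K h g \<and> (\<forall>x\<in>K. dist (h x) x \<le> e) \<and> dist (h a) b < r)"

text \<open>An Effros property, weakened in that \<open>b\<close> need only be approached, but with
  \<open>d\<close> uniform over \<open>K\<close>; the back-and-forth argument applies it at points
  that keep moving.\<close>

definition weakly_microtransitive :: "'a::metric_space set \<Rightarrow> bool" where
  "weakly_microtransitive K \<longleftrightarrow>
     (\<forall>e>0. \<exists>d>0. \<forall>a\<in>K. \<forall>b\<in>K. dist a b < d \<longrightarrow> near_orbit K e a b)"

text \<open>A correction \<open>h\<close> changes \<open>u\<close> to \<open>h \<circ> u\<close> by
  no more than it moves points, but it changes the inverse \<open>v\<close> to
  \<open>v \<circ> g\<close> by an amount governed by the uniform continuity of \<open>v\<close>. So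
  the admissible size \<open>d\<close> depends on the homeomorphism to be corrected.\<close>

lemma small_left_factor:
  fixes K :: "'a::metric_space set"
  assumes K: "compact K" and uv: "homeomorphism K K u v" and e: "e > 0"
  obtains d where "d > 0"
    "\<And>h g x. \<lbrakk>homeomorphism K K h g; \<forall>x\<in>K. dist (h x) x \<le> d; x \<in> K\<rbrakk>
       \<Longrightarrow> dist (h (u x)) (u x) \<le> e \<and> dist (v (g x)) (v x) \<le> e"
proof -
  have "uniformly_continuous_on K v"
    using K uv compact_uniformly_continuous homeomorphism_def by metis
  then obtain d where d: "d > 0" "\<And>x y. x \<in> K \<Longrightarrow> y \<in> K \<Longrightarrow> dist y x < d \<Longrightarrow> dist (v y) (v x) < e"
    using e unfolding uniformly_continuous_on_def by meson
  show ?thesis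
  proof
    show "min e (d/2) > 0" using e d by auto
    fix h g x assume h: "homeomorphism K K h g" "\<forall>x\<in>K. dist (h x) x \<le> min e (d/2)" and x: "x \<in> K"
    have "u x \<in> K" "g x \<in> K" "h (g x) = x"
      using uv h x by (auto simp: homeomorphism_def)
    then have "dist (h (u x)) (u x) \<le> e" "dist x (g x) \<le> d/2"
      using h(2) by (auto dest: bspec[of _ _ "g x"])
    moreover have "dist (v (g x)) (v x) < e"
      by (rule d(2)) (use \<open>g x \<in> K\<close> x d(1) calculation(2) in \<open>auto simp: dist_commute\<close>)
    ultimately show "dist (h (u x)) (u x) \<le> e \<and> dist (v (g x)) (v x) \<le> e" by auto
  qed
qed

text \<open>Ancel's back-and-forth argument: two homeomorphisms are corrected alternately, bringing the
  image of \<open>a\<close> and the image of \<open>b\<close> together. Each correction may be taken as small as the homeomorphism to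
  be corrected demands, because the distance to the other image was fixed one step earlier.\<close>

lemma weakly_microtransitive_imp_locally_transitive:
  fixes K :: "'a::complete_space set"
  assumes K: "compact K" and wm: "weakly_microtransitive K"
  obtains d where "d > 0"
    "\<And>a b. \<lbrakk>a \<in> K; b \<in> K; dist a b < d\<rbrakk> \<Longrightarrow> \<exists>h g. homeomorphism K K h g \<and> h a = b"
proof -
  obtain D where D: "\<And>e. e > 0 \<Longrightarrow> D e > 0"
    and near: "\<And>e a b. \<lbrakk>e > 0; a \<in> K; b \<in> K; dist a b < D e\<rbrakk> \<Longrightarrow> near_orbit K e a b"
    using wm unfolding weakly_microtransitive_def by metis
  define small where "small P k e \<longleftrightarrow> e > 0 \<and> (\<forall>h g. \<forall>x\<in>K. homeomorphism K K h g \<longrightarrow>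
     (\<forall>x\<in>K. dist (h x) x \<le> e) \<longrightarrow> dist (h (fst P x)) (fst P x) \<le> (1/2)^k
       \<and> dist (snd P (g x)) (snd P x) \<le> (1/2)^k)"
    for P :: "('a \<Rightarrow> 'a) \<times> ('a \<Rightarrow> 'a)" and k :: nat and e :: real
  define hom where "hom P \<longleftrightarrow> homeomorphism K K (fst P) (snd P)"
    for P :: "('a \<Rightarrow> 'a) \<times> ('a \<Rightarrow> 'a)"
  have "\<exists>e. small P k e" if P: "hom P" for P k
  proof -
    obtain d where "d > 0"
      "\<And>h g x. \<lbrakk>homeomorphism K K h g; \<forall>x\<in>K. dist (h x) x \<le> d; x \<in> K\<rbrakk>
       \<Longrightarrow> dist (h (fst P x)) (fst P x) \<le> (1/2)^k \<and> dist (snd P (g x)) (snd P x) \<le> (1/2)^k"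
      using small_left_factor[OF K P[unfolded hom_def], of "(1/2)^k"] by auto
    then show ?thesis unfolding small_def by blast
  qed
  then obtain E where E: "\<And>P k. hom P \<Longrightarrow> small P k (E P k)" by metis
  have Epos: "E P k > 0" if "hom P" for P k using E[OF that, of k] by (auto simp: small_def)
  let ?I = "(id, id) :: ('a \<Rightarrow> 'a) \<times> ('a \<Rightarrow> 'a)"
  have hI: "hom ?I" by (auto simp: hom_def homeomorphism_def)
  show ?thesis
  proof
    show "D (E ?I 0) > 0" by (intro D Epos hI)
    fix a b assume ab: "a \<in> K" "b \<in> K" "dist a b < D (E ?I 0)"
    define c where "c k = (if even k then a else b)" for k :: nat
    have cK: "c k \<in> K" for k using ab by (auto simp: c_def)
    have cSS: "c (Suc (Suc k)) = c k" for k by (simp add: c_def)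
    \<comment> \<open>A state holds the pair to be corrected now and the pair to be corrected next.
      The invariant puts the images of the two points so close that a correction harmless to the
      first pair exists.\<close>
    define S where "S k s \<longleftrightarrow> hom (fst s) \<and> hom (snd s) \<and>
        dist (fst (fst s) (c k)) (fst (snd s) (c (Suc k))) < D (E (fst s) k)" for k s
    define R where "R k s t \<longleftrightarrow> fst t = snd s \<and>
       (\<forall>x\<in>K. dist (fst (snd t) x) (fst (fst s) x) \<le> (1/2)^k \<and>
              dist (snd (snd t) x) (snd (fst s) x) \<le> (1/2)^k) \<and>
       dist (fst (snd t) (c k)) (fst (snd s) (c (Suc k))) < (1/2)^k"
      for k :: nat and s t :: "(('a \<Rightarrow> 'a) \<times> ('a \<Rightarrow> 'a)) \<times> (('a \<Rightarrow> 'a) \<times> ('a \<Rightarrow> 'a))"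
    have "\<exists>t. S (Suc k) t \<and> R k s t" if s: "S k s" for k s
    proof -
      obtain u v u' v' where suv: "s = ((u,v),(u',v'))" by (metis surj_pair)
      have h1: "hom (u,v)" and h2: "hom (u',v')"
        and d: "dist (u (c k)) (u' (c (Suc k))) < D (E (u,v) k)"
        using s by (auto simp: S_def suv)
      have in_K: "u (c k) \<in> K" "u' (c (Suc k)) \<in> K"
        using h1 h2 cK by (auto simp: hom_def homeomorphism_def)
      have "near_orbit K (E (u,v) k) (u (c k)) (u' (c (Suc k)))"
        by (intro near Epos h1 in_K d)
      \<comment> \<open>The accuracy is dictated by the pair \<open>(u',v')\<close>, which is
        corrected next and already known; this restores the invariant with the roles of
        \<open>a\<close> and \<open>b\<close> exchanged.\<close>
      moreover have "min ((1/2)^k) (D (E (u',v') (Suc k))) > 0"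
        using D[OF Epos[OF h2]] by simp
      ultimately obtain h g where h: "homeomorphism K K h g" "\<forall>x\<in>K. dist (h x) x \<le> E (u,v) k"
        and hd: "dist (h (u (c k))) (u' (c (Suc k))) < min ((1/2)^k) (D (E (u',v') (Suc k)))"
        unfolding near_orbit_def by meson
      let ?t = "((u',v'),(h \<circ> u, v \<circ> g))"
      have "hom (h \<circ> u, v \<circ> g)"
        using homeomorphism_compose[OF _ h(1), of K u v] h1 by (simp add: hom_def)
      then have "S (Suc k) ?t"
        using h2 hd by (simp add: S_def cSS dist_commute)
      moreover have "R k s ?t"
        using E[OF h1, of k] h hd unfolding R_def small_def suv by auto
      ultimately show ?thesis by blast
    qed
    moreover have "S 0 (?I, ?I)" using ab hI by (auto simp: S_def c_def)
    ultimately obtain s where s: "\<And>k. S k (s k)" "\<And>k. R k (s k) (s (Suc k))"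
      using dependent_nat_choice[of S R] by blast
    define U where "U k = fst (fst (s k))" for k
    define V where "V k = snd (fst (s k))" for k
    have homUV: "homeomorphism K K (U k) (V k)" for k using s(1)[of k] by (simp add: S_def hom_def U_def V_def)
    have snd_s: "snd (s k) = (U (Suc k), V (Suc k))" for k
      using s(2)[of k] by (simp add: R_def U_def V_def)
    have stepU: "dist (U (Suc (Suc k)) x) (U k x) \<le> (1/2)^k"
      and stepV: "dist (V (Suc (Suc k)) x) (V k x) \<le> (1/2)^k" if "x \<in> K" for k x
      using s(2)[of k] that by (auto simp: R_def snd_s U_def[of k] V_def[of k])
    have close: "dist (U (Suc (Suc k)) (c k)) (U (Suc k) (c (Suc k))) < (1/2)^k" for k
      using s(2)[of k] by (auto simp: R_def snd_s)
    have pow: "(1/2::real)^(j + 2*k) \<le> (1/2)^k" for j k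
      by (rule power_decreasing) auto
    \<comment> \<open>Even stages act on \<open>a\<close> and odd stages on \<open>b\<close>, so
      each subsequence gets its own limit homeomorphism. They are linked by
      \<open>f a = f' b\<close>, whence \<open>g' \<circ> f\<close> carries \<open>a\<close> to
      \<open>b\<close>.\<close>
    have lim: "\<exists>f g. homeomorphism K K f g \<and> (\<forall>x\<in>K. (\<lambda>k. U (j + 2*k) x) \<longlonglongrightarrow> f x)" for j
    proof (rule homeomorphism_limit[OF K, of "\<lambda>k. U (j + 2*k)" "\<lambda>k. V (j + 2*k)"])
      show "dist (U (j + 2 * Suc k) x) (U (j + 2*k) x) \<le> (1/2)^k" if "x \<in> K" for k x
        using order_trans[OF stepU[OF that, of "j+2*k"] pow] by simp
      show "dist (V (j + 2 * Suc k) x) (V (j + 2*k) x) \<le> (1/2)^k" if "x \<in> K" for k x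
        using order_trans[OF stepV[OF that, of "j+2*k"] pow] by simp
    qed (use homUV in auto)
    obtain f g where fg: "homeomorphism K K f g" "\<And>x. x \<in> K \<Longrightarrow> (\<lambda>k. U (0 + 2*k) x) \<longlonglongrightarrow> f x"
      using lim[of 0] by blast
    obtain f' g' where fg': "homeomorphism K K f' g'" "\<And>x. x \<in> K \<Longrightarrow> (\<lambda>k. U (1 + 2*k) x) \<longlonglongrightarrow> f' x"
      using lim[of 1] by blast
    have "f a = f' b"
    proof -
      have "(\<lambda>k. U (0 + 2 * Suc k) a) \<longlonglongrightarrow> f a" using fg(2)[OF ab(1)] LIMSEQ_Suc by fast
      then have "(\<lambda>k. dist (U (0 + 2 * Suc k) a) (U (1 + 2*k) b)) \<longlonglongrightarrow> dist (f a) (f' b)"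
        using fg'(2)[OF ab(2)] by (intro tendsto_dist)
      moreover have "(\<lambda>k. dist (U (0 + 2 * Suc k) a) (U (1 + 2*k) b)) \<longlonglongrightarrow> 0"
      proof (rule tendsto_sandwich[where f="\<lambda>_. 0" and h="\<lambda>k. (1/2)^k"])
        show "\<forall>\<^sub>F k in sequentially. dist (U (0 + 2 * Suc k) a) (U (1 + 2*k) b) \<le> (1/2)^k"
          using close[of "2 * _"] pow[of 0]
          by (intro always_eventually allI) (force simp: c_def intro: order_trans[OF less_imp_le])
      qed (auto intro: LIMSEQ_realpow_zero)
      ultimately show ?thesis using LIMSEQ_unique by fastforce
    qed
    moreover have "homeomorphism K K (g' \<circ> f) (g \<circ> f')"
      using homeomorphism_compose[OF fg(1) homeomorphism_symD[OF fg'(1)]] .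
    moreover have "g' (f' b) = b" using fg'(1) ab by (auto simp: homeomorphism_def)
    ultimately show "\<exists>h g. homeomorphism K K h g \<and> h a = b" by (metis comp_apply)
  qed
qed

lemma weakly_microtransitive_imp_homogeneous:
  fixes K :: "'a::complete_space set"
  assumes "compact K" "connected K" "weakly_microtransitive K"
  shows "homogeneous K"
proof -
  obtain d where d: "d > 0"
    "\<And>a b. \<lbrakk>a \<in> K; b \<in> K; dist a b < d\<rbrakk> \<Longrightarrow> \<exists>h g. homeomorphism K K h g \<and> h a = b"
    using weakly_microtransitive_imp_locally_transitive[OF assms(1,3)] by blast
  have "\<exists>h g. homeomorphism K K h g \<and> h x = y" if "x \<in> K" "y \<in> K" for x y
  proof (rule connected_equivalence_relation[OF assms(2) that,
      where R = "\<lambda>x y. \<exists>h g. homeomorphism K K h g \<and> h x = y"])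
    fix x y assume "\<exists>h g. homeomorphism K K h g \<and> h x = y" "x \<in> K" "y \<in> K"
    then show "\<exists>h g. homeomorphism K K h g \<and> h y = x"
      by (metis homeomorphism_apply1 homeomorphism_symD)
  next
    fix x y z assume "\<exists>h g. homeomorphism K K h g \<and> h x = y" "\<exists>h g. homeomorphism K K h g \<and> h y = z"
    then show "\<exists>h g. homeomorphism K K h g \<and> h x = z"
      by (metis comp_apply homeomorphism_compose)
  next
    fix a assume "a \<in> K"
    then show "\<exists>T. openin (top_of_set K) T \<and> a \<in> T \<and> (\<forall>x\<in>T. \<exists>h g. homeomorphism K K h g \<and> h a = x)"
      using d by (intro exI[of _ "K \<inter> ball a d"]) auto
  qed
  then show ?thesis by (auto simp: homogeneous_def)
qed

section \<open>Homogeneous compacta are weakly microtransitive\<close>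

text \<open>The outer homeomorphism is fixed first; its continuity at \<open>b\<close> then dictates
  how closely the inner one must approach \<open>b\<close>.\<close>

lemma near_orbit_trans:
  assumes "near_orbit K e a b" "near_orbit K e' b c" "a \<in> K" "b \<in> K"
  shows "near_orbit K (e + e') a c"
  unfolding near_orbit_def
proof (intro allI impI)
  fix r :: real assume r: "r > 0"
  then obtain w w' where w: "homeomorphism K K w w'" "\<forall>x\<in>K. dist (w x) x \<le> e'" "dist (w b) c < r/2"
    using assms(2) unfolding near_orbit_def by (meson half_gt_zero)
  then have "continuous_on K w" by (simp add: homeomorphism_def)
  then obtain d where d: "d > 0" "\<forall>x\<in>K. dist x b < d \<longrightarrow> dist (w x) (w b) < r/2"
    using assms(4) r unfolding continuous_on_iff by (meson half_gt_zero)
  obtain u u' where u: "homeomorphism K K u u'" "\<forall>x\<in>K. dist (u x) x \<le> e" "dist (u a) b < d"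
    using assms(1) d(1) unfolding near_orbit_def by meson
  have uK: "u x \<in> K" if "x \<in> K" for x using u(1) that by (auto simp: homeomorphism_def)
  show "\<exists>h g. homeomorphism K K h g \<and> (\<forall>x\<in>K. dist (h x) x \<le> e + e') \<and> dist (h a) c < r"
  proof (intro exI conjI ballI)
    show "homeomorphism K K (w \<circ> u) (u' \<circ> w')" by (rule homeomorphism_compose[OF u(1) w(1)])
    show "dist ((w \<circ> u) x) x \<le> e + e'" if "x \<in> K" for x
      using dist_triangle[of "w (u x)" x "u x"] u(2) w(2) uK that by fastforce
    show "dist ((w \<circ> u) a) c < r"
    proof -
      have "dist (w (u a)) (w b) < r/2" using d(2) uK[OF assms(3)] u(3) by blast
      then show ?thesis using w(3) dist_triangle[of "w (u a)" c "w b"] by simp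
    qed
  qed
qed

text \<open>The Baire category half of Effros's theorem. Homeomorphisms are sorted into countably many types:
  \<open>h\<close> is of type \<open>\<tau>\<close> if, for every pair \<open>(B, C) \<in> \<tau>\<close>, it maps \<open>B\<close> into \<open>C\<close> and its inverse shrinks \<open>C\<close> to
  diameter at most \<open>e\<close>. If \<open>g\<close> and \<open>h\<close> are of the same type, then \<open>g\<inverse> h\<close> moves points by at most \<open>e\<close>.\<close>

lemma homogeneous_imp_near_orbit_nhd:
  fixes K :: "'a::{metric_space, second_countable_topology} set"
  assumes K: "compact K" and hom: "homogeneous K" and x: "x \<in> K" and e: "e > 0"
  obtains r where "r > 0" "\<And>y. \<lbrakk>y \<in> K; dist x y < r\<rbrakk> \<Longrightarrow> near_orbit K e x y"
proof -
  obtain \<B> :: "'a set set" where B: "countable \<B>" "topological_basis \<B>"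
    using ex_countable_basis by blast
  define ty where "ty \<tau> h \<longleftrightarrow> K \<subseteq> \<Union>(fst ` \<tau>) \<and> (\<exists>g. homeomorphism K K h g \<and>
      (\<forall>(B,C)\<in>\<tau>. h ` (K \<inter> B) \<subseteq> C \<and> (\<forall>p\<in>C \<inter> K. \<forall>q\<in>C \<inter> K. dist (g p) (g q) \<le> e)))"
    for \<tau> :: "('a set \<times> 'a set) set" and h
  \<comment> \<open>Finite sets of pairs of basic open sets form a countable family, so the Baire
    theorem applies to the closures \<open>A \<tau>\<close> below.\<close>
  define T where "T = {\<tau>. finite \<tau> \<and> \<tau> \<subseteq> \<B> \<times> \<B>}"
  have cT: "countable T"
    unfolding T_def using B(1) by (simp add: countable_Collect_finite_subset)
  have ex: "\<exists>\<tau>\<in>T. ty \<tau> h" if hg: "homeomorphism K K h g" for h g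
  proof -
    have ch: "continuous_on K h" and cg: "continuous_on K g" using hg by (auto simp: homeomorphism_def)
    have "\<exists>B\<in>\<B>. \<exists>C\<in>\<B>. z \<in> B \<and> h ` (K \<inter> B) \<subseteq> C \<and> (\<forall>p\<in>C \<inter> K. \<forall>q\<in>C \<inter> K. dist (g p) (g q) \<le> e)"
      if z: "z \<in> K" for z
    proof -
      have hz: "h z \<in> K" "g (h z) = z" using hg z by (auto simp: homeomorphism_def)
      obtain d where d: "d > 0" "\<forall>p\<in>K. dist p (h z) < d \<longrightarrow> dist (g p) (g (h z)) < e/2"
        using cg hz(1) e unfolding continuous_on_iff by (meson half_gt_zero)
      obtain C where C: "C \<in> \<B>" "h z \<in> C" "C \<subseteq> ball (h z) d"
      proof (rule topological_basisE[OF B(2) open_ball])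
        show "h z \<in> ball (h z) d" using d(1) by simp
      qed
      have openC: "open C" using C(1) B(2) topological_basis_open by blast
      obtain W where W: "open W" "W \<inter> K = h -` C \<inter> K"
        using ch openC unfolding continuous_on_open_invariant by metis
      have "z \<in> W" using W(2) C(2) z by blast
      then obtain B' where B': "B' \<in> \<B>" "z \<in> B'" "B' \<subseteq> W"
        by (rule topological_basisE[OF B(2) W(1)])
      have "dist (g p) (g q) \<le> e" if "p \<in> C \<inter> K" "q \<in> C \<inter> K" for p q
        using d(2) C(3) that
        by (intro less_imp_le dist_triangle_half_l[of "g p" "g (h z)" e "g q"]) (auto simp: dist_commute)
      moreover have "h ` (K \<inter> B') \<subseteq> C" using B'(3) W(2) by blast
      ultimately show ?thesis using B'(1,2) C(1) by blast
    qed
    then obtain \<beta> \<gamma> where bc: "\<And>z. z \<in> K \<Longrightarrow> \<beta> z \<in> \<B> \<and> \<gamma> z \<in> \<B> \<and> z \<in> \<beta> z \<and> h ` (K \<inter> \<beta> z) \<subseteq> \<gamma> z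
        \<and> (\<forall>p\<in>\<gamma> z \<inter> K. \<forall>q\<in>\<gamma> z \<inter> K. dist (g p) (g q) \<le> e)"
      by metis
    have op: "\<And>z. z \<in> K \<Longrightarrow> open (\<beta> z)" using bc B(2) topological_basis_open by blast
    obtain F where F: "F \<subseteq> K" "finite F" "K \<subseteq> (\<Union>z\<in>F. \<beta> z)"
    proof (rule compactE_image[OF K, of K \<beta>])
      show "K \<subseteq> (\<Union>z\<in>K. \<beta> z)" using bc by blast
    qed (use op in auto)
    have "ty ((\<lambda>z. (\<beta> z, \<gamma> z)) ` F) h"
      unfolding ty_def
    proof (intro conjI exI)
      show "K \<subseteq> \<Union> (fst ` (\<lambda>z. (\<beta> z, \<gamma> z)) ` F)" using F(3) by (simp add: image_image)
      show "\<forall>(B, C)\<in>(\<lambda>z. (\<beta> z, \<gamma> z)) ` F. h ` (K \<inter> B) \<subseteq> C \<and> (\<forall>p\<in>C \<inter> K. \<forall>q\<in>C \<inter> K. dist (g p) (g q) \<le> e)"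
        using bc[OF subsetD[OF F(1)]] by (simp only: ball_simps split_conv) blast
    qed (rule hg)
    moreover have "(\<lambda>z. (\<beta> z, \<gamma> z)) ` F \<in> T" using F bc by (auto simp: T_def)
    ultimately show ?thesis by blast
  qed
  define A where "A \<tau> = top_of_set K closure_of {h x | h. ty \<tau> h}" for \<tau>
  have "K \<subseteq> \<Union>(A ` T)"
  proof
    fix y assume y: "y \<in> K"
    obtain h g where h: "homeomorphism K K h g" "h x = y"
      using hom x y unfolding homogeneous_def by blast
    obtain \<tau> where "\<tau> \<in> T" "ty \<tau> h" using ex h(1) by blast
    then have "y \<in> A \<tau>" unfolding A_def using y h
      by (auto intro!: subsetD[OF closure_of_subset_Int])
    then show "y \<in> \<Union>(A ` T)" using \<open>\<tau> \<in> T\<close> by blast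
  qed
  moreover have "\<Union>(A ` T) \<subseteq> K"
    unfolding A_def using closure_of_subset_topspace[of "top_of_set K"] by auto
  ultimately have UA: "\<Union>(A ` T) = K" by blast
  have "\<exists>\<tau>\<in>T. top_of_set K interior_of A \<tau> \<noteq> {}"
  proof (rule ccontr)
    assume "\<not> ?thesis"
    then have "top_of_set K interior_of \<Union>(A ` T) = {}"
      using K cT
      by (intro Baire_category_alt)
         (auto simp: A_def compact_imp_locally_compact_space compact_space_subtopology
           intro!: disjI2 metrizable_imp_regular_space metrizable_space_subtopology metrizable_space_euclidean)
    then show False using UA x interior_of_topspace[of "top_of_set K"] by simp
  qed
  then obtain \<tau> Ob where Ob: "openin (top_of_set K) Ob" "Ob \<subseteq> A \<tau>" "Ob \<noteq> {}"
    by (meson interior_of_subset openin_interior_of)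
  \<comment> \<open>A nonempty open set inside a closure meets the set itself, so it contains some
    \<open>g x\<close> with \<open>g\<close> of type \<open>\<tau>\<close>; pulling it back by
    \<open>g\<close> gives a neighbourhood of \<open>x\<close>.\<close>
  then obtain g where g: "ty \<tau> g" "g x \<in> Ob"
    unfolding A_def by (smt (verit, ccfv_threshold) all_not_in_conv in_closure_of mem_Collect_eq subsetD)
  obtain g' where gg': "homeomorphism K K g g'"
    and all: "\<forall>(B,C)\<in>\<tau>. g ` (K \<inter> B) \<subseteq> C \<and> (\<forall>p\<in>C \<inter> K. \<forall>q\<in>C \<inter> K. dist (g' p) (g' q) \<le> e)"
    using g(1) unfolding ty_def by (elim conjE exE)
  have shr: "dist (g' p) (g' q) \<le> e" if "(B,C) \<in> \<tau>" "p \<in> C \<inter> K" "q \<in> C \<inter> K" for B C p q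
    using bspec[OF all that(1)] that(2,3) by auto
  have img: "g ` (K \<inter> B) \<subseteq> C" if "(B,C) \<in> \<tau>" for B C
    using bspec[OF all that] by auto
  have cg: "continuous_on K g" and cg': "continuous_on K g'" using gg' by (auto simp: homeomorphism_def)
  obtain s where s: "s > 0" "ball (g x) s \<inter> K \<subseteq> Ob"
    using Ob(1) g(2) by (meson openin_contains_ball)
  obtain r where r: "r > 0" "\<forall>y\<in>K. dist y x < r \<longrightarrow> dist (g y) (g x) < s"
    using cg x s(1) unfolding continuous_on_iff by meson
  have "near_orbit K e x y" if y: "y \<in> K" "dist x y < r" for y
    unfolding near_orbit_def
  proof (intro allI impI)
    fix \<eta> :: real assume "\<eta> > 0"
    have gy: "g y \<in> K" "g' (g y) = y" using gg' y by (auto simp: homeomorphism_def)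
    obtain d where d: "d > 0" "\<forall>p\<in>K. dist p (g y) < d \<longrightarrow> dist (g' p) (g' (g y)) < \<eta>"
      using cg' gy(1) \<open>\<eta> > 0\<close> unfolding continuous_on_iff by meson
    have "g y \<in> ball (g x) s" using r(2) y by (auto simp: dist_commute)
    then have "g y \<in> A \<tau>" using s(2) Ob(2) gy by blast
    moreover have "openin (top_of_set K) (K \<inter> ball (g y) d)" by (simp add: openin_open_Int)
    moreover have "g y \<in> K \<inter> ball (g y) d" using gy d(1) by simp
    ultimately obtain q where "q \<in> {h x | h. ty \<tau> h}" "q \<in> K \<inter> ball (g y) d"
      unfolding A_def in_closure_of by meson
    \<comment> \<open>\<open>h\<close> has the same type as \<open>g\<close> and takes
      \<open>x\<close> close to \<open>g y\<close>, so \<open>g' \<circ> h\<close> takes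
      \<open>x\<close> close to \<open>y\<close>.\<close>
    then obtain h where h: "ty \<tau> h" "h x \<in> ball (g y) d" "h x \<in> K" by blast
    obtain h' where hh': "homeomorphism K K h h'"
      and all': "\<forall>(B,C)\<in>\<tau>. h ` (K \<inter> B) \<subseteq> C \<and> (\<forall>p\<in>C \<inter> K. \<forall>q\<in>C \<inter> K. dist (h' p) (h' q) \<le> e)"
      using h(1) unfolding ty_def by (elim conjE exE)
    have himg: "h ` (K \<inter> B) \<subseteq> C" if "(B,C) \<in> \<tau>" for B C
      using bspec[OF all' that] by auto
    show "\<exists>h g. homeomorphism K K h g \<and> (\<forall>x\<in>K. dist (h x) x \<le> e) \<and> dist (h x) y < \<eta>"
    proof (intro exI conjI ballI)
      show "homeomorphism K K (g' \<circ> h) (h' \<circ> g)"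
        by (rule homeomorphism_compose[OF hh' homeomorphism_symD[OF gg']])
      show "dist ((g' \<circ> h) z) z \<le> e" if z: "z \<in> K" for z
      proof -
        have "K \<subseteq> \<Union>(fst ` \<tau>)" using g(1) unfolding ty_def by (elim conjE)
        then obtain P where "P \<in> \<tau>" "z \<in> fst P" using z by blast
        moreover obtain B C where "P = (B, C)" by (metis surj_pair)
        ultimately have BC: "(B,C) \<in> \<tau>" "z \<in> B" by auto
        have "h z \<in> C \<inter> K" "g z \<in> C \<inter> K"
          using himg[OF BC(1)] img[OF BC(1)] BC(2) z hh' gg' by (auto simp: homeomorphism_def)
        then have "dist (g' (h z)) (g' (g z)) \<le> e" by (rule shr[OF BC(1)])
        then show ?thesis using gg' z by (auto simp: homeomorphism_def)
      qed
      show "dist ((g' \<circ> h) x) y < \<eta>"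
        using d(2) h gy by (auto simp: dist_commute)
    qed
  qed
  then show ?thesis using that r(1) by blast
qed

lemma homogeneous_imp_weakly_microtransitive:
  fixes K :: "'a::{metric_space, second_countable_topology} set"
  assumes K: "compact K" and hom: "homogeneous K"
  shows "weakly_microtransitive K"
  unfolding weakly_microtransitive_def
proof (intro allI impI)
  fix e :: real assume e: "e > 0"
  have nhd: "\<exists>r>0. \<forall>y\<in>K. dist x y < r \<longrightarrow> near_orbit K (e/3) x y" if "x \<in> K" for x
    using homogeneous_imp_near_orbit_nhd[OF K hom that, of "e/3"] e
    by (metis divide_pos_pos zero_less_numeral)
  \<comment> \<open>The radius in \<open>nhd\<close> belongs to the starting point and says nothing
    about returning to it. A homeomorphism \<open>v\<close> taking \<open>c\<close> into the radius
    of \<open>a\<close> gives the way back: from \<open>a\<close> towards \<open>v c\<close>, then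
    to \<open>c\<close> by the inverse of \<open>v\<close>.\<close>
  have rev: "near_orbit K (e/3 + e/3) a c" if c: "c \<in> K" and a: "a \<in> K" and ca: "near_orbit K (e/3) c a" for a c
  proof -
    obtain r where r: "r > 0" "\<And>y. \<lbrakk>y \<in> K; dist a y < r\<rbrakk> \<Longrightarrow> near_orbit K (e/3) a y"
      using nhd[OF a] by blast
    obtain v v' where v: "homeomorphism K K v v'" "\<forall>x\<in>K. dist (v x) x \<le> e/3" "dist (v c) a < r"
      using ca r(1) unfolding near_orbit_def by meson
    have vc: "v c \<in> K" "v' (v c) = c" using v(1) c by (auto simp: homeomorphism_def)
    have 1: "near_orbit K (e/3) a (v c)" using r(2) vc(1) v(3) by (simp add: dist_commute)
    have 2: "near_orbit K (e/3) (v c) c"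
      unfolding near_orbit_def
    proof (intro allI impI exI conjI ballI)
      show "homeomorphism K K v' v" using v(1) homeomorphism_symD by blast
      show "dist (v' x) x \<le> e/3" if "x \<in> K" for x
        using v(1,2) that by (metis dist_commute homeomorphism_def imageI)
    qed (use vc in auto)
    show ?thesis by (rule near_orbit_trans[OF 1 2 a vc(1)])
  qed
  obtain \<rho> where \<rho>: "\<And>x. x \<in> K \<Longrightarrow> \<rho> x > 0"
    "\<And>x y. \<lbrakk>x \<in> K; y \<in> K; dist x y < \<rho> x\<rbrakk> \<Longrightarrow> near_orbit K (e/3) x y"
    using nhd by metis
  \<comment> \<open>A Lebesgue number puts \<open>a\<close> and \<open>b\<close> near a common
    centre \<open>c\<close>; passing from \<open>a\<close> to \<open>c\<close> costs
    \<open>2e/3\<close>, from \<open>c\<close> to \<open>b\<close> another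
    \<open>e/3\<close>.\<close>
  obtain d where d: "d > 0" "\<And>x. x \<in> K \<Longrightarrow> \<exists>G\<in>(\<lambda>x. ball x (\<rho> x)) ` K. ball x d \<subseteq> G"
  proof (rule Heine_Borel_lemma[OF K, of "(\<lambda>x. ball x (\<rho> x)) ` K"])
    show "K \<subseteq> \<Union>((\<lambda>x. ball x (\<rho> x)) ` K)" using \<rho>(1) centre_in_ball by blast
  qed auto
  have "near_orbit K e a b" if ab: "a \<in> K" "b \<in> K" "dist a b < d" for a b
  proof -
    obtain c where c: "c \<in> K" "ball a d \<subseteq> ball c (\<rho> c)" using d(2)[OF ab(1)] by blast
    have "a \<in> ball a d" "b \<in> ball a d" using ab d(1) by auto
    then have "dist c a < \<rho> c" "dist c b < \<rho> c" using c(2) by (auto simp del: mem_ball simp flip: mem_ball)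
    then have "near_orbit K (e/3) c a" "near_orbit K (e/3) c b" using \<rho>(2) c ab by auto
    then have "near_orbit K (e/3 + e/3 + e/3) a b"
      by (intro near_orbit_trans[OF rev[OF c(1) ab(1)]] c ab)
    then show ?thesis by simp
  qed
  then show "\<exists>d>0. \<forall>a\<in>K. \<forall>b\<in>K. dist a b < d \<longrightarrow> near_orbit K e a b"
    using d(1) by (intro exI[of _ d]) simp
qed

section \<open>Coding homogeneous continua\<close>

text \<open>A separation of the compact closure has a Lebesgue number, and a chain with shorter
  steps cannot cross from one part to the other, although by density both parts contain points of
  the sequence.\<close>

lemma compact_connected_if_chains:
  fixes p :: "nat \<Rightarrow> 'a::metric_space"
  assumes K: "compact (closure (range p))"
    and chain: "\<And>e i. e > 0 \<Longrightarrow> (0, i) \<in> {(a, b). dist (p a) (p b) < e}\<^sup>*"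
  shows "connected (closure (range p))"
proof (rule ccontr)
  let ?K = "closure (range p)"
  assume "\<not> connected ?K"
  then obtain A B where AB: "open A" "open B" "?K \<subseteq> A \<union> B" "A \<inter> B \<inter> ?K = {}" "A \<inter> ?K \<noteq> {}" "B \<inter> ?K \<noteq> {}"
    unfolding connected_def by blast
  obtain d where d: "d > 0" "\<And>x. x \<in> ?K \<Longrightarrow> \<exists>G\<in>{A, B}. ball x d \<subseteq> G"
    by (rule Heine_Borel_lemma[OF K, of "{A, B}"]) (use AB(1-3) in auto)
  have pK: "p i \<in> ?K" for i by (auto intro: subsetD[OF closure_subset])
  have step: "p b \<in> A" if "p a \<in> A" "dist (p a) (p b) < d" for a b
  proof -
    have "p a \<notin> B" using that(1) pK AB(4) by blast
    moreover have "p a \<in> ball (p a) d" "p b \<in> ball (p a) d" using d(1) that(2) by auto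
    ultimately show ?thesis using d(2)[OF pK, of a] by blast
  qed
  have stay: "p i \<in> A \<longleftrightarrow> p 0 \<in> A" for i
    using chain[OF d(1), of i]
  proof (induction rule: rtrancl_induct)
    case (step a b)
    then have "p a \<in> A \<longleftrightarrow> p b \<in> A"
      using \<open>\<And>b a. \<lbrakk>p a \<in> A; dist (p a) (p b) < d\<rbrakk> \<Longrightarrow> p b \<in> A\<close> by (auto simp: dist_commute)
    then show ?case using step by simp
  qed simp
  have "\<exists>i. p i \<in> A" "\<exists>i. p i \<in> B"
    using AB(1,2,5,6) open_Int_closure_eq_empty[of A "range p"] open_Int_closure_eq_empty[of B "range p"] by auto
  moreover have "p i \<notin> A \<or> p i \<notin> B" for i
    using AB(4) closure_subset[of "range p"] by blast
  ultimately show False using stay by metis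
qed

text \<open>Balls of radius \<open>e/2\<close> about the points reachable from \<open>p 0\<close>
  are disjoint from those about the other points, since a common point would provide one more
  admissible step. Together they cover the closure and would separate it.\<close>

lemma connected_imp_chain:
  fixes p :: "nat \<Rightarrow> 'a::metric_space"
  assumes con: "connected (closure (range p))" and e: "e > 0"
  shows "(0, i) \<in> {(a, b). dist (p a) (p b) < e}\<^sup>*"
proof (rule ccontr)
  let ?K = "closure (range p)"
  let ?R = "{(a, b). dist (p a) (p b) < e}"
  define U where "U = (\<Union>a\<in>{a. (0, a) \<in> ?R\<^sup>*}. ball (p a) (e/2))"
  define V where "V = (\<Union>a\<in>{a. (0, a) \<notin> ?R\<^sup>*}. ball (p a) (e/2))"
  assume i: "(0, i) \<notin> ?R\<^sup>*"
  have "?K \<subseteq> U \<union> V"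
  proof
    fix x assume "x \<in> ?K"
    then obtain a where "dist (p a) x < e/2" using e by (auto simp: closure_approachable dest: spec[of _ "e/2"])
    then show "x \<in> U \<union> V" by (auto simp: U_def V_def)
  qed
  moreover have "U \<inter> V = {}"
  proof (rule ccontr)
    assume "U \<inter> V \<noteq> {}"
    then obtain x where x: "x \<in> U" "x \<in> V" by blast
    obtain a where a: "(0, a) \<in> ?R\<^sup>*" "x \<in> ball (p a) (e/2)" using x(1) unfolding U_def by blast
    obtain b where b: "(0, b) \<notin> ?R\<^sup>*" "x \<in> ball (p b) (e/2)" using x(2) unfolding V_def by blast
    have ab: "(0, a) \<in> ?R\<^sup>*" "(0, b) \<notin> ?R\<^sup>*" "dist (p a) x < e/2" "dist (p b) x < e/2"
      using a b by simp_all
    then have "(a, b) \<in> ?R" using dist_triangle_half_l[of "p a" x e "p b"] by simp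
    then show False using ab(1,2) rtrancl_into_rtrancl by metis
  qed
  moreover have "open U" "open V" by (auto simp: U_def V_def)
  moreover have "p 0 \<in> U \<inter> ?K" "p i \<in> V \<inter> ?K"
    using i e by (auto simp: U_def V_def intro: subsetD[OF closure_subset])
  ultimately show False using con connectedD[of ?K U V] by blast
qed

text \<open>The moduli do two jobs: they make \<open>q i\<close> depend on the point
  \<open>p i\<close> alone, even if the sequence repeats points, and they make this dependence
  uniformly continuous.\<close>

lemma extend_to_closure:
  fixes p q :: "nat \<Rightarrow> 'a::complete_space"
  assumes "\<And>r. \<exists>\<mu>>0. \<forall>a b. dist (p a) (p b) < \<mu> \<longrightarrow> dist (q a) (q b) \<le> (1/2)^r"
  obtains f where "continuous_on (closure (range p)) f" "\<And>i. f (p i) = q i"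
proof -
  have small: "\<exists>\<mu>>0. \<forall>a b. dist (p a) (p b) < \<mu> \<longrightarrow> dist (q a) (q b) < e" if e: "e > 0" for e :: real
  proof -
    have "(1/2::real) < 1" by simp
    then obtain r where r: "(1/2)^r < e" using real_arch_pow_inv[OF e] by blast
    obtain \<mu> where "\<mu> > 0" "\<forall>a b. dist (p a) (p b) < \<mu> \<longrightarrow> dist (q a) (q b) \<le> (1/2)^r"
      using assms by blast
    then show ?thesis using r by (intro exI[of _ \<mu>]) (auto intro: order.strict_trans1)
  qed
  have eq: "q a = q b" if "p a = p b" for a b
  proof (rule ccontr)
    assume "q a \<noteq> q b"
    then have "dist (q a) (q b) > 0" by simp
    then obtain \<mu> where "\<mu> > 0" "\<forall>c c'. dist (p c) (p c') < \<mu> \<longrightarrow> dist (q c) (q c') < dist (q a) (q b)"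
      using small by blast
    then have "dist (p a) (p b) < \<mu> \<longrightarrow> dist (q a) (q b) < dist (q a) (q b)" by blast
    then show False using that \<open>\<mu> > 0\<close> by simp
  qed
  define f where "f x = q (SOME i. p i = x)" for x
  have fp: "f (p i) = q i" for i
    unfolding f_def by (rule eq) (rule someI[of _ i], simp)
  have "uniformly_continuous_on (range p) f"
    unfolding uniformly_continuous_on_def
  proof (intro allI impI)
    fix e :: real assume "e > 0"
    then obtain \<mu> where \<mu>: "\<mu> > 0" "\<forall>c c'. dist (p c) (p c') < \<mu> \<longrightarrow> dist (q c) (q c') < e"
      using small by blast
    show "\<exists>d>0. \<forall>x\<in>range p. \<forall>x'\<in>range p. dist x' x < d \<longrightarrow> dist (f x') (f x) < e"
      using \<mu> by (intro exI[of _ \<mu>]) (auto simp: fp)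
  qed
  then obtain g where "uniformly_continuous_on (closure (range p)) g" "\<And>x. x \<in> range p \<Longrightarrow> f x = g x"
    by (rule uniformly_continuous_on_extension_on_closure) (rule that, assumption, blast)
  then show ?thesis
    using that[of g] fp uniformly_continuous_imp_continuous by (metis rangeI)
qed

text \<open>A code for a homogeneous continuum \<open>K \<subseteq> X\<close>: a sequence \<open>p\<close> dense in \<open>K\<close>, bounds \<open>N\<close> witnessing
  total boundedness, and self-homeomorphisms of \<open>K\<close> given by their values \<open>h J\<close> on the dense sequence together with
  moduli \<open>\<mu> J\<close> of uniform continuity. The homeomorphisms with indices \<open>[m, l, r, 0], [m, l, r, 1], \<dots>\<close> move points by at
  most \<open>2\<^sup>-\<^sup>m\<close>, and below the index \<open>b m l r\<close> there are enough of them to move every point at distance less than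
  \<open>d m\<close> from \<open>p l\<close> into the ball of radius \<open>2\<^sup>-\<^sup>r\<close> about \<open>p l\<close>. Each condition defines a
  \<open>G\<^sub>\<delta>\<close> set of codes.\<close>

locale homogeneity_code =
  fixes X :: "'a::complete_space set"
    and p :: "nat \<Rightarrow> 'a" and N :: "nat \<Rightarrow> real"
    and h :: "nat list \<Rightarrow> nat \<Rightarrow> 'a" and \<mu> :: "nat list \<Rightarrow> nat \<Rightarrow> real"
    and d :: "nat \<Rightarrow> real" and b :: "nat \<Rightarrow> nat \<Rightarrow> nat \<Rightarrow> real"
  assumes in_X: "\<And>i. p i \<in> X"
    and net: "\<And>r i. \<exists>l. real l < N r \<and> dist (p i) (p l) < (1/2)^r"
    and chain: "\<And>r i. (0, i) \<in> {(a, b). dist (p a) (p b) < (1/2)^r}\<^sup>*"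
    and into: "\<And>J i r. \<exists>l. dist (h J i) (p l) < (1/2)^r"
    and onto: "\<And>J i r. \<exists>l. dist (p i) (h J l) < (1/2)^r"
    and mod_pos: "\<And>J r. 0 < \<mu> J r"
    and mod_h: "\<And>J r i j. \<mu> J r \<le> dist (p i) (p j) \<or> dist (h J i) (h J j) \<le> (1/2)^r"
    and mod_inv: "\<And>J r i j. \<mu> J r \<le> dist (h J i) (h J j) \<or> dist (p i) (p j) \<le> (1/2)^r"
    and d_pos: "\<And>m. 0 < d m"
    and small: "\<And>m l r j i. dist (h [m, l, r, j] i) (p i) \<le> (1/2)^m"
    and move: "\<And>m l r i. d m \<le> dist (p i) (p l) \<or>
                (\<exists>j. real j < b m l r \<and> dist (h [m, l, r, j] i) (p l) < (1/2)^r)"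
begin

abbreviation K where "K \<equiv> closure (range p)"

lemma half_power_less:
  assumes "e > 0" obtains r :: nat where "(1/2)^r < (e::real)"
proof -
  have "(1/2::real) < 1" by simp
  then show ?thesis using real_arch_pow_inv[OF assms] that by blast
qed

lemma p_in_K: "p i \<in> K"
  by (auto intro: subsetD[OF closure_subset])

lemma in_K_iff: "x \<in> K \<longleftrightarrow> (\<forall>r. \<exists>l. dist x (p l) < (1/2)^r)"
proof -
  have "x \<in> K \<longleftrightarrow> (\<forall>e>0. \<exists>l. dist x (p l) < e)"
    by (simp add: closure_approachable dist_commute)
  also have "\<dots> \<longleftrightarrow> (\<forall>r. \<exists>l. dist x (p l) < (1/2)^r)"
    by (meson half_power_less order.strict_trans half_gt_zero zero_less_one zero_less_power half_gt_zero_iff)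
  finally show ?thesis .
qed

lemma range_h: "closure (range (h J)) = K"
proof
  show "closure (range (h J)) \<subseteq> K"
    by (rule closure_minimal) (use into in_K_iff in auto)
  have "p i \<in> closure (range (h J))" for i
    unfolding closure_approachable
  proof (intro allI impI)
    fix e :: real assume "e > 0"
    then obtain r where "(1/2)^r < e" by (rule half_power_less)
    moreover obtain l where "dist (p i) (h J l) < (1/2)^r" using onto by blast
    ultimately show "\<exists>y\<in>range (h J). dist y (p i) < e"
      by (intro bexI[of _ "h J l"]) (auto simp: dist_commute)
  qed
  then show "K \<subseteq> closure (range (h J))"
    by (intro closure_minimal) auto
qed

text \<open>\<open>mod_h\<close> extends the assignment of \<open>h J i\<close> to
  \<open>p i\<close>, and \<open>mod_inv\<close> its inverse. By \<open>into\<close> and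
  \<open>onto\<close> both sequences have closure \<open>K\<close>, so the extensions undo each
  other on dense sets and hence everywhere.\<close>

lemma ex_homeomorphism:
  obtains f g where "homeomorphism K K f g" "\<And>i. f (p i) = h J i"
proof -
  have 1: "\<exists>m>0. \<forall>a b. dist (p a) (p b) < m \<longrightarrow> dist (h J a) (h J b) \<le> (1/2)^r" for r
    using mod_pos[of J r] mod_h[of J r] by (intro exI[of _ "\<mu> J r"]) (auto simp: not_le[symmetric])
  have 2: "\<exists>m>0. \<forall>a b. dist (h J a) (h J b) < m \<longrightarrow> dist (p a) (p b) \<le> (1/2)^r" for r
    using mod_pos[of J r] mod_inv[of J r] by (intro exI[of _ "\<mu> J r"]) (auto simp: not_le[symmetric])
  obtain f where f: "continuous_on K f" "\<And>i. f (p i) = h J i"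
    using extend_to_closure[OF 1] by blast
  obtain g where g: "continuous_on K g" "\<And>i. g (h J i) = p i"
    using extend_to_closure[OF 2] unfolding range_h by blast
  have fK: "f ` K \<subseteq> K"
    by (rule image_closure_subset[OF f(1)]) (use f(2) range_h[of J] closure_subset[of "range (h J)"] in auto)
  have gK: "g ` K \<subseteq> K"
  proof -
    have "g ` closure (range (h J)) \<subseteq> K"
      by (rule image_closure_subset) (use g range_h[of J] p_in_K in auto)
    then show ?thesis by (simp add: range_h)
  qed
  have gf: "g (f x) = x" if "x \<in> K" for x
  proof -
    have "dist (g (f x)) x \<le> 0"
    proof (rule continuous_le_on_closure[OF _ that])
      show "continuous_on K (\<lambda>x. dist (g (f x)) x)"
        by (intro continuous_intros continuous_on_compose2[OF g(1) f(1) fK])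
    qed (auto simp: f g)
    then show ?thesis by simp
  qed
  have fg: "f (g x) = x" if "x \<in> K" for x
  proof -
    have "dist (f (g x)) x \<le> 0"
    proof (rule continuous_le_on_closure[where S = "range (h J)"])
      show "continuous_on (closure (range (h J))) (\<lambda>x. dist (f (g x)) x)"
        unfolding range_h by (intro continuous_intros continuous_on_compose2[OF f(1) g(1) gK])
    qed (use that range_h in \<open>auto simp: f g\<close>)
    then show ?thesis by simp
  qed
  have "homeomorphism K K f g"
    by (rule homeomorphismI) (use f g fK gK fg gf in auto)
  then show ?thesis using that f(2) by blast
qed

text \<open>The index supplied by \<open>move\<close> depends on the dense point and might escape as
  dense points approach \<open>x\<close>. The bound \<open>b m l r\<close> leaves finitely many
  candidates, all continuous at \<open>x\<close>, so one neighbourhood of \<open>x\<close> works for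
  all of them.\<close>

lemma weakly_microtransitive_K: "weakly_microtransitive K"
  unfolding weakly_microtransitive_def
proof (intro allI impI)
  fix e :: real assume "e > 0"
  then obtain m where m: "(1/2)^m < e" by (rule half_power_less)
  have "near_orbit K e x y" if x: "x \<in> K" and y: "y \<in> K" and xy: "dist x y < d m" for x y
    unfolding near_orbit_def
  proof (intro allI impI)
    fix \<eta> :: real assume \<eta>: "\<eta> > 0"
    then have "\<eta> / 3 > 0" by simp
    then obtain r where r: "(1/2)^r < \<eta> / 3" by (rule half_power_less)
    have "min (\<eta>/3) (d m - dist x y) > 0" using \<eta> xy by simp
    then obtain l where l: "dist (p l) y < min (\<eta>/3) (d m - dist x y)"
      using y unfolding closure_approachable by blast
    have "\<exists>f g. homeomorphism K K f g \<and> (\<forall>i. f (p i) = h [m, l, r, j] i)" for j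
      using ex_homeomorphism[of "[m, l, r, j]"] by metis
    then obtain F G where F: "\<And>j. homeomorphism K K (F j) (G j)" "\<And>j i. F j (p i) = h [m, l, r, j] i"
      by metis
    have "\<exists>\<epsilon>>0. \<forall>z\<in>K. dist z x < \<epsilon> \<longrightarrow> dist (F j z) (F j x) < \<eta>/3" for j
    proof -
      have "continuous_on K (F j)" using F(1)[of j] by (simp add: homeomorphism_def)
      then show ?thesis using x \<open>\<eta>/3 > 0\<close> unfolding continuous_on_iff by blast
    qed
    then obtain \<epsilon> where \<epsilon>: "\<And>j. \<epsilon> j > 0" "\<And>j z. \<lbrakk>z \<in> K; dist z x < \<epsilon> j\<rbrakk> \<Longrightarrow> dist (F j z) (F j x) < \<eta>/3"
      by metis
    define M where "M = nat \<lceil>b m l r\<rceil>"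
    define \<theta> where "\<theta> = Min (insert (d m - dist x (p l)) (\<epsilon> ` {..<M}))"
    have "dist x (p l) < d m" using l dist_triangle[of x "p l" y] by (simp add: dist_commute)
    then have "\<theta> > 0" unfolding \<theta>_def using \<epsilon>(1) by (subst Min_gr_iff) auto
    then obtain i where i: "dist (p i) x < \<theta>" using x unfolding closure_approachable by blast
    have "\<theta> \<le> d m - dist x (p l)" unfolding \<theta>_def by simp
    then have "dist (p i) (p l) < d m" using i dist_triangle[of "p i" "p l" x] by simp
    then obtain j where j: "real j < b m l r" "dist (h [m, l, r, j] i) (p l) < (1/2)^r"
      using move[of m i l r] by auto
    then have "j < M" unfolding M_def by linarith
    then have "\<theta> \<le> \<epsilon> j" unfolding \<theta>_def by (intro Min_le) auto
    then have "dist (F j (p i)) (F j x) < \<eta>/3" using \<epsilon>(2)[OF p_in_K] i by simp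
    then have "dist (F j x) y < \<eta>"
      using j(2) r l dist_triangle[of "F j x" y "F j (p i)"] dist_triangle[of "F j (p i)" y "p l"]
      by (simp add: F dist_commute)
    moreover have "dist (F j z) z \<le> e" if "z \<in> K" for z
    proof -
      have "dist (F j z) z \<le> (1/2)^m"
      proof (rule continuous_le_on_closure[OF _ that])
        show "continuous_on K (\<lambda>z. dist (F j z) z)"
          using F(1)[of j] by (intro continuous_intros) (simp add: homeomorphism_def)
      qed (use small F(2) in auto)
      then show ?thesis using m by simp
    qed
    ultimately show "\<exists>h g. homeomorphism K K h g \<and> (\<forall>x\<in>K. dist (h x) x \<le> e) \<and> dist (h x) y < \<eta>"
      using F(1) by blast
  qed
  then show "\<exists>d>0. \<forall>a\<in>K. \<forall>b\<in>K. dist a b < d \<longrightarrow> near_orbit K e a b"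
    using d_pos by (intro exI[of _ "d m"]) simp
qed

lemma K_in_homogeneous_continua:
  assumes "compact X" shows "K \<in> homogeneous_continua X"
proof -
  have "K \<subseteq> X" by (rule closure_minimal) (use in_X assms compact_imp_closed in auto)
  then have K: "compact K" using assms compact_closure by (metis bounded_subset closed_closure compact_Int_closed inf.absorb_iff2)
  have "connected K"
  proof (rule compact_connected_if_chains[OF K])
    fix e :: real and i assume "e > 0"
    then obtain r where "(1/2)^r < e" by (rule half_power_less)
    then have "{(a, b). dist (p a) (p b) < (1/2)^r} \<subseteq> {(a, b). dist (p a) (p b) < e}" by auto
    from rtrancl_mono[OF this] chain show "(0, i) \<in> {(a, b). dist (p a) (p b) < e}\<^sup>*" by blast
  qed
  then have "homogeneous K"
    using K weakly_microtransitive_K by (intro weakly_microtransitive_imp_homogeneous)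
  then show ?thesis
    using \<open>K \<subseteq> X\<close> K \<open>connected K\<close> by (auto simp: homogeneous_continua_def subcontinua_def nonempty_compacts_def)
qed

end

section \<open>Existence of codes\<close>

text \<open>A homeomorphism that serves \<open>x\<close> serves a neighbourhood of \<open>x\<close>,
  and \<open>K \<inter> cball y d\<close> is compact; a finite subcover yields the bound
  \<open>n\<close>.\<close>

lemma near_orbit_uniform_family:
  fixes K :: "'a::metric_space set"
  assumes K: "compact K" and near: "\<And>x. \<lbrakk>x \<in> K; dist x y \<le> d\<rbrakk> \<Longrightarrow> near_orbit K e x y"
    and r: "r > 0" and e: "e \<ge> 0"
  obtains H G and n :: nat where "\<And>j. homeomorphism K K (H j) (G j)" "\<And>j x. x \<in> K \<Longrightarrow> dist (H j x) x \<le> e"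
    "\<And>x. \<lbrakk>x \<in> K; dist x y \<le> d\<rbrakk> \<Longrightarrow> \<exists>j<n. dist (H j x) y < r"
proof -
  define C where "C = K \<inter> cball y d"
  have "compact C" using K by (simp add: C_def compact_Int_closed)
  define P where "P f \<longleftrightarrow> (\<exists>g. homeomorphism K K f g) \<and> (\<forall>x\<in>K. dist (f x) x \<le> e)" for f
  have "\<exists>f W. P f \<and> open W \<and> x \<in> W \<and> (\<forall>z\<in>W \<inter> K. dist (f z) y < r)" if x: "x \<in> C" for x
  proof -
    obtain f g where f: "homeomorphism K K f g" "\<forall>x\<in>K. dist (f x) x \<le> e" "dist (f x) y < r"
      using near[of x] x r unfolding near_orbit_def C_def by (auto simp: dist_commute)
    have "continuous_on K f" using f(1) by (simp add: homeomorphism_def)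
    moreover have "r - dist (f x) y > 0" "x \<in> K" using f(3) x by (auto simp: C_def)
    ultimately obtain s where s: "s > 0" "\<forall>z\<in>K. dist z x < s \<longrightarrow> dist (f z) (f x) < r - dist (f x) y"
      unfolding continuous_on_iff by blast
    have "dist (f z) y < r" if "z \<in> ball x s \<inter> K" for z
      using s(2) that dist_triangle[of "f z" y "f x"] by (force simp: dist_commute)
    then show ?thesis using f s(1) by (intro exI[of _ f] exI[of _ "ball x s"]) (auto simp: P_def)
  qed
  then obtain f W where fW: "\<And>x. x \<in> C \<Longrightarrow> P (f x) \<and> open (W x) \<and> x \<in> W x \<and> (\<forall>z\<in>W x \<inter> K. dist (f x z) y < r)"
    by metis
  obtain D where D: "D \<subseteq> C" "finite D" "C \<subseteq> (\<Union>x\<in>D. W x)"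
  proof (rule compactE_image[OF \<open>compact C\<close>, of C W])
    show "C \<subseteq> \<Union> (W ` C)" using fW by blast
  qed (use fW in auto)
  obtain c :: "nat \<Rightarrow> 'a" and n where c: "D = c ` {j. j < n}"
    using finite_imp_nat_seg_image_inj_on[OF D(2)] by blast
  \<comment> \<open>Beyond the subcover the family is padded with the identity, which is admissible
    because \<open>e \<ge> 0\<close>.\<close>
  define H where "H j = (if j < n then f (c j) else id)" for j
  have "P (H j)" for j
  proof (cases "j < n")
    case True
    then show ?thesis using fW D(1) c by (auto simp: H_def)
  next
    case False
    have "homeomorphism K K id id" by (simp add: homeomorphism_def)
    then show ?thesis using False e by (auto simp: H_def P_def)
  qed
  then obtain G where "\<And>j. homeomorphism K K (H j) (G j)" "\<And>j x. x \<in> K \<Longrightarrow> dist (H j x) x \<le> e"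
    unfolding P_def by metis
  moreover have "\<exists>j<n. dist (H j x) y < r" if "x \<in> K" "dist x y \<le> d" for x
  proof -
    have "x \<in> C" using that by (simp add: C_def dist_commute)
    then obtain j where j: "j < n" "x \<in> W (c j)" using D(3) c by auto
    then have "dist (f (c j) x) y < r" using fW[of "c j"] D(1) c that by auto
    then show ?thesis using j by (auto simp: H_def)
  qed
  ultimately show ?thesis using that by blast
qed

lemma ex_homogeneity_code:
  fixes X :: "'a::polish_space set"
  assumes "Q \<in> homogeneous_continua X"
  obtains p N h \<mu> d b where "homogeneity_code X p N h \<mu> d b" "closure (range p) = Q"
proof -
  have Q: "Q \<subseteq> X" "Q \<noteq> {}" "compact Q" "connected Q" "homogeneous Q"
    using assms by (auto simp: homogeneous_continua_def subcontinua_def nonempty_compacts_def)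
  obtain T where T: "countable T" "T \<subseteq> Q" "Q \<subseteq> closure T" by (rule separable)
  have "T \<noteq> {}" using T Q(2) by auto
  define p where "p = from_nat_into T"
  have rp: "range p = T" using range_from_nat_into[OF \<open>T \<noteq> {}\<close> T(1)] by (simp add: p_def)
  have cl: "closure (range p) = Q"
    using T Q(3) rp by (simp add: closure_minimal compact_imp_closed subset_antisym)
  have pQ: "p i \<in> Q" for i using rp T(2) by blast
  have dense: "\<exists>l. dist x (p l) < e" if "x \<in> Q" "e > 0" for x e
    using that cl closure_approachable[of x "range p"] by (auto simp: dist_commute)
  have "\<exists>n::real. \<forall>i. \<exists>l. real l < n \<and> dist (p i) (p l) < (1/2)^r" for r
  proof -
    have "Q \<subseteq> (\<Union>l. ball (p l) ((1/2)^r))" using dense[of _ "(1/2)^r"] by (auto simp: dist_commute)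
    then obtain L where L: "finite L" "Q \<subseteq> (\<Union>l\<in>L. ball (p l) ((1/2)^r))"
      using compactE_image[OF Q(3), of UNIV "\<lambda>l. ball (p l) ((1/2)^r)"] by auto
    then obtain n :: nat where n: "\<forall>l\<in>L. l < n" using finite_nat_set_iff_bounded by blast
    show ?thesis
    proof (intro exI[of _ "real n"] allI)
      fix i
      obtain l where "l \<in> L" "p i \<in> ball (p l) ((1/2)^r)" using L(2) pQ[of i] by blast
      then show "\<exists>l. real l < real n \<and> dist (p i) (p l) < (1/2)^r"
        using n by (intro exI[of _ l]) (auto simp: dist_commute)
    qed
  qed
  then obtain N :: "nat \<Rightarrow> real" where N: "\<And>r i. \<exists>l. real l < N r \<and> dist (p i) (p l) < (1/2)^r" by metis
  have "weakly_microtransitive Q" using homogeneous_imp_weakly_microtransitive Q by blast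
  then have "\<exists>d>0. \<forall>a\<in>Q. \<forall>b\<in>Q. dist a b < d \<longrightarrow> near_orbit Q ((1/2)^m) a b" for m :: nat
    unfolding weakly_microtransitive_def by simp
  then obtain d where d: "\<And>m. d m > 0"
    "\<And>m a b. \<lbrakk>a \<in> Q; b \<in> Q; dist a b < d m\<rbrakk> \<Longrightarrow> near_orbit Q ((1/2)^m) a b" by metis
  \<comment> \<open>Half of \<open>d m\<close> is used because the compactness argument needs a
    closed ball, while weak microtransitivity speaks of distances strictly below
    \<open>d m\<close>.\<close>
  define P where "P m l r H G n \<longleftrightarrow> (\<forall>j. homeomorphism Q Q (H j) (G j)) \<and> (\<forall>j. \<forall>x\<in>Q. dist (H j x) x \<le> (1/2)^m) \<and>
    (\<forall>x\<in>Q. dist x (p l) \<le> d m / 2 \<longrightarrow> (\<exists>j<n. dist (H j x) (p l) < (1/2)^r))"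
    for m l r :: nat and H G :: "nat \<Rightarrow> 'a \<Rightarrow> 'a" and n :: nat
  have "\<exists>H G n. P m l r H G n" for m l r
  proof (rule near_orbit_uniform_family[OF Q(3), of "p l" "d m / 2" "(1/2)^m" "(1/2)^r"])
    show "near_orbit Q ((1/2)^m) x (p l)" if "x \<in> Q" "dist x (p l) \<le> d m / 2" for x
      using that d(1)[of m] by (intro d(2) pQ) auto
    fix H G :: "nat \<Rightarrow> 'a \<Rightarrow> 'a" and n
    assume "\<And>j. homeomorphism Q Q (H j) (G j)" "\<And>j x. x \<in> Q \<Longrightarrow> dist (H j x) x \<le> (1/2)^m"
      "\<And>x. \<lbrakk>x \<in> Q; dist x (p l) \<le> d m / 2\<rbrakk> \<Longrightarrow> \<exists>j<n. dist (H j x) (p l) < (1/2)^r"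
    then show ?thesis unfolding P_def by blast
  qed auto
  then obtain H G n where HGn: "\<And>m l r. P m l r (H m l r) (G m l r) (n m l r)" by metis
  \<comment> \<open>The code asks for a homeomorphism at every list; lists not of length four get
    the identity.\<close>
  define F where "F J = (case J of [m, l, r, j] \<Rightarrow> (H m l r j, G m l r j) | _ \<Rightarrow> (id, id))" for J
  have F: "homeomorphism Q Q (fst (F J)) (snd (F J))" for J
    using HGn by (auto simp: F_def P_def homeomorphism_def[of Q Q id id] split: list.splits)
  have FQ: "fst (F J) x \<in> Q" "snd (F J) x \<in> Q" "snd (F J) (fst (F J) x) = x" "fst (F J) (snd (F J) x) = x" if "x \<in> Q" for J x
    using F[of J] that by (auto simp: homeomorphism_def)
  have "\<exists>\<mu>>0. \<forall>x\<in>Q. \<forall>y\<in>Q. (dist x y < \<mu> \<longrightarrow> dist (fst (F J) x) (fst (F J) y) < (1/2)^r) \<and>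
      (dist x y < \<mu> \<longrightarrow> dist (snd (F J) x) (snd (F J) y) < (1/2)^r)" for J r
  proof -
    have uc: "uniformly_continuous_on Q (fst (F J))" "uniformly_continuous_on Q (snd (F J))"
      using F[of J] Q(3) by (auto simp: homeomorphism_def compact_uniformly_continuous)
    have half: "(1/2::real)^r > 0" by simp
    obtain \<mu>1 where "\<mu>1 > 0" "\<forall>x\<in>Q. \<forall>y\<in>Q. dist y x < \<mu>1 \<longrightarrow> dist (fst (F J) y) (fst (F J) x) < (1/2)^r"
      using uc(1)[unfolded uniformly_continuous_on_def, rule_format, OF half] by blast
    moreover obtain \<mu>2 where "\<mu>2 > 0" "\<forall>x\<in>Q. \<forall>y\<in>Q. dist y x < \<mu>2 \<longrightarrow> dist (snd (F J) y) (snd (F J) x) < (1/2)^r"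
      using uc(2)[unfolded uniformly_continuous_on_def, rule_format, OF half] by blast
    ultimately show ?thesis by (intro exI[of _ "min \<mu>1 \<mu>2"]) auto
  qed
  then obtain \<mu> where \<mu>: "\<And>J r. \<mu> J r > 0"
    "\<And>J r x y. \<lbrakk>x \<in> Q; y \<in> Q; dist x y < \<mu> J r\<rbrakk> \<Longrightarrow> dist (fst (F J) x) (fst (F J) y) < (1/2)^r"
    "\<And>J r x y. \<lbrakk>x \<in> Q; y \<in> Q; dist x y < \<mu> J r\<rbrakk> \<Longrightarrow> dist (snd (F J) x) (snd (F J) y) < (1/2)^r"
    by metis
  have "homogeneity_code X p N (\<lambda>J i. fst (F J) (p i)) \<mu> (\<lambda>m. d m / 2) (\<lambda>m l r. real (n m l r))"
  proof
    show "p i \<in> X" for i using pQ Q(1) by blast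
    show "\<exists>l. real l < N r \<and> dist (p i) (p l) < (1/2)^r" for r i by (rule N)
    show "(0, i) \<in> {(a, b). dist (p a) (p b) < (1/2)^r}\<^sup>*" for r i
      by (rule connected_imp_chain) (use cl Q in auto)
    show "\<exists>l. dist (fst (F J) (p i)) (p l) < (1/2)^r" for J i r
      by (intro dense FQ pQ) simp
    show "\<exists>l. dist (p i) (fst (F J) (p l)) < (1/2)^r" for J i r
    proof -
      obtain l where "dist (snd (F J) (p i)) (p l) < \<mu> J r" using dense[OF FQ(2)[OF pQ] \<mu>(1)] by blast
      then have "dist (fst (F J) (snd (F J) (p i))) (fst (F J) (p l)) < (1/2)^r" by (intro \<mu>(2) FQ pQ)
      then show ?thesis using FQ(4)[OF pQ] by auto
    qed
    show "0 < \<mu> J r" for J r by (rule \<mu>)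
    show "\<mu> J r \<le> dist (p i) (p j) \<or> dist (fst (F J) (p i)) (fst (F J) (p j)) \<le> (1/2)^r" for J r i j
      using \<mu>(2)[OF pQ pQ, of i j J r] by linarith
    show "\<mu> J r \<le> dist (fst (F J) (p i)) (fst (F J) (p j)) \<or> dist (p i) (p j) \<le> (1/2)^r" for J r i j
      using \<mu>(3)[OF FQ(1)[OF pQ] FQ(1)[OF pQ], of J i J j J r] FQ(3)[OF pQ] by simp linarith
    show "0 < d m / 2" for m using d(1) by simp
    show "dist (fst (F [m, l, r, j]) (p i)) (p i) \<le> (1/2)^m" for m l r j i
      using HGn[of m l r] pQ by (simp add: F_def P_def)
    show "d m / 2 \<le> dist (p i) (p l) \<or>
        (\<exists>j. real j < real (n m l r) \<and> dist (fst (F [m, l, r, j]) (p i)) (p l) < (1/2)^r)" for m l r i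
      using HGn[of m l r] pQ[of i] unfolding F_def P_def by force
  qed
  then show ?thesis using cl that by blast
qed

section \<open>The Polish space of codes and its map into the hyperspace\<close>

lemma hausdorff_dist_leI_dist:
  assumes "A \<noteq> {}" "B \<noteq> {}" "bounded A" "bounded B"
    and "\<And>a. a \<in> A \<Longrightarrow> \<exists>b\<in>B. dist a b \<le> r" "\<And>b. b \<in> B \<Longrightarrow> \<exists>a\<in>A. dist b a \<le> r"
  shows "hausdorff_dist A B \<le> r"
  using assms by (intro hausdorff_dist_leI) (meson infdist_le2)+

lemma continuous_map_into_continuum_hyperspace:
  assumes f: "\<And>x. x \<in> S \<Longrightarrow> f x \<in> subcontinua X"
    and c: "\<And>x e. \<lbrakk>x \<in> S; e > 0\<rbrakk> \<Longrightarrow>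
      \<exists>U. openin (top_of_set S) U \<and> x \<in> U \<and> (\<forall>y\<in>U. hausdorff_dist (f x) (f y) < e)"
  shows "continuous_map (top_of_set S) (continuum_hyperspace X) f"
  unfolding continuum_hyperspace_def continuous_map_in_subtopology
proof
  interpret M: Metric_space "nonempty_compacts X" hausdorff_dist
    by (rule Metric_space_hausdorff_dist)
  show "continuous_map (top_of_set S) (hyperspace X) f"
    unfolding hyperspace_def M.continuous_map_to_metric
  proof (intro ballI allI impI)
    fix x and e :: real assume "x \<in> topspace (top_of_set S)" "e > 0"
    then have x: "x \<in> S" by simp
    obtain U where U: "openin (top_of_set S) U" "x \<in> U" "\<forall>y\<in>U. hausdorff_dist (f x) (f y) < e"
      using c[OF x \<open>e > 0\<close>] by blast
    moreover have "f y \<in> nonempty_compacts X" if "y \<in> U \<or> y = x" for y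
      using f[of y] that x openin_imp_subset[OF U(1)] by (auto simp: subcontinua_def)
    ultimately show "\<exists>U. openin (top_of_set S) U \<and> x \<in> U \<and> (\<forall>y\<in>U. f y \<in> M.mball (f x) e)"
      by (intro exI[of _ U]) (auto simp: M.in_mball)
  qed
qed (use f in auto)

text \<open>One real sequence stores the whole code. Its positions are finite lists numbered by
  \<open>to_nat\<close>; the heads 0 to 5 tell the six components apart, and a list index
  \<open>J\<close> is put last so that its length needs no marking.\<close>

definition code_pt :: "(nat \<Rightarrow> real) \<Rightarrow> nat \<Rightarrow> nat \<Rightarrow> real" where
  "code_pt w i = (\<lambda>c. w (to_nat [0, i, c]))"

definition code_hom :: "(nat \<Rightarrow> real) \<Rightarrow> nat list \<Rightarrow> nat \<Rightarrow> nat \<Rightarrow> real" where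
  "code_hom w J i = (\<lambda>c. w (to_nat (1 # i # c # J)))"

definition code_net :: "(nat \<Rightarrow> real) \<Rightarrow> nat \<Rightarrow> real" where
  "code_net w r = w (to_nat [2, r])"

definition code_mod :: "(nat \<Rightarrow> real) \<Rightarrow> nat list \<Rightarrow> nat \<Rightarrow> real" where
  "code_mod w J r = w (to_nat (3 # r # J))"

definition code_dist :: "(nat \<Rightarrow> real) \<Rightarrow> nat \<Rightarrow> real" where
  "code_dist w m = w (to_nat [4, m])"

definition code_bound :: "(nat \<Rightarrow> real) \<Rightarrow> nat \<Rightarrow> nat \<Rightarrow> nat \<Rightarrow> real" where
  "code_bound w m l r = w (to_nat [5, m, l, r])"

definition codes :: "(nat \<Rightarrow> real) set \<Rightarrow> (nat \<Rightarrow> real) set" where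
  "codes X = {w. homogeneity_code X (code_pt w) (code_net w) (code_hom w) (code_mod w)
     (code_dist w) (code_bound w)}"

lemma continuous_on_code [continuous_intros]:
  "continuous_on A (\<lambda>w. code_pt w i)" "continuous_on A (\<lambda>w. code_hom w J i)"
  "continuous_on A (\<lambda>w. code_net w r)" "continuous_on A (\<lambda>w. code_mod w J r)"
  "continuous_on A (\<lambda>w. code_dist w m)" "continuous_on A (\<lambda>w. code_bound w m l r)"
  unfolding code_pt_def code_hom_def code_net_def code_mod_def code_dist_def code_bound_def
  by (intro continuous_on_coordinatewise_then_product continuous_on_product_coordinates
      continuous_on_subset[OF continuous_on_product_coordinates] subset_UNIV)+

lemma ex_code:
  obtains w where "code_pt w = p" "code_hom w = h" "code_net w = N" "code_mod w = \<mu>"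
    "code_dist w = d" "code_bound w = b"
proof -
  define W where "W xs = (if hd xs = 0 then p (xs ! 1) (xs ! 2)
     else if hd xs = 1 then h (drop 3 xs) (xs ! 1) (xs ! 2)
     else if hd xs = 2 then N (xs ! 1)
     else if hd xs = 3 then \<mu> (drop 2 xs) (xs ! 1)
     else if hd xs = 4 then d (xs ! 1) else b (xs ! 1) (xs ! 2) (xs ! 3))" for xs :: "nat list"
  show ?thesis
    by (rule that[of "\<lambda>n. W (from_nat n)"])
      (auto simp: code_pt_def code_hom_def code_net_def code_mod_def code_dist_def code_bound_def
        W_def fun_eq_iff numeral_2_eq_2 numeral_3_eq_3)
qed

lemma gdelta_in_Collect_all:
  fixes P :: "'i::countable \<Rightarrow> 'a::metric_space \<Rightarrow> bool"
  assumes "\<And>i. gdelta_in euclidean {w. P i w}"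
  shows "gdelta_in euclidean {w. \<forall>i. P i w}"
proof -
  have "gdelta_in euclidean (\<Inter>i. {w. P i w})"
    by (rule gdelta_in_Inter) (use assms in auto)
  moreover have "(\<Inter>i. {w. P i w}) = {w. \<forall>i. P i w}" by auto
  ultimately show ?thesis by simp
qed

lemma gdelta_in_Collect_conj:
  "\<lbrakk>gdelta_in X {w. P w}; gdelta_in X {w. Q w}\<rbrakk> \<Longrightarrow> gdelta_in X {w. P w \<and> Q w}"
  using gdelta_in_Int[of X "{w. P w}" "{w. Q w}"] by (simp add: Collect_conj_eq)

lemma gdelta_in_Collect_disj:
  "\<lbrakk>gdelta_in X {w. P w}; gdelta_in X {w. Q w}\<rbrakk> \<Longrightarrow> gdelta_in X {w. P w \<or> Q w}"
  using gdelta_in_Un[of X "{w. P w}" "{w. Q w}"] by (simp add: Collect_disj_eq)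

lemma open_gdelta: "open S \<Longrightarrow> gdelta_in euclidean S"
  by (simp add: open_imp_gdelta_in)

lemma closed_gdelta: "closed (S :: 'a::metric_space set) \<Longrightarrow> gdelta_in euclidean S"
  by (simp add: closed_imp_gdelta_in metrizable_space_euclidean)

text \<open>A chain is finite, so its existence is a union, over lengths and intermediate vertices,
  of finitely many strict inequalities between continuous functions.\<close>

lemma open_Collect_chain:
  fixes p :: "'w::topological_space \<Rightarrow> 'i \<Rightarrow> 'a::metric_space"
  assumes "\<And>i. continuous_on UNIV (\<lambda>w. p w i)"
  shows "open {w. (a, b) \<in> {(i, j). dist (p w i) (p w j) < e}\<^sup>*}"
proof -
  have "open {w. (a, b) \<in> {(i, j). dist (p w i) (p w j) < e} ^^ n}" for n
  proof (induction n arbitrary: b)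
    case 0
    then show ?case by (cases "a = b") auto
  next
    case (Suc n)
    have "{w. (a, b) \<in> {(i, j). dist (p w i) (p w j) < e} ^^ Suc n} =
      (\<Union>c. {w. (a, c) \<in> {(i, j). dist (p w i) (p w j) < e} ^^ n} \<inter> {w. dist (p w c) (p w b) < e})"
      by auto
    moreover have "open {w. dist (p w c) (p w b) < e}" for c
      by (intro open_Collect_less continuous_intros assms)
    ultimately show ?case using Suc by (auto intro!: open_UN open_Int)
  qed
  then have "open (\<Union>n. {w. (a, b) \<in> {(i, j). dist (p w i) (p w j) < e} ^^ n})" by blast
  moreover have "(\<Union>n. {w. (a, b) \<in> {(i, j). dist (p w i) (p w j) < e} ^^ n}) =
      {w. (a, b) \<in> {(i, j). dist (p w i) (p w j) < e}\<^sup>*}"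
    by (auto simp: rtrancl_power)
  ultimately show ?thesis by simp
qed

text \<open>Universal quantifiers over indices are countable intersections. Existential ones stand
  before open conditions, hence the strict inequalities below them in
  \<open>homogeneity_code\<close>; implications such as \<open>mod_h\<close> are written as
  disjunctions of closed conditions.\<close>

lemma gdelta_codes:
  assumes "closed X" shows "gdelta_in euclidean (codes X)"
proof -
  have pos: "gdelta_in euclidean {w :: nat \<Rightarrow> real. 0 < f w}" if "continuous_on UNIV f" for f :: "_ \<Rightarrow> real"
    by (intro open_gdelta open_Collect_less that continuous_on_const)
  have le: "gdelta_in euclidean {w :: nat \<Rightarrow> real. f w \<le> g w}"
    if "continuous_on UNIV f" "continuous_on UNIV g" for f g :: "_ \<Rightarrow> real"
    by (intro closed_gdelta closed_Collect_le that)
  show ?thesis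
    unfolding codes_def homogeneity_code_def
  proof (intro gdelta_in_Collect_conj gdelta_in_Collect_all)
    show "gdelta_in euclidean {w. code_pt w i \<in> X}" for i
      using closed_vimage[OF assms, of "\<lambda>w. code_pt w i"]
      by (intro closed_gdelta) (simp add: vimage_def continuous_on_code)
    show "gdelta_in euclidean {w. (0, i) \<in> {(a, b). dist (code_pt w a) (code_pt w b) < (1/2)^r}\<^sup>*}" for r i
      by (intro open_gdelta open_Collect_chain continuous_intros)
    show "gdelta_in euclidean {w. code_dist w m \<le> dist (code_pt w i) (code_pt w l) \<or>
        (\<exists>j. real j < code_bound w m l r \<and> dist (code_hom w [m, l, r, j] i) (code_pt w l) < (1/2)^r)}" for m l r i
      by (intro gdelta_in_Collect_disj le)
        (intro continuous_intros open_gdelta open_Collect_ex open_Collect_conj open_Collect_less)+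
  qed (intro gdelta_in_Collect_disj le pos continuous_intros |
      (rule open_gdelta, intro open_Collect_ex open_Collect_conj open_Collect_less continuous_intros))+
qed

text \<open>Closeness of finitely many points of two sequences does not by itself bound the distance
  of their closures. Through \<open>net\<close>, the bound \<open>code_net w r\<close> makes the
  first \<open>n\<close> points a \<open>(1/2)^r\<close>-net for all codes near \<open>v\<close>,
  and these points vary continuously.\<close>

lemma continuous_code_closure:
  assumes X: "compact X"
  shows "continuous_map (top_of_set (codes X)) (continuum_hyperspace X) (\<lambda>w. closure (range (code_pt w)))"
proof (rule continuous_map_into_continuum_hyperspace)
  let ?K = "\<lambda>w. closure (range (code_pt w))"
  have hc: "?K w \<in> homogeneous_continua X" if "w \<in> codes X" for w
    using homogeneity_code.K_in_homogeneous_continua[OF _ X] that by (auto simp: codes_def)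
  then show sub: "?K w \<in> subcontinua X" if "w \<in> codes X" for w
    using that by (auto simp: homogeneous_continua_def)
  have bdd: "bounded (?K w)" if "w \<in> codes X" for w
    using sub[OF that] by (auto simp: subcontinua_def nonempty_compacts_def compact_imp_bounded)
  fix v and e :: real assume v: "v \<in> codes X" and e: "e > 0"
  have "(1/2::real) < 1" "e/4 > 0" using e by auto
  then obtain r where r: "(1/2)^r < e/4" using real_arch_pow_inv by blast
  define n where "n = Suc (nat \<lceil>code_net v r\<rceil>)"
  have n: "code_net v r < real n" unfolding n_def by linarith
  define U where "U = {w. code_net w r < real n \<and> (\<forall>l\<in>{..<n}. dist (code_pt w l) (code_pt v l) < e/4)}"
  have net: "\<exists>l<n. dist (code_pt w i) (code_pt w l) < (1/2)^r" if "w \<in> codes X \<inter> U" for w i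
  proof -
    have "homogeneity_code X (code_pt w) (code_net w) (code_hom w) (code_mod w) (code_dist w) (code_bound w)"
      using that by (simp add: codes_def)
    then obtain l where "real l < code_net w r" "dist (code_pt w i) (code_pt w l) < (1/2)^r"
      by (blast dest: homogeneity_code.net)
    then show ?thesis using that by (intro exI[of _ l]) (auto simp: U_def)
  qed
  have vU: "v \<in> codes X \<inter> U" using v n e by (auto simp: U_def)
  have near: "infdist z (?K w') \<le> e/2"
    if w: "w \<in> codes X \<inter> U" "w' \<in> codes X \<inter> U" "\<And>l. l < n \<Longrightarrow> dist (code_pt w l) (code_pt w' l) < e/4"
      and z: "z \<in> ?K w" for w w' z
  proof (rule continuous_le_on_closure[OF _ z])
    show "continuous_on (?K w) (\<lambda>z. infdist z (?K w'))" by (intro continuous_intros)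
    fix z assume "z \<in> range (code_pt w)"
    then obtain i where i: "z = code_pt w i" by blast
    obtain l where l: "l < n" "dist (code_pt w i) (code_pt w l) < (1/2)^r" using net[OF w(1)] by blast
    have "dist z (code_pt w' l) \<le> e/2"
      using w(3)[OF l(1)] l(2) r dist_triangle[of z "code_pt w' l" "code_pt w l"] i by simp
    moreover have "code_pt w' l \<in> ?K w'" by (auto intro: subsetD[OF closure_subset])
    ultimately show "infdist z (?K w') \<le> e/2" by (rule infdist_le2[rotated])
  qed
  have "hausdorff_dist (?K v) (?K w) < e" if "w \<in> codes X \<inter> U" for w
  proof -
    have "hausdorff_dist (?K v) (?K w) \<le> e/2"
      using that vU bdd
      by (intro hausdorff_dist_leI near) (auto simp: U_def dist_commute)
    then show ?thesis using e by simp
  qed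
  moreover have "open U"
  proof -
    have "open ({w. code_net w r < real n} \<inter> (\<Inter>l\<in>{..<n}. {w. dist (code_pt w l) (code_pt v l) < e/4}))"
      by (intro open_Int open_INT ballI finite_lessThan open_Collect_less continuous_intros)
    moreover have "{w. code_net w r < real n} \<inter> (\<Inter>l\<in>{..<n}. {w. dist (code_pt w l) (code_pt v l) < e/4}) = U"
      by (auto simp: U_def)
    ultimately show ?thesis by simp
  qed
  ultimately show "\<exists>U. openin (top_of_set (codes X)) U \<and> v \<in> U \<and> (\<forall>w\<in>U. hausdorff_dist (?K v) (?K w) < e)"
    using vU by (intro exI[of _ "codes X \<inter> U"]) (auto simp: openin_open_Int)
qed

lemma second_countable_euclidean: "second_countable (euclidean :: 'a::second_countable_topology topology)"
proof -
  obtain \<B> :: "'a set set" where \<B>: "countable \<B>" "topological_basis \<B>"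
    using ex_countable_basis by blast
  have "\<exists>V\<in>\<B>. x \<in> V \<and> V \<subseteq> U" if "open U" "x \<in> U" for U x
    using topological_basisE[OF \<B>(2) that] by metis
  then show ?thesis
    unfolding second_countable_def using \<B> topological_basis_open by (intro exI[of _ \<B>]) auto
qed

lemma analytic_homogeneous_continua:
  fixes X :: "(nat \<Rightarrow> real) set"
  assumes X: "compact X"
  shows "analytic_in (continuum_hyperspace X) (homogeneous_continua X)"
  unfolding analytic_in_def
proof (intro exI conjI)
  show "Polish_space (top_of_set (codes X))"
    unfolding Polish_space_def
    using gdelta_codes[OF compact_imp_closed[OF X]]
    by (auto intro!: completely_metrizable_space_gdelta_in completely_metrizable_space_euclidean
        second_countable_subtopology second_countable_euclidean)
  show "continuous_map (top_of_set (codes X)) (continuum_hyperspace X) (\<lambda>w. closure (range (code_pt w)))"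
    by (rule continuous_code_closure[OF X])
  have "closure (range (code_pt w)) \<in> homogeneous_continua X" if "w \<in> codes X" for w
    using homogeneity_code.K_in_homogeneous_continua[OF _ X] that by (auto simp: codes_def)
  moreover have "Q \<in> (\<lambda>w. closure (range (code_pt w))) ` codes X" if "Q \<in> homogeneous_continua X" for Q
  proof -
    obtain p N h \<mu> d b where c: "homogeneity_code X p N h \<mu> d b" "closure (range p) = Q"
      using ex_homogeneity_code[OF \<open>Q \<in> homogeneous_continua X\<close>] by blast
    obtain w where "code_pt w = p" "code_hom w = h" "code_net w = N" "code_mod w = \<mu>"
      "code_dist w = d" "code_bound w = b" by (rule ex_code)
    then show ?thesis using c by (auto simp: codes_def intro!: image_eqI[of _ _ w])
  qed
  ultimately show "(\<lambda>w. closure (range (code_pt w))) ` topspace (top_of_set (codes X)) = homogeneous_continua X"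
    by auto
qed

lemma compact_cube: "compact (cube n)"
proof -
  have "compact_space (product_topology (\<lambda>_. top_of_set {0..1::real}) {i. enat i < n})"
    by (simp add: compact_space_product_topology compact_space_subtopology)
  then have "compact_space (top_of_set (cube n))"
    by (simp add: homeomorphic_compact_space[OF cube_homeomorphic_product])
  then have "compactin (top_of_set (cube n)) (cube n)" by (simp add: compact_space_def)
  then show ?thesis by (simp add: compactin_subtopology)
qed

section \<open>Null sequences do not form a countable union of G-delta sets\<close>

lemma tendsto_fun_iff:
  fixes f :: "'b \<Rightarrow> 'i \<Rightarrow> 'a::topological_space"
  shows "(f \<longlongrightarrow> l) F \<longleftrightarrow> (\<forall>i. ((\<lambda>x. f x i) \<longlongrightarrow> l i) F)"
  using limitin_componentwise[of "\<lambda>_. euclidean" UNIV f l F]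
  by (simp add: euclidean_product_topology)

lemma open_contains_cylinder:
  fixes x :: "nat \<Rightarrow> 'a::topological_space"
  assumes "open U" "x \<in> U"
  obtains N where "\<And>y. (\<And>i. i < N \<Longrightarrow> y i = x i) \<Longrightarrow> y \<in> U"
proof (rule ccontr)
  assume "\<not> thesis"
  then have "\<forall>N. \<exists>y. (\<forall>i<N. y i = x i) \<and> y \<notin> U" using that by blast
  then obtain Y where Y: "\<And>N i. i < N \<Longrightarrow> Y N i = x i" "\<And>N. Y N \<notin> U" by metis
  have "(\<lambda>N. Y N i) \<longlonglongrightarrow> x i" for i
    by (rule tendsto_eventually) (use Y(1) in \<open>auto simp: eventually_sequentially intro!: exI[of _ "Suc i"]\<close>)
  then have "Y \<longlonglongrightarrow> x" by (simp add: tendsto_fun_iff)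
  then have "\<forall>\<^sub>F N in sequentially. Y N \<in> U" using assms topological_tendstoD by blast
  then show False using Y(2) by simp
qed

definition unit_c0 :: "(nat \<Rightarrow> real) set" where
  "unit_c0 = {x \<in> c0. \<forall>i. \<bar>x i\<bar> < 1}"

definition sym_box :: "(nat \<Rightarrow> real) set" where
  "sym_box = {x. \<forall>i. \<bar>x i\<bar> \<le> 1}"

lemma closed_all_coordinates:
  fixes a b :: "nat \<Rightarrow> real"
  shows "closed {x :: nat \<Rightarrow> real. \<forall>i. a i \<le> x i \<and> x i \<le> b i}"
  by (intro closed_Collect_all closed_Collect_conj closed_Collect_le continuous_intros
      continuous_on_product_coordinates)

text \<open>Prescribed coordinates are intervals with \<open>a i = b i\<close>, so the box is closed
  and hence completely metrizable. By Baire, \<open>G\<close> and all the sets \<open>U k\<close>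
  have a common point, which cannot tend to zero.\<close>

lemma not_subset_c0_if_dense_in_box:
  fixes a b :: "nat \<Rightarrow> real" and c :: real
  assumes ab: "\<And>i. a i \<le> b i" and c: "c > 0" and tail: "\<And>i. i \<ge> N \<Longrightarrow> a i \<le> c \<and> b i \<ge> c"
  defines "Z \<equiv> {x. \<forall>i. a i \<le> x i \<and> x i \<le> b i}"
  assumes G: "gdelta_in (top_of_set Z) G" and dense: "top_of_set Z closure_of G = Z"
  shows "\<not> G \<subseteq> c0"
proof
  assume "G \<subseteq> c0"
  define U where "U k = {x \<in> Z. \<exists>i\<ge>k. x i > c / 2}" for k
  have U: "openin (top_of_set Z) (U k) \<and> top_of_set Z closure_of (U k) = topspace (top_of_set Z)" for k
  proof
    have "open (\<Union>i\<in>{k..}. {x :: nat \<Rightarrow> real. x i > c / 2})"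
      by (intro open_UN ballI open_Collect_less continuous_intros continuous_on_product_coordinates)
    moreover have "U k = Z \<inter> (\<Union>i\<in>{k..}. {x. x i > c / 2})" by (auto simp: U_def)
    ultimately show "openin (top_of_set Z) (U k)" by (auto simp: openin_open)
    have "Z \<subseteq> top_of_set Z closure_of (U k)"
    proof (clarsimp simp: in_closure_of)
      fix x T assume x: "x \<in> Z" "x \<in> T" "openin (top_of_set Z) T"
      then obtain W where W: "open W" "T = Z \<inter> W" by (auto simp: openin_open)
      obtain M where M: "\<And>y. (\<And>i. i < M \<Longrightarrow> y i = x i) \<Longrightarrow> y \<in> W"
        using open_contains_cylinder[OF W(1), of x] x W by blast
      \<comment> \<open>One coordinate beyond the cylinder, beyond \<open>k\<close> and beyond the
        prescribed part is raised to \<open>c\<close>; the point stays in the given open set and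
        enters \<open>U k\<close>.\<close>
      define j where "j = max M (max k N)"
      have "x(j := c) \<in> W" by (rule M) (auto simp: j_def)
      moreover have "x(j := c) \<in> Z" using x(1) tail[of j] by (auto simp: Z_def j_def)
      moreover have "x(j := c) \<in> U k" using calculation(2) c
        by (auto simp: U_def j_def intro!: exI[of _ j])
      ultimately show "\<exists>y. y \<in> U k \<and> y \<in> T" using W by blast
    qed
    then show "top_of_set Z closure_of (U k) = topspace (top_of_set Z)"
      using closure_of_subset_topspace by fastforce
  qed
  obtain C :: "nat \<Rightarrow> (nat \<Rightarrow> real) set" where C: "\<And>n. openin (top_of_set Z) (C n)" "\<Inter>(range C) = G"
    using G unfolding gdelta_in_descending by blast
  have "completely_metrizable_space (top_of_set Z)"
    using completely_metrizable_space_closedin[OF completely_metrizable_space_euclidean]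
      closed_all_coordinates[of a b] by (simp add: Z_def)
  then have "top_of_set Z closure_of \<Inter>(range C \<union> range U) = topspace (top_of_set Z)"
  proof (intro Baire_category disjI1)
    fix T assume "T \<in> range C \<union> range U"
    moreover have "top_of_set Z closure_of (C n) = topspace (top_of_set Z)" for n
      using closure_of_mono[of G "C n" "top_of_set Z"] dense C(2) closure_of_subset_topspace[of "top_of_set Z" "C n"]
      by auto
    ultimately show "openin (top_of_set Z) T \<and> top_of_set Z closure_of T = topspace (top_of_set Z)"
      using U C(1) by blast
  qed auto
  moreover have "a \<in> Z" using ab by (auto simp: Z_def)
  ultimately have "\<Inter>(range C \<union> range U) \<noteq> {}" by (metis closure_of_empty empty_iff topspace_euclidean_subtopology)
  then obtain x where x: "x \<in> \<Inter>(range C \<union> range U)" by blast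
  then have "x \<in> G" using C(2) by auto
  then have "x \<longlonglongrightarrow> 0" using \<open>G \<subseteq> c0\<close> by (auto simp: c0_def)
  then have "\<forall>\<^sub>F i in sequentially. x i < c / 2"
    using c by (intro order_tendstoD(2)) auto
  then obtain k where "\<forall>i\<ge>k. x i < c / 2" by (auto simp: eventually_sequentially)
  moreover have "x \<in> U k" using x by blast
  then obtain i where "i \<ge> k" "x i > c / 2" by (auto simp: U_def)
  ultimately show False by fastforce
qed

text \<open>If \<open>G m\<close> were dense in the current box, it would contain a sequence that is
  not null; hence some cylinder of the box avoids it, and its coordinates are prescribed from then
  on. Halving the bound on the free coordinates forces the diagonal sequence to tend to
  zero.\<close>

lemma unit_c0_not_gdelta_sigma_in: "\<not> gdelta_sigma_in (top_of_set sym_box) unit_c0"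
proof
  assume "gdelta_sigma_in (top_of_set sym_box) unit_c0"
  then obtain \<U> where \<U>: "countable \<U>" "\<And>U. U \<in> \<U> \<Longrightarrow> gdelta_in (top_of_set sym_box) U" "\<Union>\<U> = unit_c0"
    by (auto simp: gdelta_sigma_in_def union_of_def)
  have "(\<lambda>_. 0) \<in> unit_c0" by (simp add: unit_c0_def c0_def)
  then have "\<U> \<noteq> {}" using \<U>(3) by blast
  then obtain G :: "nat \<Rightarrow> (nat \<Rightarrow> real) set" where G: "\<U> = range G"
    using range_from_nat_into[OF _ \<U>(1)] by metis
  \<comment> \<open>A stage \<open>s\<close> is a sequence with the number of its coordinates that
    are prescribed. The bound on the others is at most \<open>1/2\<close> already for
    \<open>m = 0\<close>, which keeps the limit strictly inside the unit bounds.\<close>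
  define Z where "Z m s = {x. \<forall>i. (if i < snd s then fst s i else 0) \<le> x i \<and>
      x i \<le> (if i < snd s then fst s i else (1/2)^Suc m)}" for m and s :: "(nat \<Rightarrow> real) \<times> nat"
  have Z_iff: "x \<in> Z m s \<longleftrightarrow> (\<forall>i<snd s. x i = fst s i) \<and> (\<forall>i\<ge>snd s. 0 \<le> x i \<and> x i \<le> (1/2)^Suc m)" for x m s
  proof -
    have "(if i < snd s then fst s i else 0) \<le> x i \<and> x i \<le> (if i < snd s then fst s i else (1/2)^Suc m)
      \<longleftrightarrow> (i < snd s \<longrightarrow> x i = fst s i) \<and> (snd s \<le> i \<longrightarrow> 0 \<le> x i \<and> x i \<le> (1/2)^Suc m)" for i
      by auto
    then show ?thesis unfolding Z_def mem_Collect_eq by blast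
  qed
  define S where "S s \<longleftrightarrow> (\<forall>i<snd s. 0 \<le> fst s i \<and> fst s i \<le> 1/2)" for s :: "(nat \<Rightarrow> real) \<times> nat"
  define R where "R m s t \<longleftrightarrow> snd s < snd t \<and> fst t \<in> Z m s \<and>
      (\<forall>x\<in>Z m s. (\<forall>i<snd t. x i = fst t i) \<longrightarrow> x \<notin> G m)" for m s t
  have half: "(1/2::real)^Suc m \<le> 1/2" for m by (simp add: power_le_one)
  have Zhalf: "0 \<le> x i \<and> x i \<le> 1/2" if "x \<in> Z m s" "S s" for x m s i
  proof (cases "i < snd s")
    case True
    then show ?thesis using that by (simp add: Z_iff S_def)
  next
    case False
    then have "0 \<le> x i \<and> x i \<le> (1/2)^Suc m" using that(1) unfolding Z_iff by simp
    then show ?thesis using half[of m] by linarith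
  qed
  have "\<exists>t. S t \<and> R m s t" if s: "S s" for m s
  proof -
    let ?Y = "top_of_set (Z m s)"
    have Zbox: "Z m s \<subseteq> sym_box"
    proof
      fix x assume "x \<in> Z m s"
      then have "\<bar>x i\<bar> \<le> 1" for i using Zhalf[OF _ s, of x m i] by auto
      then show "x \<in> sym_box" by (simp add: sym_box_def)
    qed
    have Gm: "gdelta_in ?Y (G m \<inter> Z m s)"
    proof -
      have "gdelta_in (top_of_set sym_box) (G m)" using \<U>(2) G by blast
      then have "gdelta_in (subtopology (top_of_set sym_box) (Z m s)) (G m \<inter> Z m s)"
        by (auto simp: gdelta_in_subtopology)
      then show ?thesis using Zbox by (simp add: subtopology_subtopology Int_absorb1)
    qed
    have "?Y closure_of (G m \<inter> Z m s) \<noteq> Z m s"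
    proof
      assume d: "?Y closure_of (G m \<inter> Z m s) = Z m s"
      have "\<not> G m \<inter> Z m s \<subseteq> c0"
        unfolding Z_def
        by (rule not_subset_c0_if_dense_in_box[where c = "(1/2)^Suc m" and N = "snd s"])
          (use Gm d in \<open>auto simp: Z_def\<close>)
      then show False using \<U>(3) G by (auto simp: unit_c0_def)
    qed
    then obtain y where y: "y \<in> Z m s" "y \<notin> ?Y closure_of (G m \<inter> Z m s)"
      using closure_of_subset_topspace[of ?Y] by fastforce
    then obtain T where T: "openin ?Y T" "y \<in> T" "T \<inter> (G m \<inter> Z m s) = {}"
      unfolding in_closure_of by auto
    then obtain W where W: "open W" "T = Z m s \<inter> W" by (auto simp: openin_open)
    obtain M where M: "\<And>x. (\<And>i. i < M \<Longrightarrow> x i = y i) \<Longrightarrow> x \<in> W"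
      using open_contains_cylinder[OF W(1), of y] T W by blast
    have "S (y, max M (Suc (snd s)))" using Zhalf[OF y(1) s] by (simp add: S_def)
    moreover have "R m s (y, max M (Suc (snd s)))"
      using y M T W by (auto simp: R_def)
    ultimately show ?thesis by blast
  qed
  moreover have "S ((\<lambda>_. 0), 0)" by (simp add: S_def)
  ultimately obtain s where s: "\<And>m. S (s m)" "\<And>m. R m (s m) (s (Suc m))"
    using dependent_nat_choice[of "\<lambda>_. S" R] by blast
  have mono: "snd (s m) < snd (s (Suc m))" for m using s(2)[of m] by (simp add: R_def)
  then have sm: "strict_mono (\<lambda>m. snd (s m))" by (simp add: strict_mono_Suc_iff)
  have step: "fst (s (Suc m)) \<in> Z m (s m)" for m using s(2)[of m] by (simp add: R_def)
  have agree: "fst (s (m + j)) i = fst (s m) i" if "i < snd (s m)" for m j i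
  proof (induction j)
    case (Suc j)
    have "snd (s m) \<le> snd (s (m + j))" using strict_mono_mono[OF sm] by (simp add: mono_def)
    then show ?case using step[of "m+j"] Suc that by (simp add: Z_iff)
  qed simp
  have small: "0 \<le> fst (s (m + j)) i \<and> fst (s (m + j)) i \<le> (1/2)^Suc m"
    if "snd (s m) \<le> i" "i < snd (s (m + j))" for m j i
    using that(2)
  proof (induction j)
    case (Suc j)
    show ?case
    proof (cases "i < snd (s (m + j))")
      case True
      then show ?thesis using agree[OF True, of 1] Suc by simp
    next
      case False
      then have "0 \<le> fst (s (m + Suc j)) i \<and> fst (s (m + Suc j)) i \<le> (1/2)^Suc (m + j)"
        using step[of "m+j"] unfolding Z_iff by simp
      moreover have "(1/2::real)^Suc (m + j) \<le> (1/2)^Suc m" by (rule power_decreasing) auto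
      ultimately show ?thesis by linarith
    qed
  qed (use that in simp)
  \<comment> \<open>Stage \<open>Suc i\<close> has prescribed coordinate \<open>i\<close>, because
    the numbers \<open>snd (s m)\<close> increase strictly from 0.\<close>
  define x where "x i = fst (s (Suc i)) i" for i
  have lt: "i < snd (s (Suc i))" for i
    using strict_mono_imp_increasing[OF sm, of "Suc i"] by simp
  have x_eq: "x i = fst (s m) i" if "i < snd (s m)" for i m
    using agree[OF that, of "Suc i"] agree[OF lt, of i m] by (simp add: x_def add.commute)
  have xZ: "x \<in> Z m (s m)" for m
  proof -
    have "0 \<le> x i \<and> x i \<le> (1/2)^Suc m" if i: "snd (s m) \<le> i" for i
    proof -
      have "snd (s (Suc i)) \<le> snd (s (m + Suc i))" using strict_mono_mono[OF sm] by (simp add: mono_def)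
      then have "i < snd (s (m + Suc i))" using lt[of i] by simp
      then show ?thesis using small[OF i, of "Suc i"] x_eq by metis
    qed
    then show ?thesis unfolding Z_iff using x_eq by blast
  qed
  have "x \<notin> G m" for m
    using s(2)[of m] xZ[of m] xZ[of "Suc m"] by (auto simp: R_def Z_iff)
  moreover have "x \<in> unit_c0"
  proof -
    have "x \<longlonglongrightarrow> 0"
    proof (rule LIMSEQ_I)
      fix r :: real assume "r > 0"
      moreover have "(1/2::real) < 1" by simp
      ultimately obtain m where m: "(1/2)^m < r" using real_arch_pow_inv by blast
      have "norm (x i - 0) < r" if "i \<ge> snd (s m)" for i
        using xZ[of m] that m unfolding Z_iff by (auto dest!: spec[of _ i])
      then show "\<exists>no. \<forall>i\<ge>no. norm (x i - 0) < r" by blast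
    qed
    moreover have "\<bar>x i\<bar> < 1" for i
      using Zhalf[OF xZ[of 0] s(1)[of 0], of i] by auto
    ultimately show ?thesis by (simp add: unit_c0_def c0_def)
  qed
  ultimately show False using \<U>(3) G by blast
qed

section \<open>A family of plane continua\<close>

definition unit_box :: "(nat \<Rightarrow> real) set" where
  "unit_box = {z. \<forall>i. 0 \<le> z i \<and> z i \<le> 1}"

definition plane_pt :: "real \<Rightarrow> real \<Rightarrow> nat \<Rightarrow> real" where
  "plane_pt t s = (\<lambda>i. if i = 0 then t else if i = 1 then s else 0)"

text \<open>A tent of height 1 over the interval from \<open>3/4\<close> to \<open>5/4\<close> times
  \<open>(1/2)^Suc j\<close>. The factor 4 keeps the supports disjoint: the next one ends at
  \<open>5/8\<close> of the same unit. So \<open>profile\<close> has at most one nonzero summand at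
  any point.\<close>

definition bump :: "nat \<Rightarrow> real \<Rightarrow> real" where
  "bump j t = max 0 (1 - 4 * \<bar>t * 2 ^ Suc j - 1\<bar>)"

definition profile :: "(nat \<Rightarrow> real) \<Rightarrow> real \<Rightarrow> real" where
  "profile z t = (\<Sum>j. z j * bump j t)"

text \<open>In the triangle with vertices \<open>(0,0)\<close>, \<open>(1,0)\<close>, \<open>(0,1)\<close>, the base is replaced by the graph of
  \<open>t \<mapsto> (1 - t) profile z t\<close>; the first alternative describes that graph together with the left edge
  \<open>t = 0\<close>, the second one the hypotenuse. The peak with number \<open>j\<close> reaches the hypotenuse iff \<open>z j = 1\<close>.\<close>

definition curve :: "(nat \<Rightarrow> real) \<Rightarrow> (nat \<Rightarrow> real) set" where
  "curve z = {x \<in> cube 2. x 0 * x 1 = (1 - x 0) * (x 0 * profile z (x 0)) \<or> x 1 = 1 - x 0}"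

lemma plane_pt_simps [simp]: "plane_pt t s 0 = t" "plane_pt t s (Suc 0) = s"
  by (simp_all add: plane_pt_def)

lemma plane_pt_eq_iff [simp]: "plane_pt t s = plane_pt t' s' \<longleftrightarrow> t = t' \<and> s = s'"
  by (metis plane_pt_simps)

lemma plane_pt_in_cube: "plane_pt t s \<in> cube 2 \<longleftrightarrow> t \<in> {0..1} \<and> s \<in> {0..1}"
proof -
  have "(2::enat) \<le> enat i \<longrightarrow> plane_pt t s i = 0" for i
  proof
    assume "(2::enat) \<le> enat i"
    then have "2 \<le> i" by (simp flip: numeral_eq_enat)
    then show "plane_pt t s i = 0" by (simp add: plane_pt_def)
  qed
  moreover have "(\<forall>i. 0 \<le> plane_pt t s i \<and> plane_pt t s i \<le> 1) \<longleftrightarrow> t \<in> {0..1} \<and> s \<in> {0..1}"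
    by (auto simp: plane_pt_def split: if_splits)
  ultimately show ?thesis by (simp add: cube_def)
qed

lemma cube_2_eq_plane_pt: "x \<in> cube 2 \<Longrightarrow> x = plane_pt (x 0) (x 1)"
proof
  fix i assume x: "x \<in> cube 2"
  show "x i = plane_pt (x 0) (x 1) i"
  proof (cases "i < 2")
    case True
    then have "i = 0 \<or> i = 1" by auto
    then show ?thesis by (auto simp: plane_pt_def)
  next
    case False
    then have "(2::enat) \<le> enat i" by (simp flip: numeral_eq_enat)
    then show ?thesis using x False by (auto simp: cube_def plane_pt_def)
  qed
qed

lemma continuous_on_plane_pt [continuous_intros]:
  assumes "continuous_on A f" "continuous_on A g"
  shows "continuous_on A (\<lambda>a. plane_pt (f a) (g a))"
proof (rule continuous_on_coordinatewise_then_product)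
  show "continuous_on A (\<lambda>a. plane_pt (f a) (g a) i)" for i
    using assms by (cases "i = 0"; cases "i = 1") (auto simp: plane_pt_def)
qed

lemma continuous_on_coord [continuous_intros]:
  "continuous_on A (\<lambda>x :: nat \<Rightarrow> real. x i)"
  by (rule continuous_on_subset[OF continuous_on_product_coordinates]) simp

lemma bump_bounds: "0 \<le> bump j t" "bump j t \<le> 1"
  by (auto simp: bump_def)

lemma bump_nonzero_iff: "bump j t \<noteq> 0 \<longleftrightarrow> \<bar>t * 2 ^ Suc j - 1\<bar> < 1/4"
  by (cases "\<bar>t * 2 ^ Suc j - 1\<bar> < 1/4") (auto simp: bump_def max_def simp del: power_Suc)

lemma power2_double: "j < k \<Longrightarrow> 0 \<le> t \<Longrightarrow> 2 * (t * 2 ^ Suc j) \<le> t * (2::real) ^ Suc k"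
proof -
  assume "j < k" "0 \<le> t"
  then have "(2::real) ^ Suc (Suc j) \<le> 2 ^ Suc k" by (intro power_increasing) auto
  then show ?thesis using mult_left_mono[OF _ \<open>0 \<le> t\<close>] by fastforce
qed

lemma bump_support_pos:
  fixes t :: real
  assumes "\<bar>t * 2 ^ Suc j - 1\<bar> < 1/4" shows "0 < t"
proof -
  have "0 < t * 2 ^ Suc j" using assms by linarith
  then show ?thesis by (simp add: zero_less_mult_iff)
qed

lemma bump_support_unique:
  fixes t :: real
  assumes "\<bar>t * 2 ^ Suc j - 1\<bar> < 1/4" "\<bar>t * 2 ^ Suc k - 1\<bar> < 1/4"
  shows "j = k"
proof -
  have *: False if "j < k" "\<bar>t * 2 ^ Suc j - 1\<bar> < 1/4" "\<bar>t * 2 ^ Suc k - 1\<bar> < 1/4" for j k :: nat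
    using power2_double[OF that(1), of t] bump_support_pos[OF that(2)] that(2,3) by linarith
  show ?thesis using *[of j k] *[of k j] assms by (meson linorder_neqE_nat)
qed

lemma profile_eq_single:
  assumes "\<bar>t * 2 ^ Suc j - 1\<bar> < 1/4" shows "profile z t = z j * bump j t"
proof -
  have "profile z t = (\<Sum>k\<in>{j}. z k * bump k t)"
    unfolding profile_def
    by (rule suminf_finite) (use bump_support_unique[OF assms] bump_nonzero_iff in \<open>auto simp del: power_Suc\<close>)
  then show ?thesis by simp
qed

lemma profile_eq_0:
  assumes "\<And>j. \<not> \<bar>t * 2 ^ Suc j - 1\<bar> < 1/4" shows "profile z t = 0"
proof -
  have "bump k t = 0" for k using assms[of k] bump_nonzero_iff by blast
  then show ?thesis by (simp add: profile_def)
qed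

lemma profile_cases:
  obtains "\<And>z. profile z t = 0"
  | j where "\<bar>t * 2 ^ Suc j - 1\<bar> < 1/4" "\<And>z. profile z t = z j * bump j t"
  using profile_eq_single profile_eq_0 by metis

lemma profile_bounds:
  assumes "z \<in> unit_box" shows "0 \<le> profile z t" "profile z t \<le> 1"
proof -
  have z: "0 \<le> z j" "z j \<le> 1" for j using assms by (auto simp: unit_box_def)
  have "0 \<le> profile z t \<and> profile z t \<le> 1"
    by (rule profile_cases[of t]) (auto simp: z bump_bounds mult_le_one)
  then show "0 \<le> profile z t" "profile z t \<le> 1" by auto
qed

lemma profile_at_0 [simp]: "profile z 0 = 0"
  by (rule profile_eq_0) auto

lemma profile_right: "5/8 \<le> t \<Longrightarrow> profile z t = 0"
proof (rule profile_eq_0)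
  fix j assume t: "5/8 \<le> t"
  have "(2::real) ^ 1 \<le> 2 ^ Suc j" by (intro power_increasing) auto
  then have "5/8 * 2 \<le> t * 2 ^ Suc j" using t by (intro mult_mono) auto
  then show "\<not> \<bar>t * 2 ^ Suc j - 1\<bar> < 1/4" by linarith
qed

lemma half_power_mult: "(1/2::real) ^ Suc j * 2 ^ Suc j = 1"
  by (simp flip: power_mult_distrib)

lemma profile_peak: "profile z ((1/2) ^ Suc j) = z j"
proof -
  have "bump j ((1/2) ^ Suc j) = 1" unfolding bump_def half_power_mult by simp
  moreover have "\<bar>(1/2) ^ Suc j * 2 ^ Suc j - 1\<bar> < (1/4::real)" unfolding half_power_mult by simp
  ultimately show ?thesis using profile_eq_single by simp
qed

text \<open>At this left end \<open>t\<close> of the support of \<open>bump j\<close>, the number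
  \<open>t * 2 ^ Suc k\<close> is at most \<open>3/8\<close> for \<open>k < j\<close> and at least
  \<open>3/2\<close> for \<open>k > j\<close>. Such valleys accumulate at 0 and separate the
  peaks.\<close>

lemma profile_valley: "profile z (3/4 * (1/2) ^ Suc j) = 0"
proof (rule profile_eq_0)
  fix k
  have *: "\<not> \<bar>t * 2 ^ Suc k - 1\<bar> < 1/4" if "t \<ge> 0" "t * 2 ^ Suc j = 3/4" for t :: real
  proof (cases k j rule: linorder_cases)
    case less
    then show ?thesis using power2_double[OF less that(1)] that(2) by linarith
  next
    case equal
    then show ?thesis using that(2) by simp
  next
    case greater
    then show ?thesis using power2_double[OF greater that(1)] that(2) by linarith
  qed
  have "3/4 * (1/2::real) ^ Suc j * 2 ^ Suc j = 3/4"
    using half_power_mult[of j] by (simp only: mult.assoc mult_1_right)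
  then show "\<not> \<bar>3/4 * (1/2) ^ Suc j * 2 ^ Suc k - 1\<bar> < (1/4::real)"
    by (intro *) simp_all
qed

lemma support_index_less:
  fixes t :: real
  assumes "\<bar>t * 2 ^ Suc j - 1\<bar> < 1/4" "(1/2) ^ M \<le> t" shows "j < M"
proof (rule ccontr)
  assume "\<not> j < M"
  then have "(2::real) ^ Suc M \<le> 2 ^ Suc j" by (intro power_increasing) auto
  then have "(1/2) ^ M * 2 ^ Suc M \<le> t * 2 ^ Suc j"
    using assms(2) by (intro mult_mono order_trans[OF _ assms(2)]) auto
  moreover have "(1/2::real) ^ M * 2 ^ Suc M = 2" by (simp add: power_one_over)
  ultimately show False using assms(1) by linarith
qed

lemma continuous_on_bump: "continuous_on A (bump j)"
  unfolding bump_def by (intro continuous_intros)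

text \<open>To the right of \<open>(1/2)^M\<close> only the peaks with \<open>j < M\<close>
  contribute, so the sum is locally finite away from 0.\<close>

lemma continuous_on_profile: "continuous_on {0<..} (profile z)"
proof -
  have c: "continuous_on {(1/2)^M<..} (profile z)" for M
  proof -
    have "continuous_on {(1/2)^M<..} (\<lambda>t. \<Sum>j<M. z j * bump j t)"
      by (intro continuous_intros continuous_on_bump)
    moreover have "(\<Sum>j<M. z j * bump j t) = profile z t" if "t \<in> {(1/2)^M<..}" for t
      unfolding profile_def
    proof (rule suminf_finite[symmetric])
      show "z j * bump j t = 0" if "j \<notin> {..<M}" for j
        using support_index_less[of t j M] bump_nonzero_iff[of j t] that \<open>t \<in> _\<close> by auto
    qed simp
    ultimately show ?thesis by (rule continuous_on_eq)
  qed
  have "continuous_on (\<Union>M. {(1/2)^M<..}) (profile z)"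
    by (rule continuous_on_open_UN) (use c in auto)
  moreover have "(\<Union>M. {(1/2)^M<..}) = {0::real<..}"
  proof
    show "{0::real<..} \<subseteq> (\<Union>M. {(1/2)^M<..})"
    proof
      fix t :: real assume "t \<in> {0<..}"
      then have "0 < t" "(1/2::real) < 1" by auto
      then show "t \<in> (\<Union>M. {(1/2)^M<..})" using real_arch_pow_inv by auto
    qed
  qed (auto intro: order.strict_trans[rotated])
  ultimately show ?thesis by simp
qed

lemma continuous_on_profile_null:
  assumes z: "z \<in> unit_box" and lim: "z \<longlonglongrightarrow> 0"
  shows "continuous_on {0..} (profile z)"
  unfolding continuous_on_eq_continuous_within
proof
  fix t :: real assume "t \<in> {0..}"
  show "continuous (at t within {0..}) (profile z)"
  proof (cases "t = 0")
    case False
    then have "t \<in> {0<..}" using \<open>t \<in> {0..}\<close> by simp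
    then have "isCont (profile z) t"
      using continuous_on_profile[of z] by (simp add: continuous_on_eq_continuous_at)
    then show ?thesis by (rule continuous_at_imp_continuous_within)
  next
    case True
    show ?thesis
      unfolding True continuous_within_eps_delta
    proof (intro allI impI)
      fix e :: real assume e: "e > 0"
      then have "\<forall>\<^sub>F j in sequentially. z j < e" using lim by (intro order_tendstoD(2))
      then obtain n where n: "\<And>j. j \<ge> n \<Longrightarrow> z j < e" by (auto simp: eventually_sequentially)
      have "dist (profile z t) (profile z 0) < e" if t: "t \<in> {0..}" "dist t 0 < (1/2) ^ Suc n" for t
      proof (rule profile_cases[of t])
        assume "\<And>z. profile z t = 0"
        then show ?thesis using e by simp
      next
        fix j assume j: "\<bar>t * 2 ^ Suc j - 1\<bar> < 1/4" "\<And>z. profile z t = z j * bump j t"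
        have "\<not> j < n"
        proof
          assume "j < n"
          then have "(2::real) ^ Suc j \<le> 2 ^ n" by (intro power_increasing) auto
          then have "t * 2 ^ Suc j \<le> (1/2) ^ Suc n * 2 ^ n"
            using t by (intro mult_mono) auto
          also have "\<dots> = 1/2" by (simp add: power_one_over)
          finally show False using j(1) by linarith
        qed
        then have "z j < e" using n by simp
        moreover have "z j * bump j t \<le> z j" "0 \<le> z j * bump j t"
          using z bump_bounds[of j t] by (auto simp: unit_box_def mult_left_le)
        ultimately show ?thesis by (simp add: j(2) dist_real_def)
      qed
      then show "\<exists>d>0. \<forall>x'\<in>{0..}. dist x' 0 < d \<longrightarrow> dist (profile z x') (profile z 0) < e"
        by (intro exI[of _ "(1/2) ^ Suc n"]) (auto simp del: power_Suc)
    qed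
  qed
qed

text \<open>If \<open>z\<close> does not tend to zero, \<open>profile z\<close> is discontinuous at
  0, but it stays bounded and the factor \<open>t\<close> restores continuity. This is why the
  equation in \<open>curve\<close> carries the factor \<open>x 0\<close>: it makes the set closed
  and includes the left edge.\<close>

lemma continuous_on_times_profile:
  assumes z: "z \<in> unit_box"
  shows "continuous_on {0..} (\<lambda>t. t * profile z t)"
  unfolding continuous_on_eq_continuous_within
proof
  fix t :: real assume "t \<in> {0..}"
  show "continuous (at t within {0..}) (\<lambda>t. t * profile z t)"
  proof (cases "t = 0")
    case False
    then have "t \<in> {0<..}" using \<open>t \<in> {0..}\<close> by simp
    then have "isCont (profile z) t"
      using continuous_on_profile[of z] by (simp add: continuous_on_eq_continuous_at)
    then have "isCont (\<lambda>t. t * profile z t) t" by (intro isCont_mult continuous_ident)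
    then show ?thesis by (rule continuous_at_imp_continuous_within)
  next
    case True
    have *: "dist (t * profile z t) (0 * profile z 0) \<le> dist t 0" for t
      using mult_left_le[of "\<bar>profile z t\<bar>" "\<bar>t\<bar>"] profile_bounds[OF z, of t] by (simp add: abs_mult)
    then show ?thesis
      unfolding True continuous_within_eps_delta using order.strict_trans1[OF *] by blast
  qed
qed

lemma plane_pt_in_curve_iff:
  "plane_pt t s \<in> curve z \<longleftrightarrow> t \<in> {0..1} \<and> s \<in> {0..1} \<and> (t = 0 \<or> s = (1 - t) * profile z t \<or> s = 1 - t)"
proof -
  have "t * s = (1 - t) * (t * profile z t) \<longleftrightarrow> t = 0 \<or> s = (1 - t) * profile z t"
    by (metis mult.left_commute mult_cancel_left)
  then show ?thesis by (auto simp: curve_def plane_pt_in_cube)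
qed

lemma curve_eq_plane_pt: "x \<in> curve z \<Longrightarrow> x = plane_pt (x 0) (x 1)"
  unfolding curve_def by (rule cube_2_eq_plane_pt) simp

lemma curve_ex_plane_pt: "x \<in> curve z \<Longrightarrow> \<exists>t s. x = plane_pt t s"
  using curve_eq_plane_pt by blast

lemma closed_curve:
  assumes z: "z \<in> unit_box" and "closed (cube 2)" shows "closed (curve z)"
proof -
  have "continuous_on (cube 2) (\<lambda>x. x 0 * x 1 - (1 - x 0) * (x 0 * profile z (x 0)))"
    by (intro continuous_intros continuous_on_compose2[OF continuous_on_times_profile[OF z]])
      (auto simp: cube_def)
  then have "closed (cube 2 \<inter> (\<lambda>x. x 0 * x 1 - (1 - x 0) * (x 0 * profile z (x 0))) -` {0})"
    using assms(2) by (intro continuous_closed_preimage) auto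
  moreover have "closed {x :: nat \<Rightarrow> real. x 1 = 1 - x 0}"
    by (intro closed_Collect_eq continuous_intros)
  ultimately have "closed ((cube 2 \<inter> (\<lambda>x. x 0 * x 1 - (1 - x 0) * (x 0 * profile z (x 0))) -` {0})
      \<union> (cube 2 \<inter> {x. x 1 = 1 - x 0}))"
    using closed_Un[OF _ closed_Int[OF assms(2)]] by blast
  moreover have "(cube 2 \<inter> (\<lambda>x. x 0 * x 1 - (1 - x 0) * (x 0 * profile z (x 0))) -` {0})
      \<union> (cube 2 \<inter> {x. x 1 = 1 - x 0}) = curve z"
    by (auto simp: curve_def)
  ultimately show ?thesis by simp
qed

lemma scaled_profile_bounds:
  assumes "z \<in> unit_box" "t \<in> {0..1}"
  shows "(1 - t) * profile z t \<in> {0..1}" "(1 - t) * profile z t \<le> 1 - t"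
proof -
  have "(1 - t) * profile z t \<le> 1 - t"
    using profile_bounds[OF assms(1), of t] assms(2) by (intro mult_left_le) auto
  then show "(1 - t) * profile z t \<in> {0..1}" "(1 - t) * profile z t \<le> 1 - t"
    using profile_bounds[OF assms(1), of t] assms(2) by auto
qed

lemma curve_eq_Un:
  assumes "z \<in> unit_box"
  shows "curve z = (\<lambda>t. plane_pt t ((1 - t) * profile z t)) ` {0<..1} \<union>
    ((\<lambda>t. plane_pt t (1 - t)) ` {0..1} \<union> plane_pt 0 ` {0..1})"
proof
  show "curve z \<subseteq> (\<lambda>t. plane_pt t ((1 - t) * profile z t)) ` {0<..1} \<union>
    ((\<lambda>t. plane_pt t (1 - t)) ` {0..1} \<union> plane_pt 0 ` {0..1})"
  proof
    fix x assume x: "x \<in> curve z"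
    then obtain t s where ts: "x = plane_pt t s" using curve_ex_plane_pt by blast
    show "x \<in> (\<lambda>t. plane_pt t ((1 - t) * profile z t)) ` {0<..1} \<union>
      ((\<lambda>t. plane_pt t (1 - t)) ` {0..1} \<union> plane_pt 0 ` {0..1})"
      using x unfolding ts plane_pt_in_curve_iff by (cases "t = 0") auto
  qed
next
  have "plane_pt t ((1 - t) * profile z t) \<in> curve z" if "t \<in> {0<..1}" for t
    using scaled_profile_bounds(1)[OF assms, of t] that unfolding plane_pt_in_curve_iff by simp
  moreover have "plane_pt t (1 - t) \<in> curve z" "plane_pt 0 t \<in> curve z" if "t \<in> {0..1}" for t
    using that unfolding plane_pt_in_curve_iff by simp_all
  ultimately show "(\<lambda>t. plane_pt t ((1 - t) * profile z t)) ` {0<..1} \<union>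
    ((\<lambda>t. plane_pt t (1 - t)) ` {0..1} \<union> plane_pt 0 ` {0..1}) \<subseteq> curve z"
    by blast
qed

lemma connected_curve:
  assumes "z \<in> unit_box" shows "connected (curve z)"
proof -
  let ?A = "(\<lambda>t. plane_pt t ((1 - t) * profile z t)) ` {0<..1}"
  let ?B = "(\<lambda>t. plane_pt t (1 - t)) ` {0..1}" and ?C = "(\<lambda>t. plane_pt 0 t) ` {0..1}"
  have "continuous_on {0<..1} (profile z)"
    by (rule continuous_on_subset[OF continuous_on_profile]) auto
  then have A: "connected ?A"
    by (intro connected_continuous_image continuous_intros) auto
  have B: "connected ?B" "connected ?C"
    by (intro connected_continuous_image continuous_intros; simp)+
  have "plane_pt 0 1 \<in> ?B" "plane_pt 0 1 \<in> ?C"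
    by (rule image_eqI[of _ _ 0]; simp) (rule image_eqI[of _ _ 1]; simp)
  then have "?B \<inter> ?C \<noteq> {}" by blast
  then have BC: "connected (?B \<union> ?C)" by (rule connected_Un[OF B])
  have "plane_pt 1 0 \<in> ?A" "plane_pt 1 0 \<in> ?B"
    by (rule image_eqI[of _ _ 1]; simp)+
  then have "?A \<inter> (?B \<union> ?C) \<noteq> {}" by blast
  then have "connected (?A \<union> (?B \<union> ?C))" by (rule connected_Un[OF A BC])
  then show ?thesis by (simp only: curve_eq_Un[OF assms])
qed

text \<open>Over the abscissa \<open>t\<close> of peak \<open>j\<close> the curve has only the
  heights \<open>(1 - t) * z j\<close> and \<open>1 - t\<close>. So the parameters agree at
  \<open>j\<close> or the first of them is 1; exchanging the roles, the second one is 1 as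
  well.\<close>

lemma curve_inject:
  assumes "z \<in> unit_box" "z' \<in> unit_box" and eq: "curve z = curve z'"
  shows "z = z'"
proof
  fix j
  have *: "a j = b j \<or> a j = 1" if "a \<in> unit_box" "b \<in> unit_box" "curve a = curve b" for a b
  proof -
    let ?t = "(1/2::real) ^ Suc j"
    have t: "?t \<in> {0..1}" "?t \<noteq> 0" "?t \<noteq> 1"
      using power_decreasing[of 1 "Suc j" "1/2::real"] by (auto simp del: power_Suc)
    have "plane_pt ?t ((1 - ?t) * a j) \<in> curve a"
      using scaled_profile_bounds(1)[OF that(1) t(1)] t(1) unfolding plane_pt_in_curve_iff profile_peak by blast
    then have "plane_pt ?t ((1 - ?t) * a j) \<in> curve b" using that(3) by simp
    then have "(1 - ?t) * a j = (1 - ?t) * b j \<or> (1 - ?t) * a j = 1 - ?t"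
      using t(2) unfolding plane_pt_in_curve_iff profile_peak by blast
    then show ?thesis using t(3) by auto
  qed
  show "z j = z' j" using *[OF assms] *[OF assms(2,1) eq[symmetric]] by auto
qed

text \<open>Points of the graph with abscissa below \<open>(1/2)^M\<close> are matched horizontally
  with the left edge, which all the curves share; elsewhere only the first \<open>M\<close> heights
  matter. This is what the product topology can control.\<close>

lemma curve_near:
  assumes z: "z \<in> unit_box" "z' \<in> unit_box" and d: "(1/2) ^ M < d"
    and close: "\<And>j. j < M \<Longrightarrow> \<bar>z j - z' j\<bar> < d"
    and pl: "\<And>t s t' s'. \<lbrakk>t \<in> {0..1}; s \<in> {0..1}; t' \<in> {0..1}; s' \<in> {0..1}; dist (t, s) (t', s') < d\<rbrakk>
      \<Longrightarrow> dist (plane_pt t s) (plane_pt t' s') \<le> e" and e: "e \<ge> 0"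
    and x: "x \<in> curve z"
  shows "\<exists>y\<in>curve z'. dist x y \<le> e"
proof -
  obtain t s where ts: "x = plane_pt t s" using x curve_ex_plane_pt by blast
  have x': "t \<in> {0..1}" "s \<in> {0..1}" "t = 0 \<or> s = (1 - t) * profile z t \<or> s = 1 - t"
    using x unfolding ts plane_pt_in_curve_iff by auto
  have d0: "d > 0" using d by (metis half_gt_zero less_trans zero_less_one zero_less_power)
  consider "t = 0 \<or> s = 1 - t" | "s = (1 - t) * profile z t" "t < (1/2)^M"
    | "s = (1 - t) * profile z t" "(1/2)^M \<le> t"
    using x' by fastforce
  then show ?thesis
  proof cases
    case 1
    then have "x \<in> curve z'" using x' unfolding ts plane_pt_in_curve_iff by auto
    then show ?thesis using e by (intro bexI[of _ x]) auto
  next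
    case 2
    have "plane_pt 0 s \<in> curve z'" using x' unfolding plane_pt_in_curve_iff by auto
    moreover have "dist x (plane_pt 0 s) \<le> e"
      unfolding ts using x' 2 d by (intro pl) (auto simp: dist_prod_def)
    ultimately show ?thesis by blast
  next
    case 3
    let ?s' = "(1 - t) * profile z' t"
    have s': "?s' \<in> {0..1}" by (rule scaled_profile_bounds[OF z(2) x'(1)])
    have "plane_pt t ?s' \<in> curve z'" using x' s' unfolding plane_pt_in_curve_iff by auto
    moreover have "\<bar>profile z t - profile z' t\<bar> < d"
    proof (rule profile_cases[of t])
      fix j assume j: "\<bar>t * 2 ^ Suc j - 1\<bar> < 1/4" "\<And>z. profile z t = z j * bump j t"
      have "\<bar>profile z t - profile z' t\<bar> = \<bar>z j - z' j\<bar> * bump j t"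
        by (simp add: j(2) bump_bounds abs_mult flip: left_diff_distrib)
      also have "\<dots> \<le> \<bar>z j - z' j\<bar>" by (intro mult_left_le bump_bounds) auto
      also have "\<dots> < d" by (rule close[OF support_index_less[OF j(1) 3(2)]])
      finally show ?thesis .
    qed (use d0 in simp)
    moreover have "\<bar>s - ?s'\<bar> \<le> \<bar>profile z t - profile z' t\<bar>"
    proof -
      have "s - ?s' = (1 - t) * (profile z t - profile z' t)" by (simp add: 3(1) right_diff_distrib)
      then have "\<bar>s - ?s'\<bar> = \<bar>profile z t - profile z' t\<bar> * (1 - t)" using x'(1) by (simp add: abs_mult)
      also have "\<dots> \<le> \<bar>profile z t - profile z' t\<bar>" by (rule mult_left_le) (use x'(1) in auto)
      finally show ?thesis .
    qed
    ultimately have "dist x (plane_pt t ?s') \<le> e"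
      unfolding ts using x' s' by (intro pl) (auto simp: dist_prod_def dist_real_def)
    then show ?thesis using \<open>plane_pt t ?s' \<in> curve z'\<close> by blast
  qed
qed

text \<open>Uniform continuity on the compact square replaces any computation with the metric of
  \<open>nat \<Rightarrow> real\<close>.\<close>

lemma ex_plane_pt_modulus:
  assumes "e > 0"
  obtains d where "d > 0"
    "\<And>t s t' s'. \<lbrakk>t \<in> {0..1}; s \<in> {0..1}; t' \<in> {0..1}; s' \<in> {0..1}; dist (t, s) (t', s') < d\<rbrakk>
      \<Longrightarrow> dist (plane_pt t s) (plane_pt t' s') \<le> e"
proof -
  have "uniformly_continuous_on ({0..1} \<times> {0..1}) (\<lambda>p. plane_pt (fst p) (snd p))"
    by (intro compact_uniformly_continuous continuous_intros compact_Times) auto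
  then obtain d where d: "d > 0" "\<forall>p\<in>{0..1} \<times> {0..1}. \<forall>q\<in>{0..1} \<times> {0..1}. dist q p < d \<longrightarrow>
      dist (plane_pt (fst q) (snd q)) (plane_pt (fst p) (snd p)) < e"
    using assms unfolding uniformly_continuous_on_def by blast
  show ?thesis
  proof (rule that[OF d(1)])
    fix t s t' s' :: real assume "t \<in> {0..1}" "s \<in> {0..1}" "t' \<in> {0..1}" "s' \<in> {0..1}" "dist (t, s) (t', s') < d"
    then show "dist (plane_pt t s) (plane_pt t' s') \<le> e"
      using d(2)[rule_format, of "(t', s')" "(t, s)"] by simp
  qed
qed

section \<open>Homogeneity of the curves\<close>

definition locally_line :: "'a::topological_space set \<Rightarrow> 'a \<Rightarrow> bool" where
  "locally_line K x \<longleftrightarrow>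
     (\<exists>V (I :: real set). openin (top_of_set K) V \<and> x \<in> V \<and> open I \<and> V homeomorphic I)"

lemma homogeneous_locally_line:
  assumes "homogeneous K" "x \<in> K" "y \<in> K" "locally_line K x"
  shows "locally_line K y"
proof -
  obtain h g where h: "homeomorphism K K h g" "h x = y"
    using assms(1-3) unfolding homogeneous_def by blast
  obtain V and I :: "real set" where V: "openin (top_of_set K) V" "x \<in> V" "open I" "V homeomorphic I"
    using assms(4) unfolding locally_line_def by blast
  have "openin (top_of_set K) (h ` V)"
    by (rule homeomorphism_imp_open_map[OF h(1) V(1)])
  moreover have "h ` V homeomorphic I"
  proof -
    have "V \<subseteq> K" using V(1) by (rule openin_imp_subset)
    then have "homeomorphism V (h ` V) h g" by (rule homeomorphism_of_subsets[OF h(1)]) auto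
    then show ?thesis using V(4) by (meson homeomorphic_def homeomorphic_sym homeomorphic_trans)
  qed
  ultimately show ?thesis using V(2,3) h(2) unfolding locally_line_def by blast
qed

lemma locally_line_curve:
  assumes z: "z \<in> unit_box"
  shows "plane_pt (3/4) (1/4) \<in> curve z" "locally_line (curve z) (plane_pt (3/4) (1/4))"
proof -
  show mem: "plane_pt (3/4) (1/4) \<in> curve z" by (simp add: plane_pt_in_curve_iff)
  let ?I = "{5/8<..<7/8::real}"
  \<comment> \<open>All supports end by \<open>5/8\<close>, so there the graph has height 0 and the
    condition \<open>0 < x 1\<close> leaves only the hypotenuse.\<close>
  define O' where "O' = {x :: nat \<Rightarrow> real. 5/8 < x 0 \<and> x 0 < 7/8 \<and> 0 < x 1}"
  have "open O'"
    unfolding O'_def by (intro open_Collect_conj open_Collect_less continuous_intros)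
  moreover have "homeomorphism (curve z \<inter> O') ?I (\<lambda>x. x 0) (\<lambda>t. plane_pt t (1 - t))"
  proof (rule homeomorphismI)
    show "(\<lambda>t. plane_pt t (1 - t)) ` ?I \<subseteq> curve z \<inter> O'"
      by (auto simp: plane_pt_in_curve_iff O'_def)
    show "plane_pt (x 0) (1 - x 0) = x" if x: "x \<in> curve z \<inter> O'" for x
    proof -
      obtain t s where ts: "x = plane_pt t s" using x curve_ex_plane_pt by blast
      have "5/8 < t" "0 < s" using x by (auto simp: ts O'_def)
      then have "s = 1 - t" using x profile_right[of t z] by (auto simp: ts plane_pt_in_curve_iff)
      then show ?thesis by (simp add: ts)
    qed
    show "continuous_on ?I (\<lambda>t. plane_pt t (1 - t))" by (intro continuous_intros)
    show "continuous_on (curve z \<inter> O') (\<lambda>x. x 0)" by (intro continuous_intros)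
  qed (auto simp: O'_def)
  then have "curve z \<inter> O' homeomorphic ?I" by (auto simp: homeomorphic_def)
  moreover have "plane_pt (3/4) (1/4) \<in> curve z \<inter> O'" using mem by (simp add: O'_def)
  ultimately show "locally_line (curve z) (plane_pt (3/4) (1/4))"
    unfolding locally_line_def
    by (intro exI[of _ "curve z \<inter> O'"] exI[of _ ?I]) (auto simp: openin_open_Int)
qed

text \<open>The smaller of the two end values is also taken by the other path, by the intermediate
  value theorem.\<close>

lemma rising_paths_meet:
  fixes u v :: "real \<Rightarrow> real"
  assumes "continuous_on {0..1} u" "continuous_on {0..1} v" "u 0 = v 0" "u 1 > u 0" "v 1 > v 0"
  shows "\<exists>s\<in>{0<..1}. \<exists>s'\<in>{0<..1}. u s = v s'"
proof -
  have *: "\<exists>s\<in>{0<..1}. \<exists>s'\<in>{0<..1}. u s = v s'"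
    if uv: "continuous_on {0..1} v" "u 0 = v 0" "u 1 > u 0" "u 1 \<le> v 1" for u v :: "real \<Rightarrow> real"
  proof -
    obtain s' where s': "0 \<le> s'" "s' \<le> 1" "v s' = u 1"
      using IVT'[of v 0 "u 1" 1] uv by auto
    then have "s' \<noteq> 0" using uv by auto
    then show ?thesis using s' by (intro bexI[of _ 1] bexI[of _ s']) auto
  qed
  show ?thesis
  proof (cases "u 1 \<le> v 1")
    case True
    then show ?thesis using * assms by blast
  next
    case False
    then have "\<exists>s\<in>{0<..1}. \<exists>s'\<in>{0<..1}. v s = u s'" using *[of u v] assms by simp
    then show ?thesis by metis
  qed
qed

text \<open>On a line \<open>g q\<close> has only two sides, so two of the three end points lie on
  the same side; \<open>rising_paths_meet\<close>, after a change of sign if necessary, makes these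
  two arms cross.\<close>

lemma no_triod_in_line:
  fixes I :: "real set" and a b c :: "real \<Rightarrow> 'a::topological_space"
  assumes V: "V homeomorphic I"
    and cont: "continuous_on {0..1} a" "continuous_on {0..1} b" "continuous_on {0..1} c"
    and img: "a ` {0..1} \<subseteq> V" "b ` {0..1} \<subseteq> V" "c ` {0..1} \<subseteq> V"
    and start: "a 0 = q" "b 0 = q" "c 0 = q"
    and nq: "a 1 \<noteq> q" "b 1 \<noteq> q" "c 1 \<noteq> q"
    and disj: "\<And>s s'. \<lbrakk>s \<in> {0<..1}; s' \<in> {0<..1}\<rbrakk> \<Longrightarrow> a s \<noteq> b s' \<and> a s \<noteq> c s' \<and> b s \<noteq> c s'"
  shows False
proof -
  obtain g g' where g: "homeomorphism V I g g'" using V homeomorphic_def by blast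
  have cg: "continuous_on V g" and inj: "inj_on g V"
    using g by (auto simp: homeomorphism_def intro: inj_on_inverseI)
  have cont': "continuous_on {0..1} (\<lambda>s. g (f s))" if "continuous_on {0..1} f" "f ` {0..1} \<subseteq> V" for f :: "real \<Rightarrow> _"
    by (rule continuous_on_compose2[OF cg that])
  have meet: False
    if f: "continuous_on {0..1} f" "f ` {0..1} \<subseteq> V" "f 0 = q" and k: "continuous_on {0..1} k" "k ` {0..1} \<subseteq> V" "k 0 = q"
      and side: "(g (f 1) > g q \<and> g (k 1) > g q) \<or> (g (f 1) < g q \<and> g (k 1) < g q)"
      and d: "\<And>s s'. \<lbrakk>s \<in> {0<..1}; s' \<in> {0<..1}\<rbrakk> \<Longrightarrow> f s \<noteq> k s'" for f k :: "real \<Rightarrow> _"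
  proof -
    have "\<exists>s\<in>{0<..1}. \<exists>s'\<in>{0<..1}. g (f s) = g (k s')"
    proof (cases "g (f 1) > g q")
      case True
      then show ?thesis
        using rising_paths_meet[of "\<lambda>s. g (f s)" "\<lambda>s. g (k s)"] side f k cont' by simp
    next
      case False
      then have "\<exists>s\<in>{0<..1}. \<exists>s'\<in>{0<..1}. - g (f s) = - g (k s')"
        using side f k cont'[of f] cont'[of k]
        by (intro rising_paths_meet continuous_on_minus) auto
      then show ?thesis by simp
    qed
    then obtain s s' where s: "s \<in> {0<..1}" "s' \<in> {0<..1}" "g (f s) = g (k s')" by blast
    have "f s \<in> V" "k s' \<in> V" using s(1,2) f(2) k(2) by (auto simp: image_subset_iff)
    then have "f s = k s'" using inj s(3) by (simp add: inj_on_eq_iff)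
    then show False using d s by blast
  qed
  have qV: "q \<in> V" "a 1 \<in> V" "b 1 \<in> V" "c 1 \<in> V" using img start(1)[symmetric] by (simp_all add: image_subset_iff)
  then have "g (a 1) \<noteq> g q" "g (b 1) \<noteq> g q" "g (c 1) \<noteq> g q" using nq inj by (auto simp: inj_on_eq_iff)
  then consider "(g (a 1) > g q \<and> g (b 1) > g q) \<or> (g (a 1) < g q \<and> g (b 1) < g q)"
    | "(g (a 1) > g q \<and> g (c 1) > g q) \<or> (g (a 1) < g q \<and> g (c 1) < g q)"
    | "(g (b 1) > g q \<and> g (c 1) > g q) \<or> (g (b 1) < g q \<and> g (c 1) < g q)"
    by linarith
  then show False
    by cases (use meet[OF cont(1) img(1) start(1) cont(2) img(2) start(2)]
        meet[OF cont(1) img(1) start(1) cont(3) img(3) start(3)]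
        meet[OF cont(2) img(2) start(2) cont(3) img(3) start(3)] disj in blast)+
qed

text \<open>The touching point is the centre of a triod: the hypotenuse on either side of it and the
  right flank of the peak.\<close>

lemma not_locally_line_touching_peak:
  assumes z: "z \<in> unit_box" and zj: "z j = 1"
  defines "\<tau> \<equiv> (1/2::real) ^ Suc j"
  shows "plane_pt \<tau> (1 - \<tau>) \<in> curve z" "\<not> locally_line (curve z) (plane_pt \<tau> (1 - \<tau>))"
proof -
  have \<tau>: "0 < \<tau>" "\<tau> \<le> 1/2" "\<tau> * 2 ^ Suc j = 1"
    unfolding \<tau>_def using power_decreasing[of 1 "Suc j" "1/2::real"] half_power_mult[of j] by (auto simp del: power_Suc)
  let ?q = "plane_pt \<tau> (1 - \<tau>)"
  show "?q \<in> curve z" using \<tau> by (simp add: plane_pt_in_curve_iff)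
  define C where "C t = plane_pt t ((1 - t) * profile z t)" for t
  define H where "H t = plane_pt t (1 - t)" for t
  have C_q: "C \<tau> = ?q" using profile_peak[of z j] zj by (simp add: C_def \<tau>_def)
  have cC: "continuous_on {0<..} C" unfolding C_def by (intro continuous_intros continuous_on_profile)
  have cH: "continuous_on {0<..} H" unfolding H_def by (intro continuous_intros)
  show "\<not> locally_line (curve z) ?q"
  proof
    assume "locally_line (curve z) ?q"
    then obtain V and I :: "real set" where V: "openin (top_of_set (curve z)) V" "?q \<in> V" "V homeomorphic I"
      unfolding locally_line_def by blast
    then obtain e where e: "e > 0" "ball ?q e \<inter> curve z \<subseteq> V" unfolding openin_contains_ball by blast
    obtain d1 where d1: "d1 > 0" "\<forall>t\<in>{0<..}. dist t \<tau> < d1 \<longrightarrow> dist (C t) (C \<tau>) < e"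
      using cC[unfolded continuous_on_iff, rule_format, of \<tau> e] \<tau>(1) e(1) by auto
    obtain d2 where d2: "d2 > 0" "\<forall>t\<in>{0<..}. dist t \<tau> < d2 \<longrightarrow> dist (H t) (H \<tau>) < e"
      using cH[unfolded continuous_on_iff, rule_format, of \<tau> e] \<tau>(1) e(1) by auto
    \<comment> \<open>\<open>d1\<close> and \<open>d2\<close> keep the arms inside \<open>V\<close>;
      \<open>\<tau>/4\<close> is half the width of the support of \<open>bump j\<close>, so that
      only this peak contributes. The halving gives strict inequalities.\<close>
    define \<eta> where "\<eta> = min (min d1 d2) (\<tau>/4) / 2"
    have \<eta>: "0 < \<eta>" "\<eta> < d1" "\<eta> < d2" "\<eta> < \<tau>/4" using d1(1) d2(1) \<tau>(1) by (auto simp: \<eta>_def)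
    have t_bounds: "0 < \<tau> + \<eta> * s" "\<tau> + \<eta> * s < 1" "\<bar>\<eta> * s\<bar> \<le> \<eta>" "\<bar>(\<tau> + \<eta> * s) * 2 ^ Suc j - 1\<bar> < 1/4"
      if "\<bar>s\<bar> \<le> 1" for s
    proof -
      have "\<bar>\<eta> * s\<bar> = \<eta> * \<bar>s\<bar>" using \<eta>(1) by (simp add: abs_mult)
      then show *: "\<bar>\<eta> * s\<bar> \<le> \<eta>" using mult_left_le[OF that, of \<eta>] \<eta>(1) by simp
      then show "0 < \<tau> + \<eta> * s" "\<tau> + \<eta> * s < 1" using \<tau> \<eta>(4) by linarith+
      have "\<bar>(\<tau> + \<eta> * s) * 2 ^ Suc j - 1\<bar> = \<bar>\<eta> * s\<bar> * 2 ^ Suc j"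
        by (simp add: distrib_right \<tau>(3) abs_mult del: power_Suc)
      also have "\<dots> \<le> \<eta> * 2 ^ Suc j" using * by (intro mult_right_mono) auto
      also have "\<dots> < \<tau>/4 * 2 ^ Suc j" using \<eta>(4) by (intro mult_strict_right_mono) auto
      also have "\<dots> = 1/4" using \<tau>(3) by simp
      finally show "\<bar>(\<tau> + \<eta> * s) * 2 ^ Suc j - 1\<bar> < 1/4" .
    qed
    have prof: "profile z (\<tau> + \<eta> * s) < 1" if s: "\<bar>s\<bar> \<le> 1" "s \<noteq> 0" for s
    proof -
      have "profile z (\<tau> + \<eta> * s) = bump j (\<tau> + \<eta> * s)"
        using profile_eq_single[OF t_bounds(4)[OF s(1)], of z] zj by simp
      moreover have "(\<tau> + \<eta> * s) * 2 ^ Suc j - 1 = \<eta> * s * 2 ^ Suc j"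
        by (simp add: distrib_right \<tau>(3) del: power_Suc)
      moreover have "\<eta> * s * 2 ^ Suc j \<noteq> 0" using \<eta>(1) s(2) by simp
      ultimately show ?thesis by (simp add: bump_def del: power_Suc)
    qed
    have C_curve: "C (\<tau> + \<eta> * s) \<in> V" and H_curve: "H (\<tau> + \<eta> * s) \<in> V" if s: "\<bar>s\<bar> \<le> 1" for s
    proof -
      let ?t = "\<tau> + \<eta> * s"
      have t: "?t \<in> {0..1}" "?t \<in> {0<..}" using t_bounds[OF s] by auto
      have "dist ?t \<tau> < d1" "dist ?t \<tau> < d2" using t_bounds(3)[OF s] \<eta>(2,3) by (auto simp: dist_real_def)
      then have "dist (C ?t) ?q < e" "dist (H ?t) ?q < e" using d1(2) d2(2) t(2) C_q by (auto simp: H_def)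
      moreover have "C ?t \<in> curve z" "H ?t \<in> curve z"
        using t scaled_profile_bounds(1)[OF z t(1)] by (auto simp: C_def H_def plane_pt_in_curve_iff)
      ultimately show "C ?t \<in> V" "H ?t \<in> V" using e(2) by (auto simp: dist_commute)
    qed
    show False
    proof (rule no_triod_in_line[OF V(3)])
      show "continuous_on {0..1} (\<lambda>s. H (\<tau> + \<eta> * s))" "continuous_on {0..1} (\<lambda>s. H (\<tau> + \<eta> * (- s)))"
        unfolding H_def by (intro continuous_intros)+
      show "continuous_on {0..1} (\<lambda>s. C (\<tau> + \<eta> * s))"
        by (rule continuous_on_compose2[OF cC]) (use t_bounds in \<open>auto intro!: continuous_intros\<close>)
      show "(\<lambda>s. H (\<tau> + \<eta> * s)) ` {0..1} \<subseteq> V" "(\<lambda>s. C (\<tau> + \<eta> * s)) ` {0..1} \<subseteq> V"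
        using H_curve C_curve by auto
      show "(\<lambda>s. H (\<tau> + \<eta> * (- s))) ` {0..1} \<subseteq> V"
        using H_curve[of "- _"] by auto
      show "H (\<tau> + \<eta> * 0) = ?q" "H (\<tau> + \<eta> * (- 0)) = ?q" "C (\<tau> + \<eta> * 0) = ?q"
        using C_q by (auto simp: H_def)
      show "H (\<tau> + \<eta> * 1) \<noteq> ?q" "H (\<tau> + \<eta> * (- 1)) \<noteq> ?q" "C (\<tau> + \<eta> * 1) \<noteq> ?q"
        using \<eta>(1) by (auto simp: H_def C_def)
      fix s s' :: real assume s: "s \<in> {0<..1}" "s' \<in> {0<..1}"
      have "\<eta> * s > 0" "\<eta> * s' > 0" using s \<eta>(1) by auto
      moreover have "(1 - (\<tau> + \<eta> * s)) * profile z (\<tau> + \<eta> * s) \<noteq> 1 - (\<tau> + \<eta> * s)"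
      proof -
        have "1 - (\<tau> + \<eta> * s) \<noteq> 0" "profile z (\<tau> + \<eta> * s) \<noteq> 1"
          using prof[of s] t_bounds(2)[of s] s by auto
        then show ?thesis by simp
      qed
      ultimately show "H (\<tau> + \<eta> * s) \<noteq> H (\<tau> + \<eta> * (- s')) \<and> H (\<tau> + \<eta> * s) \<noteq> C (\<tau> + \<eta> * s') \<and>
          H (\<tau> + \<eta> * (- s)) \<noteq> C (\<tau> + \<eta> * s')"
        unfolding H_def C_def plane_pt_eq_iff by auto
    qed
  qed
qed

text \<open>Open sets of reals are locally connected, but the curve is not so at height
  \<open>e/4\<close> of the left edge. Peaks with \<open>z j \<ge> e\<close> have points arbitrarily
  near, and a connected set joining them to \<open>q\<close> would cross valleys, where the curve
  lies only at height 0 or on the hypotenuse.\<close>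

lemma not_locally_line_oscillating:
  assumes z: "z \<in> unit_box" and lim: "\<not> z \<longlonglongrightarrow> 0"
  obtains q where "q \<in> curve z" "\<not> locally_line (curve z) q"
proof -
  obtain e where e: "e > 0" "\<And>n. \<exists>j\<ge>n. z j \<ge> e"
  proof -
    have "\<not> (\<forall>e>0. \<exists>n. \<forall>j\<ge>n. norm (z j - 0) < e)" using lim LIMSEQ_iff by blast
    then obtain e where "e > 0" "\<forall>n. \<exists>j\<ge>n. \<not> norm (z j - 0) < e" by blast
    moreover have "norm (z j - 0) = z j" for j using z by (simp add: unit_box_def)
    ultimately show thesis using that[of e] by (auto simp: not_less)
  qed
  have e1: "e \<le> 1" using e(2)[of 0] z by (force simp: unit_box_def intro: order_trans)
  define q where "q = plane_pt 0 (e/4)"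
  have qc: "q \<in> curve z" using e(1) e1 by (simp add: q_def plane_pt_in_curve_iff)
  have "\<not> locally_line (curve z) q"
  proof
    assume "locally_line (curve z) q"
    then obtain V and I :: "real set" where V: "openin (top_of_set (curve z)) V" "q \<in> V" "open I" "V homeomorphic I"
      unfolding locally_line_def by blast
    have "locally connected I" by (rule open_imp_locally_connected[OF V(3)])
    then have lc: "locally connected V"
      using homeomorphic_locally[OF V(4), of connected connected] homeomorphic_connectedness by blast
    \<comment> \<open>A valley with abscissa below \<open>1/4\<close> carries only height 0 and a
      height above \<open>3/4\<close>. \<open>O'\<close> excludes both, while it contains
      \<open>q\<close> because \<open>e \<le> 1\<close>.\<close>
    define O' where "O' = {x :: nat \<Rightarrow> real. x 0 < 1/4 \<and> 0 < x 1 \<and> x 1 < 1/2}"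
    have "open O'" unfolding O'_def by (intro open_Collect_conj open_Collect_less continuous_intros)
    then have "openin (top_of_set V) (V \<inter> O')" by (rule openin_open_Int)
    moreover have "q \<in> V \<inter> O'" using V(2) e(1) e1 by (simp add: q_def O'_def)
    ultimately obtain U C where U: "openin (top_of_set V) U" "connected C" "q \<in> U" "U \<subseteq> C" "C \<subseteq> V \<inter> O'"
      using lc unfolding locally_def by meson
    have "openin (top_of_set (curve z)) U" using U(1) V(1) openin_trans by blast
    then obtain r where r: "r > 0" "ball q r \<inter> curve z \<subseteq> U" using U(3) unfolding openin_contains_ball by blast
    have "continuous_on UNIV (\<lambda>t. plane_pt t (e/4))" by (intro continuous_intros)
    then obtain d where d: "d > 0" "\<forall>t. dist t 0 < d \<longrightarrow> dist (plane_pt t (e/4)) q < r"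
      unfolding continuous_on_iff q_def using r(1) by (metis UNIV_I)
    have "(1/2::real) < 1" by simp
    then obtain n where n: "(1/2)^n < d" using real_arch_pow_inv[OF d(1)] by blast
    obtain j where j: "j \<ge> n" "z j \<ge> e" using e(2) by blast
    define \<tau> where "\<tau> = (1/2::real) ^ Suc j"
    have \<tau>: "0 < \<tau>" "\<tau> \<le> 1/2" "\<tau> < d"
    proof -
      show "0 < \<tau>" by (simp add: \<tau>_def)
      show "\<tau> \<le> 1/2" unfolding \<tau>_def using power_decreasing[of 1 "Suc j" "1/2::real"] by simp
      have "\<tau> \<le> (1/2)^n" unfolding \<tau>_def using j(1) by (intro power_decreasing) auto
      then show "\<tau> < d" using n by simp
    qed
    \<comment> \<open>The left flank of peak \<open>j\<close> rises from height 0 at the valley to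
      at least \<open>e/2\<close>, as \<open>1 - \<tau> \<ge> 1/2\<close>; hence it passes through
      height \<open>e/4\<close>.\<close>
    have "\<exists>t. 3/4 * \<tau> \<le> t \<and> t \<le> \<tau> \<and> (1 - t) * profile z t = e/4"
    proof (rule IVT')
      show "(1 - 3/4 * \<tau>) * profile z (3/4 * \<tau>) \<le> e/4"
        using profile_valley[of z j] e(1) by (simp add: \<tau>_def)
      have "1/2 * e \<le> (1 - \<tau>) * z j" using \<tau> j(2) e(1) by (intro mult_mono) auto
      then show "e/4 \<le> (1 - \<tau>) * profile z \<tau>" using profile_peak[of z j] e(1) by (simp add: \<tau>_def)
      show "continuous_on {3/4 * \<tau>..\<tau>} (\<lambda>t. (1 - t) * profile z t)"
        using \<tau>(1) by (intro continuous_intros continuous_on_subset[OF continuous_on_profile]) auto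
    qed (use \<tau>(1) in auto)
    then obtain t where t: "3/4 * \<tau> \<le> t" "t \<le> \<tau>" "(1 - t) * profile z t = e/4" by blast
    have t0: "t > 0" "t \<le> 1" "dist t 0 < d" using t(1,2) \<tau> by auto
    then have "plane_pt t (e/4) \<in> curve z" using t(3) e(1) e1 by (simp add: plane_pt_in_curve_iff)
    moreover have "plane_pt t (e/4) \<in> ball q r" using d(2) t0(3) by (simp add: dist_commute)
    ultimately have "plane_pt t (e/4) \<in> C" using r(2) U(4) by blast
    then have tC: "t \<in> (\<lambda>x. x 0) ` C" by (rule image_eqI[rotated]) simp
    have "q \<in> C" using U(3,4) by blast
    then have qC: "0 \<in> (\<lambda>x. x 0) ` C" by (rule image_eqI[rotated]) (simp add: q_def)
    have "connected ((\<lambda>x. x 0) ` C)" by (intro connected_continuous_image U(2) continuous_intros)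
    obtain k where k: "(1/2)^k < t" using real_arch_pow_inv[OF t0(1) \<open>(1/2::real) < 1\<close>] by blast
    \<comment> \<open>A valley between 0 and \<open>t\<close>. Both of these are abscissas of points
      of the connected set \<open>C\<close>, so \<open>C\<close> has a point over the
      valley.\<close>
    define \<sigma> where "\<sigma> = 3/4 * (1/2::real) ^ Suc k"
    have "\<sigma> = 3/8 * (1/2) ^ k" "0 < (1/2::real) ^ k" by (simp_all add: \<sigma>_def)
    then have \<sigma>: "0 < \<sigma>" "\<sigma> < t" using k by linarith+
    have "\<sigma> \<in> (\<lambda>x. x 0) ` C"
      using connectedD_interval[OF \<open>connected ((\<lambda>x. x 0) ` C)\<close> qC tC] \<sigma> by simp
    then obtain x where x: "x \<in> C" "x 0 = \<sigma>" by blast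
    have "x \<in> curve z" "x \<in> O'" using x(1) U(5) openin_imp_subset[OF V(1)] by auto
    then obtain s where s: "x = plane_pt \<sigma> s" using x(2) curve_eq_plane_pt by metis
    have "s = 0 \<or> s = 1 - \<sigma>"
      using \<open>x \<in> curve z\<close> \<sigma>(1) profile_valley[of z k] unfolding s plane_pt_in_curve_iff by (auto simp: \<sigma>_def)
    then show False using \<open>x \<in> O'\<close> by (auto simp: O'_def s)
  qed
  then show ?thesis using that qc by blast
qed

section \<open>Curves homeomorphic to the circle\<close>

lemma homogeneous_homeomorphic:
  assumes "S homeomorphic T" "homogeneous T" shows "homogeneous S"
  unfolding homogeneous_def
proof (intro ballI)
  fix x y assume xy: "x \<in> S" "y \<in> S"
  obtain f g where fg: "homeomorphism S T f g" using assms(1) homeomorphic_def by blast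
  then have "f x \<in> T" "f y \<in> T" using xy by (auto simp: homeomorphism_def)
  then obtain h k where hk: "homeomorphism T T h k" "h (f x) = f y"
    using assms(2) unfolding homogeneous_def by blast
  have "homeomorphism S S (g \<circ> (h \<circ> f)) ((g \<circ> k) \<circ> f)"
    by (rule homeomorphism_compose[OF homeomorphism_compose[OF fg hk(1)] homeomorphism_symD[OF fg]])
  moreover have "(g \<circ> (h \<circ> f)) x = y" using hk(2) fg xy by (simp add: homeomorphism_def)
  ultimately show "\<exists>h g. homeomorphism S S h g \<and> h x = y" by blast
qed

lemma homogeneous_circle: "homogeneous (sphere (0::complex) 1)"
  unfolding homogeneous_def
proof (intro ballI)
  fix x y :: complex assume xy: "x \<in> sphere 0 1" "y \<in> sphere 0 1"
  then have nz: "x \<noteq> 0" "y \<noteq> 0" by auto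
  have "homeomorphism (sphere 0 1) (sphere 0 1) (\<lambda>w. w * (y / x)) (\<lambda>w. w * (x / y))"
    by (rule homeomorphismI) (use xy nz in \<open>auto simp: norm_mult norm_divide intro!: continuous_intros\<close>)
  moreover have "x * (y / x) = y" using nz by simp
  ultimately show "\<exists>h g. homeomorphism (sphere 0 1) (sphere 0 1) h g \<and> h x = y"
    by (intro exI conjI)
qed

text \<open>\<open>lim\<close> makes the graph \<open>\<alpha>\<close> continuous up to the left
  edge, hence an arc, and \<open>less\<close> keeps it off the hypotenuse \<open>\<beta>\<close>
  except at \<open>plane_pt 1 0\<close>. Together with the left edge \<open>\<gamma>\<close> they
  form a simple closed curve.\<close>

lemma homogeneous_curve:
  assumes z: "z \<in> unit_box" and lim: "z \<longlonglongrightarrow> 0" and less: "\<And>j. z j < 1"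
  shows "homogeneous (curve z)"
proof -
  define \<alpha> where "\<alpha> t = plane_pt t ((1 - t) * profile z t)" for t
  define \<beta> where "\<beta> t = plane_pt (1 - t) t" for t
  define \<gamma> where "\<gamma> t = plane_pt 0 (1 - t)" for t
  have prof: "profile z t < 1" for t
  proof (rule profile_cases[of t])
    fix j assume "\<And>z. profile z t = z j * bump j t"
    then show ?thesis using mult_left_le[OF bump_bounds(2), of "z j" j t] z less[of j] by (simp add: unit_box_def)
  qed simp
  have lt: "(1 - t) * profile z t < 1 - t" if "t < 1" for t
    using mult_strict_left_mono[OF prof[of t], of "1 - t"] that by simp
  have "continuous_on {0..1} (profile z)"
    by (rule continuous_on_subset[OF continuous_on_profile_null[OF z lim]]) auto
  then have "path \<alpha>" unfolding path_def \<alpha>_def by (intro continuous_intros)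
  then have "arc \<alpha>" unfolding arc_def by (auto simp: \<alpha>_def intro!: inj_onI)
  have "path \<beta>" "path \<gamma>" unfolding path_def \<beta>_def \<gamma>_def by (intro continuous_intros)+
  then have "arc \<beta>" "arc \<gamma>" unfolding arc_def by (auto simp: \<beta>_def \<gamma>_def intro!: inj_onI)
  have ends: "pathstart \<alpha> = plane_pt 0 0" "pathfinish \<alpha> = plane_pt 1 0"
    "pathstart \<beta> = plane_pt 1 0" "pathfinish \<beta> = plane_pt 0 1"
    "pathstart \<gamma> = plane_pt 0 1" "pathfinish \<gamma> = plane_pt 0 0"
    by (simp_all add: pathstart_def pathfinish_def \<alpha>_def \<beta>_def \<gamma>_def)
  have arc2: "arc (\<beta> +++ \<gamma>)"
    by (rule arc_join[OF \<open>arc \<beta>\<close> \<open>arc \<gamma>\<close>]) (auto simp: ends path_image_def \<beta>_def \<gamma>_def)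
  have "path_image \<alpha> \<inter> path_image (\<beta> +++ \<gamma>) \<subseteq> {plane_pt 0 0, plane_pt 1 0}"
  proof
    fix x assume "x \<in> path_image \<alpha> \<inter> path_image (\<beta> +++ \<gamma>)"
    then have "x \<in> \<alpha> ` {0..1}" "x \<in> \<beta> ` {0..1} \<union> \<gamma> ` {0..1}"
      by (simp_all add: path_image_join ends) (simp_all add: path_image_def)
    then obtain t u where t: "x = \<alpha> t" "t \<in> {0..1}" and u: "x = \<beta> u \<or> x = \<gamma> u" "u \<in> {0..1}"
      by blast
    from u(1) show "x \<in> {plane_pt 0 0, plane_pt 1 0}"
    proof
      assume "x = \<beta> u"
      then have "(1 - t) * profile z t = 1 - t" using t(1) by (auto simp: \<alpha>_def \<beta>_def)
      then have "t = 1" using lt[of t] t(2) by force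
      then show ?thesis using t(1) by (simp add: \<alpha>_def)
    next
      assume "x = \<gamma> u"
      then have "t = 0" using t(1) by (simp add: \<alpha>_def \<gamma>_def)
      then show ?thesis using t(1) by (simp add: \<alpha>_def)
    qed
  qed
  then have "simple_path (\<alpha> +++ (\<beta> +++ \<gamma>))"
    by (intro simple_path_join_loop \<open>arc \<alpha>\<close> arc2) (simp_all add: ends)
  then have "path_image (\<alpha> +++ (\<beta> +++ \<gamma>)) homeomorphic sphere (0::complex) 1"
    by (rule homeomorphic_simple_path_image_circle) (simp_all add: ends)
  moreover have "path_image (\<alpha> +++ (\<beta> +++ \<gamma>)) = curve z"
  proof -
    have img: "path_image (\<alpha> +++ (\<beta> +++ \<gamma>)) = \<alpha> ` {0..1} \<union> (\<beta> ` {0..1} \<union> \<gamma> ` {0..1})"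
      by (subst path_image_join; simp add: ends path_image_join) (simp add: path_image_def)
    have "\<alpha> t \<in> curve z" "\<beta> t \<in> curve z" "\<gamma> t \<in> curve z" if "t \<in> {0..1}" for t
      using that scaled_profile_bounds(1)[OF z that] by (auto simp: \<alpha>_def \<beta>_def \<gamma>_def plane_pt_in_curve_iff)
    moreover have "x \<in> \<alpha> ` {0..1} \<union> (\<beta> ` {0..1} \<union> \<gamma> ` {0..1})" if x: "x \<in> curve z" for x
    proof -
      obtain t s where ts: "x = plane_pt t s" using x curve_ex_plane_pt by blast
      have *: "t \<in> {0..1}" "s \<in> {0..1}" "t = 0 \<or> s = (1 - t) * profile z t \<or> s = 1 - t"
        using x unfolding ts plane_pt_in_curve_iff by auto
      from *(3) consider "x = \<gamma> (1 - s)" | "x = \<alpha> t" | "x = \<beta> (1 - t)"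
        by (auto simp: ts \<alpha>_def \<beta>_def \<gamma>_def)
      then show ?thesis
      proof cases
        case 1 then show ?thesis using *(2) by (intro UnI2 image_eqI[of _ _ "1 - s"]) auto
      next
        case 2 then show ?thesis using *(1) by (intro UnI1 image_eqI[of _ _ t]) auto
      next
        case 3 then show ?thesis using *(1) by (intro UnI2 UnI1 image_eqI[of _ _ "1 - t"]) auto
      qed
    qed
    ultimately show ?thesis unfolding img by blast
  qed
  ultimately have "curve z homeomorphic sphere (0::complex) 1" by simp
  then show ?thesis by (rule homogeneous_homeomorphic[OF _ homogeneous_circle])
qed

lemma homogeneous_curve_iff:
  assumes z: "z \<in> unit_box"
  shows "homogeneous (curve z) \<longleftrightarrow> z \<longlonglongrightarrow> 0 \<and> (\<forall>j. z j < 1)"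
proof
  assume hom: "homogeneous (curve z)"
  have all: "locally_line (curve z) q" if "q \<in> curve z" for q
    using homogeneous_locally_line[OF hom locally_line_curve(1)[OF z] that locally_line_curve(2)[OF z]] .
  have "z j < 1" for j
  proof (rule ccontr)
    assume "\<not> z j < 1"
    then have "z j = 1" using z by (auto simp: unit_box_def intro: antisym)
    then show False using all not_locally_line_touching_peak[OF z] by blast
  qed
  moreover have "z \<longlonglongrightarrow> 0" using all not_locally_line_oscillating[OF z] by metis
  ultimately show "z \<longlonglongrightarrow> 0 \<and> (\<forall>j. z j < 1)" by blast
qed (use homogeneous_curve[OF z] in blast)

section \<open>Embedding the space of null sequences\<close>

text \<open>Positive and negative parts are put at separate positions, so that all parameters of \<^const>\<open>curve\<close>
  are nonnegative.\<close>

definition split_sign :: "(nat \<Rightarrow> real) \<Rightarrow> nat \<Rightarrow> real" where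
  "split_sign y k = max 0 (if even k then y (k div 2) else - y (k div 2))"

lemma split_sign_even_odd: "split_sign y (2 * k) = max 0 (y k)" "split_sign y (Suc (2 * k)) = max 0 (- y k)"
  by (auto simp: split_sign_def)

lemma split_sign_in_unit_box: "y \<in> sym_box \<Longrightarrow> split_sign y \<in> unit_box"
  unfolding unit_box_def sym_box_def split_sign_def by (auto simp: abs_le_iff)

lemma continuous_on_split_sign: "continuous_on A (\<lambda>y. split_sign y k)"
  unfolding split_sign_def by (cases "even k") (auto intro!: continuous_intros)

lemma split_sign_inject: "split_sign y = split_sign y' \<Longrightarrow> y = y'"
proof
  fix k assume "split_sign y = split_sign y'"
  then have "max 0 (y k) = max 0 (y' k)" "max 0 (- y k) = max 0 (- y' k)"
    by (metis split_sign_even_odd)+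
  then show "y k = y' k" by (auto simp: max_def split: if_splits)
qed

lemma split_sign_tendsto_0_iff: "split_sign y \<longlonglongrightarrow> 0 \<longleftrightarrow> y \<longlonglongrightarrow> 0"
proof
  assume s: "split_sign y \<longlonglongrightarrow> 0"
  have "strict_mono (\<lambda>k::nat. 2 * k)" "strict_mono (\<lambda>k::nat. Suc (2 * k))" by (auto simp: strict_mono_def)
  from this[THEN LIMSEQ_subseq_LIMSEQ[OF s]]
  have "(\<lambda>k. max 0 (y k) - max 0 (- y k)) \<longlonglongrightarrow> 0 - 0"
    by (intro tendsto_diff) (simp_all add: o_def split_sign_even_odd)
  moreover have "max 0 (y k) - max 0 (- y k) = y k" for k by (simp add: max_def)
  ultimately show "y \<longlonglongrightarrow> 0" by simp
next
  assume y: "y \<longlonglongrightarrow> 0"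
  have "filterlim (\<lambda>k::nat. k div 2) sequentially sequentially"
    by (rule filterlim_at_top_div_const_nat) simp
  then have "(\<lambda>k. y (k div 2)) \<longlonglongrightarrow> 0" by (rule filterlim_compose[OF y])
  then have "(\<lambda>k. \<bar>y (k div 2)\<bar>) \<longlonglongrightarrow> 0" by (rule tendsto_rabs_zero)
  then show "split_sign y \<longlonglongrightarrow> 0"
    by (rule tendsto_0_le[where K = 1]) (auto simp: split_sign_def intro!: always_eventually)
qed

lemma split_sign_less_1_iff: "(\<forall>j. split_sign y j < 1) \<longleftrightarrow> (\<forall>k. \<bar>y k\<bar> < 1)"
proof
  assume "\<forall>j. split_sign y j < 1"
  then have "max 0 (y k) < 1" "max 0 (- y k) < 1" for k by (metis split_sign_even_odd)+
  then show "\<forall>k. \<bar>y k\<bar> < 1" by (simp add: abs_less_iff)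
qed (auto simp: split_sign_def abs_less_iff)

lemma homogeneous_curve_split_sign_iff:
  assumes "y \<in> sym_box" shows "homogeneous (curve (split_sign y)) \<longleftrightarrow> y \<in> unit_c0"
  by (simp add: homogeneous_curve_iff split_sign_in_unit_box assms split_sign_tendsto_0_iff
      split_sign_less_1_iff unit_c0_def c0_def)

lemma unit_c0_subset_sym_box: "unit_c0 \<subseteq> sym_box"
  by (auto simp: unit_c0_def sym_box_def less_imp_le)

lemma compact_sym_box: "compact sym_box"
proof -
  have "continuous_on (cube \<infinity>) (\<lambda>x i. 2 * x i - 1)"
    by (intro continuous_on_coordinatewise_then_product continuous_intros)
  then have "compact ((\<lambda>x i. 2 * x i - 1) ` cube \<infinity>)"
    using compact_cube compact_continuous_image by blast
  moreover have "(\<lambda>x i. 2 * x i - 1) ` cube \<infinity> = sym_box"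
  proof
    show "sym_box \<subseteq> (\<lambda>x i. 2 * x i - 1) ` cube \<infinity>"
    proof
      fix y assume y: "y \<in> sym_box"
      have "- 1 \<le> y i \<and> y i \<le> 1" for i using y by (simp add: sym_box_def abs_le_iff minus_le_iff)
      then have "0 \<le> y i + 1 \<and> y i + 1 \<le> 2" for i by (smt (verit))
      then have "(\<lambda>i. (y i + 1) / 2) \<in> cube \<infinity>" by (auto simp: cube_def)
      then show "y \<in> (\<lambda>x i. 2 * x i - 1) ` cube \<infinity>" by (rule image_eqI[rotated]) (simp add: field_simps)
    qed
  qed (auto simp: cube_def sym_box_def abs_le_iff)
  ultimately show ?thesis by simp
qed

lemma curve_in_subcontinua:
  assumes "2 \<le> n" "z \<in> unit_box" shows "curve z \<in> subcontinua (cube n)"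
proof -
  have "cube 2 \<subseteq> cube n" using assms(1) by (auto simp: cube_def dest: order_trans)
  moreover have "curve z \<subseteq> cube 2" by (auto simp: curve_def)
  moreover have "compact (curve z)"
    using compact_Int_closed[OF compact_cube[of 2] closed_curve[OF assms(2) compact_imp_closed[OF compact_cube]]]
      calculation(2) by (simp add: Int_absorb1)
  moreover have "curve z \<noteq> {}" using locally_line_curve(1)[OF assms(2)] by blast
  ultimately show ?thesis
    using connected_curve[OF assms(2)] by (auto simp: subcontinua_def nonempty_compacts_def)
qed

lemma continuous_curve:
  assumes n: "2 \<le> n"
  shows "continuous_map (top_of_set sym_box) (continuum_hyperspace (cube n)) (\<lambda>y. curve (split_sign y))"
proof (rule continuous_map_into_continuum_hyperspace)
  show sub: "curve (split_sign y) \<in> subcontinua (cube n)" if "y \<in> sym_box" for y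
    by (intro curve_in_subcontinua n split_sign_in_unit_box that)
  fix y and e :: real assume y: "y \<in> sym_box" and e: "e > 0"
  obtain d where d: "d > 0"
    "\<And>t s t' s'. \<lbrakk>t \<in> {0..1}; s \<in> {0..1}; t' \<in> {0..1}; s' \<in> {0..1}; dist (t, s) (t', s') < d\<rbrakk>
      \<Longrightarrow> dist (plane_pt t s) (plane_pt t' s') \<le> e/2"
    by (rule ex_plane_pt_modulus[of "e/2"]) (use e in auto)
  have "(1/2::real) < 1" by simp
  then obtain M where M: "(1/2)^M < d" using real_arch_pow_inv[OF d(1)] by blast
  define U where "U = (\<Inter>j\<in>{..<M}. {y'. \<bar>split_sign y j - split_sign y' j\<bar> < d})"
  have "open U"
    unfolding U_def by (intro open_INT ballI finite_lessThan open_Collect_less continuous_intros continuous_on_split_sign)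
  moreover have "hausdorff_dist (curve (split_sign y)) (curve (split_sign y')) < e" if y': "y' \<in> sym_box \<inter> U" for y'
  proof -
    have b: "split_sign y \<in> unit_box" "split_sign y' \<in> unit_box" using split_sign_in_unit_box y y' by auto
    have *: "curve (split_sign a) \<noteq> {} \<and> bounded (curve (split_sign a))" if "a \<in> sym_box" for a
      using sub[OF that] by (auto simp: subcontinua_def nonempty_compacts_def compact_imp_bounded)
    have 1: "\<bar>split_sign y j - split_sign y' j\<bar> < d" "\<bar>split_sign y' j - split_sign y j\<bar> < d" if "j < M" for j
      using y' that by (auto simp: U_def abs_minus_commute)
    have "hausdorff_dist (curve (split_sign y)) (curve (split_sign y')) \<le> e/2"
      using * y y' e
      by (intro hausdorff_dist_leI_dist curve_near[OF b(1,2) M 1(1) d(2)] curve_near[OF b(2,1) M 1(2) d(2)]) auto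
    then show ?thesis using e by simp
  qed
  moreover have "y \<in> U" using d(1) by (auto simp: U_def)
  ultimately show "\<exists>U. openin (top_of_set sym_box) U \<and> y \<in> U \<and>
      (\<forall>y'\<in>U. hausdorff_dist (curve (split_sign y)) (curve (split_sign y')) < e)"
    using y by (intro exI[of _ "sym_box \<inter> U"]) (auto simp: openin_open_Int)
qed

text \<open>Each coordinate undergoes the homeomorphism \<open>x / (1 + \<bar>x\<bar>)\<close> of
  the line onto the open interval from -1 to 1. It fixes 0, so by continuity in both directions null
  sequences correspond to null sequences.\<close>

lemma c0_homeomorphic_unit_c0: "c0 homeomorphic unit_c0"
proof -
  have pos: "1 + \<bar>x\<bar> \<noteq> 0" "1 + \<bar>x\<bar> > 0" for x :: real by auto
  have "homeomorphism c0 unit_c0 (\<lambda>x i. x i / (1 + \<bar>x i\<bar>)) (\<lambda>y i. y i / (1 - \<bar>y i\<bar>))"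
  proof (rule homeomorphismI)
    show "continuous_on c0 (\<lambda>x i. x i / (1 + \<bar>x i\<bar>))"
      using pos(1) by (intro continuous_on_coordinatewise_then_product continuous_intros) auto
    have "1 - \<bar>y i\<bar> \<noteq> 0" if "y \<in> unit_c0" for y i
      using that by (auto simp: unit_c0_def dest: spec[of _ i])
    then show "continuous_on unit_c0 (\<lambda>y i. y i / (1 - \<bar>y i\<bar>))"
      by (intro continuous_on_coordinatewise_then_product continuous_intros) auto
    show "(\<lambda>x i. x i / (1 + \<bar>x i\<bar>)) ` c0 \<subseteq> unit_c0"
    proof clarify
      fix x assume "x \<in> c0"
      then have x: "x \<longlonglongrightarrow> 0" by (simp add: c0_def)
      have "(\<lambda>i. x i / (1 + \<bar>x i\<bar>)) \<longlonglongrightarrow> 0 / (1 + \<bar>0\<bar>)" by (intro tendsto_intros x) simp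
      moreover have "\<bar>x i / (1 + \<bar>x i\<bar>)\<bar> < 1" for i
        using pos(2)[of "x i"] by (simp add: abs_divide)
      ultimately show "(\<lambda>i. x i / (1 + \<bar>x i\<bar>)) \<in> unit_c0" by (simp add: unit_c0_def c0_def)
    qed
    show "(\<lambda>y i. y i / (1 - \<bar>y i\<bar>)) ` unit_c0 \<subseteq> c0"
    proof clarify
      fix y assume "y \<in> unit_c0"
      then have y: "y \<longlonglongrightarrow> 0" by (simp add: unit_c0_def c0_def)
      have "(\<lambda>i. y i / (1 - \<bar>y i\<bar>)) \<longlonglongrightarrow> 0 / (1 - \<bar>0\<bar>)" by (intro tendsto_intros y) simp
      then show "(\<lambda>i. y i / (1 - \<bar>y i\<bar>)) \<in> c0" by (simp add: c0_def)
    qed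
    fix x :: "nat \<Rightarrow> real"
    have "x i / (1 + \<bar>x i\<bar>) / (1 - \<bar>x i / (1 + \<bar>x i\<bar>)\<bar>) = x i" for i
    proof -
      have "1 - \<bar>x i / (1 + \<bar>x i\<bar>)\<bar> = 1 / (1 + \<bar>x i\<bar>)" using pos(2)[of "x i"] by (simp add: abs_divide field_simps)
      then show ?thesis using pos(1)[of "x i"] by simp
    qed
    then show "(\<lambda>i. x i / (1 + \<bar>x i\<bar>) / (1 - \<bar>x i / (1 + \<bar>x i\<bar>)\<bar>)) = x" by (rule ext)
  next
    fix y assume "y \<in> unit_c0"
    then have y: "1 - \<bar>y i\<bar> > 0" for i by (simp add: unit_c0_def)
    have "y i / (1 - \<bar>y i\<bar>) / (1 + \<bar>y i / (1 - \<bar>y i\<bar>)\<bar>) = y i" for i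
    proof -
      have "1 + \<bar>y i / (1 - \<bar>y i\<bar>)\<bar> = 1 / (1 - \<bar>y i\<bar>)" using y[of i] by (simp add: abs_divide field_simps)
      then show ?thesis using y[of i] by simp
    qed
    then show "(\<lambda>i. y i / (1 - \<bar>y i\<bar>) / (1 + \<bar>y i / (1 - \<bar>y i\<bar>)\<bar>)) = y" by (rule ext)
  qed
  then show ?thesis by (auto simp: homeomorphic_def)
qed

lemma gdelta_sigma_in_continuous_map_preimage:
  assumes f: "continuous_map X Y f" and A: "gdelta_sigma_in Y A"
  shows "gdelta_sigma_in X {x \<in> topspace X. f x \<in> A}"
proof -
  have pre: "gdelta_in X {x \<in> topspace X. f x \<in> G}" if "gdelta_in Y G" for G
  proof -
    obtain C :: "nat \<Rightarrow> _" where C: "\<And>n. openin Y (C n)" "\<And>n. C (Suc n) \<subseteq> C n" "\<Inter>(range C) = G"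
      using \<open>gdelta_in Y G\<close> unfolding gdelta_in_descending by blast
    show ?thesis
      unfolding gdelta_in_descending
    proof (intro exI[of _ "\<lambda>n. {x \<in> topspace X. f x \<in> C n}"] conjI allI)
      show "openin X {x \<in> topspace X. f x \<in> C n}" for n
        by (rule openin_continuous_map_preimage[OF f C(1)])
      show "{x \<in> topspace X. f x \<in> C (Suc n)} \<subseteq> {x \<in> topspace X. f x \<in> C n}" for n
        using C(2)[of n] by blast
      show "(\<Inter>n. {x \<in> topspace X. f x \<in> C n}) = {x \<in> topspace X. f x \<in> G}"
        unfolding C(3)[symmetric] by auto
    qed
  qed
  obtain \<U> where \<U>: "countable \<U>" "\<And>U. U \<in> \<U> \<Longrightarrow> gdelta_in Y U" "\<Union>\<U> = A"
    using A by (auto simp: gdelta_sigma_in_def union_of_def)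
  have "\<Union>((\<lambda>U. {x \<in> topspace X. f x \<in> U}) ` \<U>) = {x \<in> topspace X. f x \<in> A}" using \<U>(3) by auto
  then show ?thesis
    unfolding gdelta_sigma_in_def union_of_def
    using \<U>(1,2) pre by (intro exI[of _ "(\<lambda>U. {x \<in> topspace X. f x \<in> U}) ` \<U>"]) auto
qed

theorem theorem6:
  fixes n :: enat
  assumes "2 \<le> n"
  shows "analytic_in (continuum_hyperspace (cube n)) (homogeneous_continua (cube n))
    \<and> (\<exists>F. closedin (subtopology (continuum_hyperspace (cube n)) (homogeneous_continua (cube n))) F
          \<and> subtopology (continuum_hyperspace (cube n)) F homeomorphic_space top_of_set c0)
    \<and> \<not> gdelta_sigma_in (continuum_hyperspace (cube n)) (homogeneous_continua (cube n))"
proof (intro conjI)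
  let ?C = "continuum_hyperspace (cube n)" and ?H = "homogeneous_continua (cube n)"
  let ?f = "\<lambda>y. curve (split_sign y)"
  show "analytic_in ?C ?H" by (intro analytic_homogeneous_continua compact_cube)
  have cont: "continuous_map (top_of_set sym_box) ?C ?f" by (rule continuous_curve[OF assms])
  have mem: "?f y \<in> ?H \<longleftrightarrow> y \<in> unit_c0" if "y \<in> sym_box" for y
    using curve_in_subcontinua[OF assms split_sign_in_unit_box[OF that]]
      homogeneous_curve_split_sign_iff[OF that] by (simp add: homogeneous_continua_def)
  have "Hausdorff_space ?C"
    unfolding continuum_hyperspace_def hyperspace_def
    by (intro Hausdorff_space_subtopology Metric_space.Hausdorff_space_mtopology Metric_space_hausdorff_dist)
  moreover have "compact_space (top_of_set sym_box)"
    using compact_sym_box by (simp add: compact_space_subtopology)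
  ultimately have closed: "closed_map (top_of_set sym_box) ?C ?f"
    using continuous_imp_closed_map cont by blast
  have "inj_on ?f sym_box"
  proof (rule inj_onI)
    fix y y' assume "y \<in> sym_box" "y' \<in> sym_box" "?f y = ?f y'"
    then show "y = y'" using split_sign_inject[OF curve_inject] split_sign_in_unit_box by blast
  qed
  then have "embedding_map (top_of_set sym_box) ?C ?f"
    by (intro injective_closed_imp_embedding_map cont closed) simp
  then have "homeomorphic_map (top_of_set sym_box) (subtopology ?C (?f ` sym_box)) ?f"
    by (simp add: embedding_map_def)
  then have "homeomorphic_map (subtopology (top_of_set sym_box) unit_c0)
      (subtopology (subtopology ?C (?f ` sym_box)) (?f ` unit_c0)) ?f"
  proof (rule homeomorphic_map_subtopologies)
    show "?f ` (topspace (top_of_set sym_box) \<inter> unit_c0) = topspace (subtopology ?C (?f ` sym_box)) \<inter> ?f ` unit_c0"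
      using unit_c0_subset_sym_box curve_in_subcontinua[OF assms split_sign_in_unit_box] by auto
  qed
  then have "top_of_set unit_c0 homeomorphic_space subtopology ?C (?f ` unit_c0)"
    using unit_c0_subset_sym_box homeomorphic_map_imp_homeomorphic_space
    by (fastforce simp: subtopology_subtopology Int_absorb1 image_mono)
  moreover have "top_of_set c0 homeomorphic_space top_of_set unit_c0"
  proof -
    obtain g g' where "homeomorphism c0 unit_c0 g g'"
      using c0_homeomorphic_unit_c0 by (auto simp: homeomorphic_def)
    then have "homeomorphic_maps (top_of_set c0) (top_of_set unit_c0) g g'"
      unfolding homeomorphic_maps_def homeomorphism_def
      by (auto simp: continuous_map_in_subtopology)
    then show ?thesis by (auto simp: homeomorphic_space_def)
  qed
  ultimately have "subtopology ?C (?f ` unit_c0) homeomorphic_space top_of_set c0"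
    by (meson homeomorphic_space_sym homeomorphic_space_trans)
  moreover have "closedin (subtopology ?C ?H) (?f ` unit_c0)"
  proof -
    have "closedin ?C (?f ` sym_box)" using closed by (simp add: closed_map_def)
    then have "closedin (subtopology ?C ?H) (?H \<inter> ?f ` sym_box)" by (rule closedin_subtopology_Int_closed)
    moreover have "?H \<inter> ?f ` sym_box = ?f ` unit_c0" using mem unit_c0_subset_sym_box by blast
    ultimately show ?thesis by simp
  qed
  ultimately show "\<exists>F. closedin (subtopology ?C ?H) F \<and> subtopology ?C F homeomorphic_space top_of_set c0"
    by blast
  show "\<not> gdelta_sigma_in ?C ?H"
  proof
    assume "gdelta_sigma_in ?C ?H"
    \<comment> \<open>The Borel class is pulled back along the continuous \<open>?f\<close>, and the
      preimage of the homogeneous continua is exactly \<open>unit_c0\<close>.\<close>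
    then have "gdelta_sigma_in (top_of_set sym_box) {y \<in> topspace (top_of_set sym_box). ?f y \<in> ?H}"
      by (rule gdelta_sigma_in_continuous_map_preimage[OF cont])
    moreover have "{y \<in> topspace (top_of_set sym_box). ?f y \<in> ?H} = unit_c0"
      using mem unit_c0_subset_sym_box by auto
    ultimately show False using unit_c0_not_gdelta_sigma_in by simp
  qed
qed

end
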